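(* Let $\Omega\subseteq\mathbb{R}^n$ be open (not necessarily bounded). Let $(u,v)$ be a weak solution in $\Omega$ of $$\operatorname{div}\big(a(|\nabla u|)\nabla u\big)=F_1(u,v),\qquad \operatorname{div}\big(b(|\nabla v|)\nabla v\big)=F_2(u,v),$$ with $u,v\in C^2(\Omega)$ and $\nabla u,\nabla v\in W^{1,2}_{loc}(\Omega)$. Suppose that the monotonicity condition $u_n>0$, $v_n<0$ holds and that $F_{12}(u,v)\ge 0$. Then $$\int_\Omega\Big[\lambda_1(|\nabla u|)\,\big|\nabla_{L_{u,x}}|\nabla u|\big|^2+\lambda_2(|\nabla u|)|\nabla u|^2\sum_{l=1}^{n-1}k_{l,u}^2\Big]\varphi^2\,dx+\int_\Omega\Big[\gamma_1(|\nabla v|)\,\big|\nabla_{L_{v,x}}|\nabla v|\big|^2+\gamma_2(|\nabla v|)|\nabla v|^2\sum_{l=1}^{n-1}k_{l,v}^2\Big]\varphi^2\,dx$$ $$\le\int_\Omega|\nabla u|^2\,(A(\nabla u)\nabla\varphi)\cdot\nabla\varphi\,dx+\int_\Omega|\nabla v|^2\,(B(\nabla v)\nabla\varphi)\cdot\nabla\varphi\,dx$$ for every locally Lipschitz function $\varphi:\Omega\to\mathbb{R}$ whose support is compact and contained in $\Omega$.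
   Context: $F\in C^{1,1}_{loc}(\mathbb{R}^2)$; $F_1,F_2$ are its first partial derivatives and $F_{11},F_{12},F_{22}$ its second partial derivatives, which exist off a Borel set of zero Lebesgue measure; the condition $F_{12}(u,v)\ge0$ is understood at points where $F_{12}$ exists. $a,b\in C^1((0,+\infty))$ satisfy $a(t)>0$, $b(t)>0$, $a(t)+a'(t)t>0$, $b(t)+b'(t)t>0$ for all $t>0$. For $\xi\neq0$, $$A_{hk}(\xi)=\frac{a'(|\xi|)}{|\xi|}\xi_h\xi_k+a(|\xi|)\delta_{hk},\qquad B_{hk}(\xi)=\frac{b'(|\xi|)}{|\xi|}\xi_h\xi_k+b(|\xi|)\delta_{hk}.$$ For $t>0$: $\lambda_1(t)=a(t)+a'(t)t$, $\lambda_2(t)=a(t)$, $\gamma_1(t)=b(t)+b'(t)t$, $\gamma_2(t)=b(t)$. Weak solution in $\Omega$: $\int_\Omega a(|\nabla u|)\nabla u\cdot\nabla\phi+F_1(u,v)\phi\,dx=0$ and $\int_\Omega b(|\nabla v|)\nabla v\cdot\nabla\psi+F_2(u,v)\psi\,dx=0$ for all $\phi,\psi\in C_0^\infty(\Omega)$. $u_n=\partial u/\partial x_n$, $v_n=\partial v/\partial x_n$. For a $C^1$ function $w$, $L_{w,x}=\{y:w(y)=w(x)\}$. Where $\nabla w(x)\ne0$, $L_{w,x}$ is a hypersurface near $x$ and the tangential gradient of $f$ is $\nabla_{L_{w,x}}f(x)=\nabla f(x)-\big(\nabla f(x)\cdot\frac{\nabla w(x)}{|\nabla w(x)|}\big)\frac{\nabla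 w(x)}{|\nabla w(x)|}$; $k_{1,w},\dots,k_{n-1,w}$ are the principal curvatures of $L_{w,x}$ (evaluated at $x$ in the integrals). *)

theory Defs
  imports "HOL-Analysis.Analysis" "HOL-Library.Multiset"
begin

subsection \<open>Partial derivatives and regularity classes\<close>

definition has_partial :: "'n::finite \<Rightarrow> (real^'n \<Rightarrow> real) \<Rightarrow> real^'n \<Rightarrow> bool" where
  "has_partial i f x \<longleftrightarrow> (\<lambda>t. f (x + t *\<^sub>R axis i 1)) differentiable (at 0)"

definition partial :: "'n::finite \<Rightarrow> (real^'n \<Rightarrow> real) \<Rightarrow> real^'n \<Rightarrow> real" where
  "partial i f x = deriv (\<lambda>t. f (x + t *\<^sub>R axis i 1)) 0"

definition grad :: "(real^'n::finite \<Rightarrow> real) \<Rightarrow> real^'n \<Rightarrow> real^'n" where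
  "grad f x = (\<chi> i. partial i f x)"

text \<open>\<open>Ck k \<Omega> f\<close>: \<open>f\<close> is of class \<open>C\<^sup>k\<close> on the open set \<open>\<Omega>\<close>. The values of \<open>f\<close> outside
  \<open>\<Omega>\<close> play no role.\<close>

fun Ck :: "nat \<Rightarrow> (real^'n::finite) set \<Rightarrow> (real^'n \<Rightarrow> real) \<Rightarrow> bool" where
  "Ck 0 \<Omega> f \<longleftrightarrow> continuous_on \<Omega> f"
| "Ck (Suc k) \<Omega> f \<longleftrightarrow> (\<forall>x\<in>\<Omega>. f differentiable (at x)) \<and> (\<forall>i. Ck k \<Omega> (partial i f))"

definition locally_lipschitz_on :: "'a::metric_space set \<Rightarrow> ('a \<Rightarrow> 'b::metric_space) \<Rightarrow> bool" where
  "locally_lipschitz_on S f \<longleftrightarrow> (\<forall>x\<in>S. \<exists>r>0. \<exists>C. C-lipschitz_on (ball x r \<inter> S) f)"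

definition C11_loc :: "(real^'n::finite \<Rightarrow> real) \<Rightarrow> bool" where
  "C11_loc F \<longleftrightarrow> Ck 1 UNIV F \<and> (\<forall>i. locally_lipschitz_on UNIV (partial i F))"

definition compact_support_in :: "'a::topological_space set \<Rightarrow> ('a \<Rightarrow> real) \<Rightarrow> bool" where
  "compact_support_in \<Omega> f \<longleftrightarrow>
     compact (closure {x\<in>\<Omega>. f x \<noteq> 0}) \<and> closure {x\<in>\<Omega>. f x \<noteq> 0} \<subseteq> \<Omega>"

definition test_functions :: "(real^'n::finite) set \<Rightarrow> (real^'n \<Rightarrow> real) set" where
  "test_functions \<Omega> = {\<phi>. (\<forall>k. Ck k \<Omega> \<phi>) \<and> compact_support_in \<Omega> \<phi>}"


subsection \<open>Local Sobolev functions\<close>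

definition L2_loc :: "(real^'n::finite) set \<Rightarrow> (real^'n \<Rightarrow> real) \<Rightarrow> bool" where
  "L2_loc \<Omega> f \<longleftrightarrow> (\<forall>K. compact K \<and> K \<subseteq> \<Omega> \<longrightarrow>
     set_borel_measurable lebesgue K f \<and> set_integrable lebesgue K (\<lambda>x. (f x)\<^sup>2))"

definition weak_partial ::
    "(real^'n::finite) set \<Rightarrow> 'n \<Rightarrow> (real^'n \<Rightarrow> real) \<Rightarrow> (real^'n \<Rightarrow> real) \<Rightarrow> bool" where
  "weak_partial \<Omega> i f g \<longleftrightarrow> (\<forall>\<phi>\<in>test_functions \<Omega>.
     (LINT x:\<Omega>|lebesgue. f x * partial i \<phi> x) = - (LINT x:\<Omega>|lebesgue. g x * \<phi> x))"

definition W12_loc :: "(real^'n::finite) set \<Rightarrow> (real^'n \<Rightarrow> real) \<Rightarrow> bool" where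
  "W12_loc \<Omega> f \<longleftrightarrow> L2_loc \<Omega> f \<and> (\<forall>i. \<exists>g. L2_loc \<Omega> g \<and> weak_partial \<Omega> i f g)"


subsection \<open>The equations\<close>

text \<open>\<open>G x\<close> stands for the right-hand side of \<open>div (a(|\<nabla>w|) \<nabla>w) = G\<close> at \<open>x\<close>.\<close>

definition weak_solution ::
    "(real^'n::finite) set \<Rightarrow> (real \<Rightarrow> real) \<Rightarrow> (real^'n \<Rightarrow> real) \<Rightarrow> (real^'n \<Rightarrow> real) \<Rightarrow> bool" where
  "weak_solution \<Omega> a w G \<longleftrightarrow> (\<forall>\<phi>\<in>test_functions \<Omega>.
     set_integrable lebesgue \<Omega>
       (\<lambda>x. a (norm (grad w x)) * (grad w x \<bullet> grad \<phi> x) + G x * \<phi> x) \<and>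
     (LINT x:\<Omega>|lebesgue. a (norm (grad w x)) * (grad w x \<bullet> grad \<phi> x) + G x * \<phi> x) = 0)"

text \<open>A point \<open>(s, t)\<close> of the plane is \<open>vector [s, t] :: real^2\<close>, with coordinates indexed by
  \<open>1\<close> and \<open>2\<close>.\<close>

definition weak_solution_system ::
    "(real^'n::finite) set \<Rightarrow> (real \<Rightarrow> real) \<Rightarrow> (real \<Rightarrow> real) \<Rightarrow> (real^2 \<Rightarrow> real) \<Rightarrow>
     (real^'n \<Rightarrow> real) \<Rightarrow> (real^'n \<Rightarrow> real) \<Rightarrow> bool" where
  "weak_solution_system \<Omega> a b F u v \<longleftrightarrow>
     weak_solution \<Omega> a u (\<lambda>x. partial 1 F (vector [u x, v x])) \<and>
     weak_solution \<Omega> b v (\<lambda>x. partial 2 F (vector [u x, v x]))"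

definition coeff_matrix :: "(real \<Rightarrow> real) \<Rightarrow> real^'n::finite \<Rightarrow> real^'n^'n" where
  "coeff_matrix a \<xi> = (\<chi> h k. deriv a (norm \<xi>) / norm \<xi> * \<xi> $ h * \<xi> $ k
                              + a (norm \<xi>) * (if h = k then 1 else 0))"

definition eig1 :: "(real \<Rightarrow> real) \<Rightarrow> real \<Rightarrow> real" where
  "eig1 a t = a t + deriv a t * t"

definition eig2 :: "(real \<Rightarrow> real) \<Rightarrow> real \<Rightarrow> real" where
  "eig2 a t = a t"


subsection \<open>Geometry of the level sets\<close>

text \<open>All notions below concern the level set of \<open>w\<close> through a point \<open>x\<close> at which
  \<open>grad w x \<noteq> 0\<close>.\<close>

definition unit_normal :: "(real^'n::finite \<Rightarrow> real) \<Rightarrow> real^'n \<Rightarrow> real^'n" where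
  "unit_normal w x = grad w x /\<^sub>R norm (grad w x)"

definition tangential_grad ::
    "(real^'n::finite \<Rightarrow> real) \<Rightarrow> (real^'n \<Rightarrow> real) \<Rightarrow> real^'n \<Rightarrow> real^'n" where
  "tangential_grad w f x = grad f x - (grad f x \<bullet> unit_normal w x) *\<^sub>R unit_normal w x"

definition tangent_space :: "(real^'n::finite \<Rightarrow> real) \<Rightarrow> real^'n \<Rightarrow> (real^'n) set" where
  "tangent_space w x = {X. X \<bullet> grad w x = 0}"

text \<open>On the tangent space, \<open>X \<mapsto> shape_matrix w x *v X\<close> is the Weingarten map \<open>- D\<^sub>X \<nu>\<close> of the level
  set, where the unit normal field \<open>\<nu> = \<nabla>w / |\<nabla>w|\<close> is defined in a full neighbourhood of \<open>x\<close>.\<close>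

definition shape_matrix :: "(real^'n::finite \<Rightarrow> real) \<Rightarrow> real^'n \<Rightarrow> real^'n^'n" where
  "shape_matrix w x = (\<chi> i j. - partial j (\<lambda>y. unit_normal w y $ i) x)"

text \<open>The principal curvatures are the eigenvalues of the Weingarten map on the tangent space,
  repeated according to their multiplicity. For \<open>w\<close> of class \<open>C\<^sup>2\<close> near \<open>x\<close> this map is
  self-adjoint, so that the multiset has exactly \<open>n - 1\<close> elements.\<close>

definition curvature_space :: "(real^'n::finite \<Rightarrow> real) \<Rightarrow> real^'n \<Rightarrow> real \<Rightarrow> (real^'n) set" where
  "curvature_space w x \<kappa> = {X \<in> tangent_space w x. shape_matrix w x *v X = \<kappa> *\<^sub>R X}"

definition principal_curvatures :: "(real^'n::finite \<Rightarrow> real) \<Rightarrow> real^'n \<Rightarrow> real multiset" where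
  "principal_curvatures w x = Abs_multiset (\<lambda>\<kappa>. dim (curvature_space w x \<kappa>))"

lemma eigenvectors_combination_eq_0:
  fixes M :: "real^'n::finite^'n" and X :: "real \<Rightarrow> real^'n"
  assumes "finite K"
    and "\<And>\<kappa>. \<kappa> \<in> K \<Longrightarrow> X \<kappa> \<noteq> 0 \<and> M *v X \<kappa> = \<kappa> *\<^sub>R X \<kappa>"
    and "(\<Sum>\<kappa>\<in>K. c \<kappa> *\<^sub>R X \<kappa>) = 0"
  shows "\<forall>\<kappa>\<in>K. c \<kappa> = 0"
  using assms
proof (induction K arbitrary: c rule: finite_induct)
  case empty
  then show ?case by simp
next
  case (insert \<mu> K)
  have sum0: "c \<mu> *\<^sub>R X \<mu> + (\<Sum>\<kappa>\<in>K. c \<kappa> *\<^sub>R X \<kappa>) = 0"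
    using insert by simp
  have "M *v (\<Sum>\<kappa>\<in>insert \<mu> K. c \<kappa> *\<^sub>R X \<kappa>) = (\<Sum>\<kappa>\<in>insert \<mu> K. c \<kappa> *\<^sub>R (M *v X \<kappa>))"
    by (simp add: linear_sum[OF matrix_vector_mul_linear] matrix_vector_mult_scaleR)
  also have "\<dots> = (\<Sum>\<kappa>\<in>insert \<mu> K. (c \<kappa> * \<kappa>) *\<^sub>R X \<kappa>)"
    by (rule sum.cong) (use insert.prems(1) in auto)
  finally have "(c \<mu> * \<mu>) *\<^sub>R X \<mu> + (\<Sum>\<kappa>\<in>K. (c \<kappa> * \<kappa>) *\<^sub>R X \<kappa>) = 0"
    using insert by simp
  moreover have "(c \<mu> * \<mu>) *\<^sub>R X \<mu> + (\<Sum>\<kappa>\<in>K. (c \<kappa> * \<mu>) *\<^sub>R X \<kappa>) = 0"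
    using arg_cong[OF sum0, of "\<lambda>y. \<mu> *\<^sub>R y"]
    by (simp add: scaleR_add_right scaleR_sum_right mult.commute)
  ultimately have "(\<Sum>\<kappa>\<in>K. (c \<kappa> * \<kappa>) *\<^sub>R X \<kappa>) = (\<Sum>\<kappa>\<in>K. (c \<kappa> * \<mu>) *\<^sub>R X \<kappa>)"
    by (metis add_left_cancel)
  then have "(\<Sum>\<kappa>\<in>K. (c \<kappa> * (\<kappa> - \<mu>)) *\<^sub>R X \<kappa>) = 0"
    by (simp add: right_diff_distrib scaleR_left_diff_distrib sum_subtractf)
  then have "\<forall>\<kappa>\<in>K. c \<kappa> * (\<kappa> - \<mu>) = 0"
    using insert.IH[of "\<lambda>\<kappa>. c \<kappa> * (\<kappa> - \<mu>)"] insert.prems(1) by blast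
  then have *: "\<forall>\<kappa>\<in>K. c \<kappa> = 0"
    using insert.hyps(2) by auto
  with sum0 have "c \<mu> *\<^sub>R X \<mu> = 0" by simp
  with * show ?case using insert.prems(1) by auto
qed

text \<open>The multiplicity function above has finite support, so \<open>Abs_multiset\<close> is applied legitimately.\<close>

lemma count_principal_curvatures:
  "count (principal_curvatures w x) \<kappa> = dim (curvature_space w x \<kappa>)"
proof -
  let ?E = "{\<kappa>. 0 < dim (curvature_space w x \<kappa>)}"
  have "\<forall>\<kappa>\<in>?E. \<exists>X. X \<in> curvature_space w x \<kappa> \<and> X \<noteq> 0"
    by (auto simp: dim_eq_0 simp flip: neq0_conv)
  then obtain X where X: "\<And>\<kappa>. \<kappa> \<in> ?E \<Longrightarrow> X \<kappa> \<in> curvature_space w x \<kappa> \<and> X \<kappa> \<noteq> 0"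
    by metis
  then have X': "\<And>\<kappa>. \<kappa> \<in> ?E \<Longrightarrow> X \<kappa> \<noteq> 0 \<and> shape_matrix w x *v X \<kappa> = \<kappa> *\<^sub>R X \<kappa>"
    by (simp add: curvature_space_def)
  have inj: "inj_on X ?E"
    by (rule inj_onI) (metis X' scaleR_right_imp_eq)
  have "card K \<le> DIM(real^'a)" if K: "finite K" "K \<subseteq> ?E" for K
  proof -
    have injK: "inj_on X K" using inj K(2) inj_on_subset by blast
    have "independent (X ` K)"
    proof (rule independent_if_scalars_zero)
      fix f y assume f: "(\<Sum>y\<in>X ` K. f y *\<^sub>R y) = 0" and y: "y \<in> X ` K"
      have "(\<Sum>\<kappa>\<in>K. f (X \<kappa>) *\<^sub>R X \<kappa>) = 0"
        using f by (simp add: sum.reindex[OF injK])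
      then have "\<forall>\<kappa>\<in>K. f (X \<kappa>) = 0"
        using eigenvectors_combination_eq_0[OF K(1), of X "shape_matrix w x" "\<lambda>\<kappa>. f (X \<kappa>)"] X' K(2)
        by blast
      with y show "f y = 0" by auto
    qed (use K in simp)
    then show ?thesis
      using independent_card_le[of "X ` K"] card_image[OF injK] by simp
  qed
  then have "finite ?E"
    by (meson finite_if_finite_subsets_card_bdd)
  then show ?thesis
    by (simp add: principal_curvatures_def Abs_multiset_inverse)
qed

end

theory Submission
  imports Defs
begin

text \<open>
  The second variation argument. Write \<open>g = F\<^sub>1(u, v)\<close> and \<open>h = F\<^sub>2(u, v)\<close>. Because the gradients do
  not vanish, the field \<open>a(|\<nabla>u|) \<nabla>u\<close> is of class \<open>C\<^sup>1\<close> and the equations hold pointwise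
  (\<open>divergence_eq_if_weak\<close>). They can therefore be differentiated in a weak sense, with compactly
  supported Lipschitz test functions (\<open>linearized_equation\<close>). Testing the derivative in the direction
  \<open>j\<close> with \<open>u\<^sub>j \<phi>\<^sup>2\<close>, summing over \<open>j\<close>, and testing the derivative in the direction \<open>n\<close> with
  \<open>|\<nabla>u|\<^sup>2 \<phi>\<^sup>2 / u\<^sub>n\<close>, one gets the inequality for \<open>u\<close> alone, with the additional term
  \<open>\<integral> (\<nabla>g \<bullet> \<nabla>u - g\<^sub>n |\<nabla>u|\<^sup>2 / u\<^sub>n) \<phi>\<^sup>2\<close> on the left (\<open>poincare_inequality_with_remainder\<close>); likewise for
  \<open>v\<close>. The pointwise ingredients are that \<open>A(\<nabla>u)\<close> is positive definite, in the form of a Picone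
  inequality (\<open>picone_pointwise\<close>), and that the part of the Hessian tangential to a level set is the
  Weingarten map multiplied by \<open>|\<nabla>u|\<close> up to sign (\<open>curvature_terms_le\<close>).

  The sum of the two additional integrands is nonnegative almost everywhere. Where \<open>\<nabla>u\<close> and \<open>\<nabla>v\<close> are
  linearly independent, \<open>(u, v)\<close> is a submersion and pulls null sets back to null sets
  (\<open>negligible_vimage_rank_2\<close>). By Rademacher's theorem \<open>\<nabla>F\<close> is then differentiable at \<open>(u, v)\<close> almost
  everywhere, its differential is symmetric (\<open>second_derivative_symmetric\<close>), and the chain rule
  turns the sum into \<open>F\<^sub>1\<^sub>2 |v\<^sub>n \<nabla>u - u\<^sub>n \<nabla>v|\<^sup>2 \<phi>\<^sup>2 / (u\<^sub>n |v\<^sub>n|) \<ge> 0\<close> (\<open>coupling_sign\<close>). Where they are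
  dependent, \<open>\<nabla>v\<close> is a multiple of \<open>\<nabla>u\<close>, and so are \<open>\<nabla>g\<close> and \<open>\<nabla>h\<close> almost everywhere
  (\<open>coupling_rank_1\<close>); both integrands vanish there, whatever happens to the second derivatives of
  \<open>F\<close>.

  The analysis behind this is Rademacher's theorem, together with integration by parts for Lipschitz
  functions. Both rest on Lebesgue's theorem that a Lipschitz function of one variable is
  differentiable almost everywhere (\<open>lipschitz_differentiable_negligible\<close>), which follows from
  Vitali's covering theorem; Fubini's theorem carries it to lines in several variables, and
  translation invariance of Lebesgue measure replaces the fundamental theorem of calculus.
\<close>

section \<open>Lipschitz functions of one variable\<close>

text \<open>Vitali's covering theorem for intervals \<open>ball c r\<close> with a property \<open>P\<close> that occurs at all
  small scales, relative to an open set.\<close>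

lemma vitali_ball_union:
  fixes S U :: "real set"
  assumes U: "open U" "S \<subseteq> U"
    and cov: "\<And>x d. x \<in> S \<Longrightarrow> 0 < d \<Longrightarrow> \<exists>c r. x \<in> ball c r \<and> r < d \<and> P c r"
  obtains C where "countable C" "\<And>c r. (c, r) \<in> C \<Longrightarrow> P c r"
    "disjoint_family_on (\<lambda>i. ball (fst i) (snd i)) C" "(\<Union>i\<in>C. ball (fst i) (snd i)) \<subseteq> U"
    "negligible (S - (\<Union>i\<in>C. ball (fst i) (snd i)))"
proof -
  define K where "K = {(c, r). P c r \<and> ball c r \<subseteq> U}"
  have "\<exists>i. i \<in> K \<and> x \<in> ball (fst i) (snd i) \<and> snd i < d" if "x \<in> S" "0 < d" for x d
  proof -
    obtain e where e: "0 < e" "ball x e \<subseteq> U"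
      using U \<open>x \<in> S\<close> openE[of U x] by blast
    obtain c r where cr: "x \<in> ball c r" "r < min d (e/2)" "P c r"
      using cov[OF \<open>x \<in> S\<close>, of "min d (e/2)"] \<open>0 < d\<close> e by auto
    have "ball c r \<subseteq> ball x e"
    proof
      fix y assume "y \<in> ball c r"
      then show "y \<in> ball x e"
        using cr dist_triangle[of x y c] by (auto simp: dist_commute)
    qed
    then show ?thesis using cr e by (intro exI[of _ "(c, r)"]) (auto simp: K_def)
  qed
  then have K: "\<And>x d. x \<in> S \<Longrightarrow> 0 < d \<Longrightarrow> \<exists>i. i \<in> K \<and> x \<in> ball (fst i) (snd i) \<and> snd i < d" by blast
  obtain C where C: "countable C" "C \<subseteq> K"
     "pairwise (\<lambda>i j. disjnt (ball (fst i) (snd i)) (ball (fst j) (snd j))) C"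
     "negligible (S - (\<Union>i \<in> C. ball (fst i) (snd i)))"
    using Vitali_covering_theorem_balls[of S K fst snd, OF K] by blast
  show ?thesis
  proof (rule that[of C])
    show "disjoint_family_on (\<lambda>i. ball (fst i) (snd i)) C"
      using C(3) unfolding disjoint_family_on_def pairwise_def disjnt_def by blast
    show "(\<Union>i\<in>C. ball (fst i) (snd i)) \<subseteq> U" "\<And>c r. (c, r) \<in> C \<Longrightarrow> P c r"
      using C(2) by (fastforce simp: K_def)+
  qed (use C in simp_all)
qed

lemma emeasure_interval_measure_ball:
  fixes g :: "real \<Rightarrow> real"
  assumes mono: "\<And>x y. x \<le> y \<Longrightarrow> g x \<le> g y" and cont: "continuous_on UNIV g" and "0 < r"
  shows "emeasure (interval_measure g) (ball c r) = ennreal (g (c + r) - g (c - r))"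
proof -
  have contx: "continuous (at_right x) g" "continuous_on {a..b} g" for a b x
    using cont continuous_on_subset[OF cont subset_UNIV] 
    by (auto simp: continuous_on_eq_continuous_within intro: continuous_within_subset)
  have eq: "{c - r<..c + r} = ball c r \<union> {c + r}" using assms by (auto simp: dist_real_def)
  have "ennreal (g (c + r) - g (c - r)) = emeasure (interval_measure g) {c - r<..c + r}"
    using assms(3) by (intro emeasure_interval_measure_Ioc[symmetric] mono contx) auto
  also have "\<dots> = emeasure (interval_measure g) (ball c r) + emeasure (interval_measure g) {c + r}"
    unfolding eq by (intro plus_emeasure[symmetric]) (auto simp: dist_real_def)
  also have "emeasure (interval_measure g) {c + r} = 0"
    using emeasure_interval_measure_Icc[of "c+r" "c+r" g] mono cont by (simp add: atLeastAtMost_singleton)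
  finally show ?thesis by simp
qed

lemma emeasure_ball_union:
  fixes M :: "real measure"
  assumes "sets M = sets borel" "countable C" "disjoint_family_on (\<lambda>i. ball (fst i) (snd i)) C"
  shows "emeasure M (\<Union>i\<in>C. ball (fst i) (snd i)) = (\<integral>\<^sup>+i. emeasure M (ball (fst i) (snd i)) \<partial>count_space C)"
  using assms by (intro emeasure_UN_countable) auto

lemma ennreal_scale_measure_ball_union_le:
  fixes M N :: "real measure"
  assumes "sets M = sets borel" "sets N = sets borel" "countable C"
    "disjoint_family_on (\<lambda>i. ball (fst i) (snd i)) C"
    and le: "\<And>c r. (c, r) \<in> C \<Longrightarrow> 0 < r \<Longrightarrow> p * emeasure M (ball c r) \<le> q * emeasure N (ball c r)"
  shows "p * emeasure M (\<Union>i\<in>C. ball (fst i) (snd i)) \<le> q * emeasure N (\<Union>i\<in>C. ball (fst i) (snd i))"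
proof -
  have "p * emeasure M (ball (fst i) (snd i)) \<le> q * emeasure N (ball (fst i) (snd i))" if "i \<in> C" for i
  proof (cases "0 < snd i")
    case True
    then show ?thesis using le[of "fst i" "snd i"] that by simp
  next
    case False
    then have "ball (fst i) (snd i) = {}" by simp
    then show ?thesis by (simp only: emeasure_empty mult_zero_right order_refl)
  qed
  then show ?thesis
    unfolding emeasure_ball_union[OF assms(1,3,4)] emeasure_ball_union[OF assms(2,3,4)]
    by (auto simp: nn_integral_cmult[symmetric] intro!: nn_integral_mono)
qed

text \<open>Let \<open>S\<close> be a set of points near which the increasing function \<open>g\<close> has difference quotients
  below \<open>p\<close> and above \<open>q > p\<close> at arbitrarily small scales. Cover \<open>S\<close> inside \<open>U\<close> by intervals with
  slope at most \<open>p\<close>, of union \<open>V\<close>, and then inside \<open>V\<close> by intervals with slope at least \<open>q\<close>, of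
  union \<open>W\<close>. If \<open>\<mu>\<close> is the Stieltjes measure of \<open>g\<close> and \<open>\<lambda>\<close> Lebesgue measure, then
  \<open>q \<lambda>(S) \<le> q \<lambda>(W) \<le> \<mu>(W) \<le> \<mu>(V) \<le> p \<lambda>(V) \<le> p \<lambda>(U)\<close>.\<close>

lemma slope_oscillation_emeasure_le:
  fixes g :: "real \<Rightarrow> real"
  assumes mono: "\<And>x y. x \<le> y \<Longrightarrow> g x \<le> g y" and cont: "continuous_on UNIV g"
    and p: "0 \<le> p" "p < q"
    and S: "S \<in> sets borel"
    and lo: "\<And>x d. x \<in> S \<Longrightarrow> 0 < d \<Longrightarrow> \<exists>c r. x \<in> ball c r \<and> r < d \<and> g (c + r) - g (c - r) \<le> p * (2 * r)"
    and hi: "\<And>x d. x \<in> S \<Longrightarrow> 0 < d \<Longrightarrow> \<exists>c r. x \<in> ball c r \<and> r < d \<and> g (c + r) - g (c - r) \<ge> q * (2 * r)"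
    and U: "open U" "S \<subseteq> U"
  shows "ennreal q * emeasure lborel S \<le> ennreal p * emeasure lborel U"
proof -
  define \<mu> where "\<mu> = interval_measure g"
  have sets: "sets \<mu> = sets borel" by (simp add: \<mu>_def)
  have ball: "emeasure \<mu> (ball c r) = ennreal (g (c + r) - g (c - r))" if "0 < r" for c r :: real
    unfolding \<mu>_def by (rule emeasure_interval_measure_ball[OF mono cont that])
  have lball: "emeasure lborel (ball c r) = ennreal (2 * r)" if "0 < r" for c r :: real
  proof -
    have "ball c r = {c - r<..<c + r}" by (auto simp: dist_real_def)
    then show ?thesis using that by simp
  qed
  obtain C where C: "countable C" "\<And>c r. (c, r) \<in> C \<Longrightarrow> g (c + r) - g (c - r) \<le> p * (2 * r)"
    "disjoint_family_on (\<lambda>i. ball (fst i) (snd i)) C" "(\<Union>i\<in>C. ball (fst i) (snd i)) \<subseteq> U"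
    "negligible (S - (\<Union>i\<in>C. ball (fst i) (snd i)))"
    using vitali_ball_union[of U S "\<lambda>c r. g (c + r) - g (c - r) \<le> p * (2 * r)", OF U lo] by blast
  define V where "V = (\<Union>i\<in>C. ball (fst i) (snd i))"
  have V: "open V" unfolding V_def by (intro open_UN ballI open_ball)
  obtain D where D: "countable D" "\<And>c r. (c, r) \<in> D \<Longrightarrow> g (c + r) - g (c - r) \<ge> q * (2 * r)"
    "disjoint_family_on (\<lambda>i. ball (fst i) (snd i)) D" "(\<Union>i\<in>D. ball (fst i) (snd i)) \<subseteq> V"
    "negligible (S \<inter> V - (\<Union>i\<in>D. ball (fst i) (snd i)))"
    using vitali_ball_union[of V "S \<inter> V" "\<lambda>c r. g (c + r) - g (c - r) \<ge> q * (2 * r)", OF V _ hi] by blast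
  define W where "W = (\<Union>i\<in>D. ball (fst i) (snd i))"
  have W: "open W" unfolding W_def by (intro open_UN ballI open_ball)
  have "negligible ((S - V) \<union> (S \<inter> V - W))"
    using C(5) D(5) unfolding V_def[symmetric] W_def[symmetric] by (rule negligible_Un)
  then have neg: "negligible (S - W)" by (rule negligible_subset) auto
  have SW: "S - W \<in> sets lborel" using S W by auto
  then have null: "S - W \<in> null_sets lborel"
    using neg unfolding negligible_iff_null_sets by (simp add: null_sets_completion_iff)
  have "emeasure lborel S \<le> emeasure lborel (W \<union> (S - W))"
    using S W by (intro emeasure_mono) auto
  also have "\<dots> = emeasure lborel W"
    using W null by (intro emeasure_Un_null_set) auto
  finally have "ennreal q * emeasure lborel S \<le> ennreal q * emeasure lborel W"
    by (rule mult_left_mono) simp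
  also have "\<dots> \<le> 1 * emeasure \<mu> W"
    unfolding W_def
  proof (rule ennreal_scale_measure_ball_union_le[OF _ sets D(1,3)])
    fix c r assume "(c, r) \<in> D" "0 < r"
    then show "ennreal q * emeasure lborel (ball c r) \<le> 1 * emeasure \<mu> (ball c r)"
      using D(2)[of c r] p by (simp add: ball lball ennreal_mult[symmetric] ennreal_leI)
  qed simp
  also have "\<dots> \<le> 1 * emeasure \<mu> V" 
    using D(4) V by (intro mult_left_mono emeasure_mono) (auto simp: W_def[symmetric] sets)
  also have "\<dots> \<le> ennreal p * emeasure lborel V"
    unfolding V_def
  proof (rule ennreal_scale_measure_ball_union_le[OF sets _ C(1,3)])
    fix c r assume "(c, r) \<in> C" "0 < r"
    then show "1 * emeasure \<mu> (ball c r) \<le> ennreal p * emeasure lborel (ball c r)"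
      using C(2)[of c r] p by (simp add: ball lball ennreal_mult[symmetric] ennreal_leI)
  qed simp
  also have "\<dots> \<le> ennreal p * emeasure lborel U"
    using C(4) U by (intro mult_left_mono emeasure_mono) (auto simp: V_def[symmetric])
  finally show ?thesis .
qed

lemma slope_oscillation_negligible:
  fixes g :: "real \<Rightarrow> real"
  assumes mono: "\<And>x y. x \<le> y \<Longrightarrow> g x \<le> g y" and cont: "continuous_on UNIV g"
    and p: "0 \<le> p" "p < q"
    and S: "S \<in> sets borel" "bounded S"
    and lo: "\<And>x d. x \<in> S \<Longrightarrow> 0 < d \<Longrightarrow> \<exists>c r. x \<in> ball c r \<and> r < d \<and> g (c + r) - g (c - r) \<le> p * (2 * r)"
    and hi: "\<And>x d. x \<in> S \<Longrightarrow> 0 < d \<Longrightarrow> \<exists>c r. x \<in> ball c r \<and> r < d \<and> g (c + r) - g (c - r) \<ge> q * (2 * r)"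
  shows "negligible S"
proof -
  have key: "ennreal q * emeasure lborel S \<le> ennreal p * emeasure lborel U" if "open U" "S \<subseteq> U" for U
    by (rule slope_oscillation_emeasure_le[of g p q S U]) (fact mono cont p S lo hi that)+
  have fin: "emeasure lborel S < \<infinity>"
    using emeasure_bounded_finite[OF S(2)] by simp
  have "ennreal q * emeasure lborel S \<le> ennreal p * emeasure lborel S + ennreal e" if e: "0 < e" for e :: real
  proof -
    obtain U where U: "open U" "S \<subseteq> U" "emeasure lborel (U - S) < ennreal (e / (p + 1))"
      using outer_regular_lborel[OF S(1), of "e / (p + 1)"] e p by auto
    have "ennreal p * emeasure lborel (U - S) \<le> ennreal p * ennreal (e / (p + 1))"
      using U(3) by (intro mult_left_mono) auto
    also have "\<dots> \<le> ennreal e"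
      using e p by (auto simp: ennreal_mult[symmetric] field_simps intro!: ennreal_leI)
    finally have le: "ennreal p * emeasure lborel (U - S) \<le> ennreal e" .
    have "emeasure lborel U = emeasure lborel S + emeasure lborel (U - S)"
      using U S plus_emeasure[of S lborel "U - S"] by (simp add: Un_absorb1)
    then have "ennreal p * emeasure lborel U = ennreal p * emeasure lborel S + ennreal p * emeasure lborel (U - S)"
      by (simp add: distrib_left)
    also have "\<dots> \<le> ennreal p * emeasure lborel S + ennreal e"
      using le by (intro add_left_mono)
    finally show ?thesis using key[OF U(1,2)] by simp
  qed
  then have "ennreal q * emeasure lborel S \<le> ennreal p * emeasure lborel S"
    by (rule ennreal_le_epsilon)
  moreover have em: "emeasure lborel S = ennreal (measure lborel S)"
    using fin by (simp add: emeasure_eq_ennreal_measure)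
  ultimately have "q * measure lborel S \<le> p * measure lborel S"
    using p by (simp add: ennreal_mult[symmetric])
  then have "measure lborel S = 0"
    using p measure_nonneg[of lborel S] by (auto simp: mult_le_cancel_right not_less)
  then have "S \<in> null_sets lborel"
    using em S by (intro null_setsI) auto
  then show ?thesis
    by (simp add: negligible_iff_null_sets null_sets_completionI)
qed

text \<open>A bounded function without a limit oscillates across a gap between two rational numbers.\<close>

lemma bounded_no_limit_imp_gap:
  fixes Q :: "'a \<Rightarrow> real"
  assumes F: "F \<noteq> bot" and b: "eventually (\<lambda>x. l \<le> Q x \<and> Q x \<le> u) F"
    and no: "\<And>c. \<not> (Q \<longlongrightarrow> c) F"
  obtains p q where "p \<in> \<rat>" "q \<in> \<rat>" "l \<le> p" "p < q" "frequently (\<lambda>x. Q x < p) F" "frequently (\<lambda>x. q < Q x) F"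
proof -
  define L where "L = Liminf F (\<lambda>x. ereal (Q x))"
  define U where "U = Limsup F (\<lambda>x. ereal (Q x))"
  have "ereal l \<le> L" unfolding L_def using b by (intro Liminf_bounded) (auto elim: eventually_mono)
  have "U \<le> ereal u" unfolding U_def using b by (intro Limsup_bounded) (auto elim: eventually_mono)
  have LU: "L \<le> U" unfolding L_def U_def using F by (rule Liminf_le_Limsup)
  have "L \<noteq> U"
  proof
    assume "L = U"
    then have "\<bar>L\<bar> \<noteq> \<infinity>" using \<open>ereal l \<le> L\<close> \<open>U \<le> ereal u\<close> by auto
    then obtain c where c: "L = ereal c" by auto
    then have "((\<lambda>x. ereal (Q x)) \<longlongrightarrow> ereal c) F"
      using \<open>L = U\<close> F unfolding L_def U_def by (intro Liminf_eq_Limsup) auto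
    then show False using no by simp
  qed
  with LU have "L < U" by simp
  then obtain m where m: "L < ereal m" "ereal m < U" using ereal_dense2 by blast
  obtain m' where m': "ereal m < ereal m'" "ereal m' < U" using ereal_dense2[OF m(2)] by blast
  obtain m2 where m2: "L < ereal m2" "ereal m2 < ereal m" using ereal_dense2[OF m(1)] by blast
  obtain p where p: "p \<in> \<rat>" "m2 < p" "p < m" using Rats_dense_in_real m2 by (metis ereal_less_eq(3) linorder_not_le)
  obtain q where q: "q \<in> \<rat>" "m < q" "q < m'" using Rats_dense_in_real m' by (metis ereal_less_eq(3) linorder_not_le)
  have "frequently (\<lambda>x. Q x < p) F"
  proof (rule ccontr)
    assume "\<not> ?thesis"
    then have "eventually (\<lambda>x. ereal p \<le> ereal (Q x)) F" by (simp add: not_frequently not_less)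
    then have "ereal p \<le> L" unfolding L_def by (rule Liminf_bounded)
    then show False using m2 p by (meson ereal_less_eq(3) le_less_trans less_imp_le linorder_not_le order.strict_trans2)
  qed
  moreover have "frequently (\<lambda>x. q < Q x) F"
  proof (rule ccontr)
    assume "\<not> ?thesis"
    then have "eventually (\<lambda>x. ereal (Q x) \<le> ereal q) F" by (simp add: not_frequently not_less)
    then have "U \<le> ereal q" unfolding U_def by (rule Limsup_bounded)
    then show False using m' q by (meson ereal_less_eq(3) le_less_trans less_imp_le linorder_not_le order.strict_trans2)
  qed
  moreover have "l \<le> p" using \<open>ereal l \<le> L\<close> m2 p by (meson ereal_less_eq(3) le_less_trans less_imp_le linorder_not_le order.strict_trans2)
  ultimately show ?thesis using that p q by simp
qed

text \<open>A strict bound on a one-sided difference quotient at \<open>x\<close> survives a slight enlargement of the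
  interval, which moves \<open>x\<close> into its interior. The sign \<open>s\<close> serves upper and lower bounds alike.\<close>

lemma slope_enlarge_interval:
  fixes g :: "real \<Rightarrow> real"
  assumes cont: "isCont g x" "isCont g (x + h)" and h: "h \<noteq> 0" "\<bar>h\<bar> < d"
    and s: "s * ((g (x + h) - g x) / h) < s * p"
  obtains c r where "x \<in> ball c r" "r < d" "s * (g (c + r) - g (c - r)) \<le> s * p * (2 * r)"
proof -
  define k where "k = \<bar>h\<bar> / 2"
  define c where "c = x + h / 2"
  have k: "0 < k" using h by (simp add: k_def)
  have "s * (g (c + k) - g (c - k)) < s * p * (2 * k)"
  proof (cases "0 < h")
    case True
    have "c + k = x + h" "c - k = x" "2 * k = h" using True by (auto simp: c_def k_def)
    then show ?thesis using s True by (simp add: field_simps)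
  next
    case False
    have "c + k = x" "c - k = x + h" "2 * k = - h" using False by (auto simp: c_def k_def)
    then show ?thesis using s False h by (simp add: field_simps)
  qed
  moreover have "isCont g (c + k)" "isCont g (c - k)"
    using cont h by (auto simp: c_def k_def abs_if add.commute split: if_splits)
  then have "((\<lambda>r. s * p * (2 * r) - s * (g (c + r) - g (c - r))) \<longlongrightarrow> s * p * (2 * k) - s * (g (c + k) - g (c - k))) (at_right k)"
    by (intro tendsto_intros isCont_tendsto_compose[where g = g]) auto
  ultimately have "eventually (\<lambda>r. 0 < s * p * (2 * r) - s * (g (c + r) - g (c - r))) (at_right k)"
    by (intro order_tendstoD(1)) auto
  moreover have "eventually (\<lambda>r. k < r \<and> r < d) (at_right k)"
    using h by (intro eventually_at_right_real[THEN eventually_mono, of k d]) (auto simp: k_def)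
  ultimately have "eventually (\<lambda>r. 0 < s * p * (2 * r) - s * (g (c + r) - g (c - r)) \<and> k < r \<and> r < d) (at_right k)"
    by eventually_elim auto
  then obtain r where r: "0 < s * p * (2 * r) - s * (g (c + r) - g (c - r))" "k < r" "r < d"
    using eventually_happens'[OF trivial_limit_at_right_real] by blast
  then show ?thesis
    by (intro that[of c r]) (auto simp: c_def k_def dist_real_def)
qed

text \<open>Lebesgue's differentiation theorem for Lipschitz functions of one variable. Adding the linear
  function \<open>L x\<close> makes the function increasing; a point of non-differentiability then lies in one of
  the countably many Borel sets \<open>E p q\<close> of points with slopes below \<open>p\<close> and above \<open>q\<close> at all
  scales.\<close>

theorem lipschitz_differentiable_negligible:
  fixes f :: "real \<Rightarrow> real"
  assumes f: "L-lipschitz_on UNIV f"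
  shows "negligible {x. \<not> f differentiable (at x)}"
proof -
  define g where "g = (\<lambda>x. f x + L * x)"
  have fxy: "\<bar>f y - f x\<bar> \<le> L * \<bar>y - x\<bar>" for x y
    using lipschitz_onD[OF f, of y x] by (simp add: dist_real_def)
  have L: "0 \<le> L" using f lipschitz_on_nonneg by blast
  have mono: "g x \<le> g y" if "x \<le> y" for x y
    using fxy[of y x] that L by (simp add: g_def algebra_simps abs_if split: if_splits)
  have cont: "continuous_on UNIV g"
    unfolding g_def using lipschitz_on_continuous_on[OF f] by (intro continuous_intros)
  then have isC: "isCont g x" for x by (simp add: continuous_on_eq_continuous_at)
  define G where "G = (\<lambda>s p d. \<Union>{ball c r |c r. r < d \<and> s * (g (c + r) - g (c - r)) \<le> s * p * (2 * r)})"
  define E where "E = (\<lambda>p q. \<Inter>n::nat. G 1 p (1 / real (Suc n)) \<inter> G (-1) q (1 / real (Suc n)))"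
  have "open (G s p d)" for s p d
    unfolding G_def by (intro open_Union) auto
  then have Eb: "E p q \<in> sets borel" for p q unfolding E_def by auto
  have neg: "negligible (E p q \<inter> ball 0 (real n))" if pq: "0 \<le> p" "p < q" for p q n
  proof (rule slope_oscillation_negligible[OF mono cont pq])
    fix x d :: real assume x: "x \<in> E p q \<inter> ball 0 (real n)" and d: "0 < d"
    obtain m where m: "1 / real (Suc m) < d" using d nat_approx_posE by blast
    have "x \<in> G 1 p (1 / real (Suc m))" "x \<in> G (-1) q (1 / real (Suc m))"
      using x by (auto simp: E_def)
    then show "\<exists>c r. x \<in> ball c r \<and> r < d \<and> g (c + r) - g (c - r) \<le> p * (2 * r)"
       "\<exists>c r. x \<in> ball c r \<and> r < d \<and> g (c + r) - g (c - r) \<ge> q * (2 * r)"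
      unfolding G_def using m by (fastforce intro: less_trans)+
  qed (use Eb in auto)
  have "{x. \<not> f differentiable (at x)} \<subseteq> (\<Union>p\<in>\<rat>\<inter>{0..}. \<Union>q\<in>\<rat>\<inter>{p<..}. \<Union>n. E p q \<inter> ball 0 (real n))"
  proof
    fix x assume "x \<in> {x. \<not> f differentiable (at x)}"
    then have nd: "\<not> f differentiable (at x)" by simp
    have no: "\<not> ((\<lambda>h. (g (x + h) - g x) / h) \<longlongrightarrow> c) (at 0)" for c
    proof
      assume "((\<lambda>h. (g (x + h) - g x) / h) \<longlongrightarrow> c) (at 0)"
      then have "(g has_real_derivative c) (at x)" by (simp add: DERIV_def)
      then have "((\<lambda>x. g x - L * x) has_real_derivative c - L) (at x)"
        by (auto intro!: derivative_eq_intros)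
      then have "(f has_real_derivative c - L) (at x)" by (simp add: g_def)
      then show False using nd real_differentiable_def by blast
    qed
    have b: "eventually (\<lambda>h. 0 \<le> (g (x + h) - g x) / h \<and> (g (x + h) - g x) / h \<le> 2 * L) (at 0)"
      unfolding eventually_at_filter
    proof (intro always_eventually allI impI)
      fix h :: real assume "h \<noteq> 0"
      then show "0 \<le> (g (x + h) - g x) / h \<and> (g (x + h) - g x) / h \<le> 2 * L"
        using mono[of x "x + h"] mono[of "x + h" x] fxy[of "x + h" x]
        by (cases "0 < h") (auto simp: g_def field_simps)
    qed
    obtain p q where pq: "p \<in> \<rat>" "q \<in> \<rat>" "0 \<le> p" "p < q"
      and fr: "frequently (\<lambda>h. (g (x + h) - g x) / h < p) (at 0)" "frequently (\<lambda>h. q < (g (x + h) - g x) / h) (at 0)"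
      by (rule bounded_no_limit_imp_gap[OF _ b no]) auto
    have "x \<in> E p q"
      unfolding E_def
    proof (intro INT_I IntI)
      fix n :: nat
      let ?d = "1 / real (Suc n)"
      have ev: "eventually (\<lambda>h::real. h \<noteq> 0 \<and> \<bar>h\<bar> < ?d) (at 0)"
        unfolding eventually_at by (intro exI[of _ ?d]) (auto simp: dist_real_def)
      obtain h where h: "(g (x + h) - g x) / h < p" "h \<noteq> 0" "\<bar>h\<bar> < ?d"
        using frequently_ex[OF frequently_eventually_frequently[OF fr(1) ev]] by blast
      from h obtain c r where "x \<in> ball c r" "r < ?d" "1 * (g (c + r) - g (c - r)) \<le> 1 * p * (2 * r)"
        using slope_enlarge_interval[where g = g and x = x and h = h and d = ?d and s = 1 and p = p] isC by auto
      then show "x \<in> G 1 p ?d" unfolding G_def by blast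
      obtain h where h: "q < (g (x + h) - g x) / h" "h \<noteq> 0" "\<bar>h\<bar> < ?d"
        using frequently_ex[OF frequently_eventually_frequently[OF fr(2) ev]] by blast
      have h': "(-1) * ((g (x + h) - g x) / h) < (-1) * q" using h(1) by linarith
      obtain c r where "x \<in> ball c r" "r < ?d" "(-1) * (g (c + r) - g (c - r)) \<le> (-1) * q * (2 * r)"
        using slope_enlarge_interval[OF isC isC h(2,3) h'] by blast
      then show "x \<in> G (-1) q ?d" unfolding G_def by blast
    qed
    moreover obtain n where "\<bar>x\<bar> < real n" using reals_Archimedean2 by blast
    ultimately show "x \<in> (\<Union>p\<in>\<rat>\<inter>{0..}. \<Union>q\<in>\<rat>\<inter>{p<..}. \<Union>n. E p q \<inter> ball 0 (real n))"
      using pq by auto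
  qed
  moreover have "negligible (\<Union>p\<in>\<rat>\<inter>{0..}. \<Union>q\<in>\<rat>\<inter>{p<..}. \<Union>n. E p q \<inter> ball 0 (real n))"
  proof (intro negligible_countable_Union countable_image countable_Int1 countable_rat)
    fix A assume "A \<in> (\<lambda>p. \<Union>q\<in>\<rat>\<inter>{p<..}. \<Union>n. E p q \<inter> ball 0 (real n)) ` (\<rat>\<inter>{0..})"
    then obtain p where p: "0 \<le> p" "A = (\<Union>q\<in>\<rat>\<inter>{p<..}. \<Union>n. E p q \<inter> ball 0 (real n))" by auto
    show "negligible A"
      unfolding p(2)
    proof (intro negligible_countable_Union countable_image countable_Int1 countable_rat)
      fix B assume "B \<in> (\<lambda>q. \<Union>n. E p q \<inter> ball 0 (real n)) ` (\<rat>\<inter>{p<..})"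
      then obtain q where q: "p < q" "B = (\<Union>n. E p q \<inter> ball 0 (real n))" by auto
      show "negligible B"
        unfolding q(2) using neg[OF p(1) q(1)] by (intro negligible_countable_Union) auto
    qed
  qed
  ultimately show ?thesis by (rule negligible_subset[rotated])
qed

section \<open>Locally Lipschitz functions and cutoffs\<close>

text \<open>Real functions on the whole space that are globally Lipschitz and vanish outside a compact
  set. These are the test functions of the integration theory below.\<close>

definition lipschitz_compact :: "('a::euclidean_space \<Rightarrow> real) \<Rightarrow> bool" where
  "lipschitz_compact f \<longleftrightarrow> (\<exists>L. L-lipschitz_on UNIV f) \<and> (\<exists>K. compact K \<and> (\<forall>x. x \<notin> K \<longrightarrow> f x = 0))"

lemma lipschitz_compactE:
  assumes "lipschitz_compact f"
  obtains L K B where "L-lipschitz_on UNIV f" "continuous_on UNIV f" "compact K" "\<And>x. x \<notin> K \<Longrightarrow> f x = 0"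
    "\<And>x. \<bar>f x\<bar> \<le> B" "0 \<le> B"
proof -
  obtain L K where LK: "L-lipschitz_on UNIV f" "compact K" "\<And>x. x \<notin> K \<Longrightarrow> f x = 0"
    using assms unfolding lipschitz_compact_def by blast
  have c: "continuous_on UNIV f" using LK(1) by (rule lipschitz_on_continuous_on)
  have "compact (f ` K)" by (rule compact_continuous_image[OF continuous_on_subset[OF c] LK(2)]) simp
  then obtain B where "\<forall>y\<in>f ` K. norm y \<le> B" using compact_imp_bounded bounded_iff by blast
  then have "\<bar>f x\<bar> \<le> max 0 B" for x using LK(3)[of x] by (cases "x \<in> K") (auto simp: le_max_iff_disj)
  then show ?thesis using that LK c by (metis max.cobounded1)
qed

lemma compact_infdist_nbhd:
  fixes K :: "'a::euclidean_space set"
  assumes "compact K" "K \<noteq> {}" "open S" "K \<subseteq> S"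
  obtains d where "0 < d" "compact {x. infdist x K \<le> d}" "{x. infdist x K \<le> d} \<subseteq> S"
proof -
  obtain d where "0 < d" "{x. infdist x K \<le> d} \<subseteq> S"
    using compact_in_open_separated[of K S] assms by blast
  then show ?thesis using that compact_infdist_le[of K d] assms by blast
qed

lemma infdist_lipschitz: "\<bar>infdist x K - infdist y K\<bar> \<le> dist x y"
  using infdist_triangle[of x K y] infdist_triangle[of y K x] by (simp add: dist_commute abs_le_iff)

lemma lipschitz_cutoff:
  fixes K :: "'a::euclidean_space set"
  assumes "compact K" "open S" "K \<subseteq> S"
  obtains \<eta> U K' where "lipschitz_compact \<eta>" "open U" "K \<subseteq> U" "\<And>x. x \<in> U \<Longrightarrow> \<eta> x = 1"
    "compact K'" "K' \<subseteq> S" "\<And>x. x \<notin> K' \<Longrightarrow> \<eta> x = 0" "\<And>x. 0 \<le> \<eta> x \<and> \<eta> x \<le> 1" "U \<subseteq> K'"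
proof (cases "K = {}")
  case True
  have "lipschitz_compact (\<lambda>_::'a. 0::real)"
    unfolding lipschitz_compact_def by (intro conjI exI[of _ 0] exI[of _ "{}"] lipschitz_on_constant) auto
  then show ?thesis using True by (intro that[of "\<lambda>_. 0" "{}" "{}"]) auto
next
  case False
  obtain d where d: "0 < d" "compact {x. infdist x K \<le> d}" "{x. infdist x K \<le> d} \<subseteq> S"
    using compact_infdist_nbhd assms False by metis
  define \<eta> where "\<eta> x = max 0 (min 1 (2 - 2 * infdist x K / d))" for x
  have lip: "(2 / d)-lipschitz_on UNIV \<eta>"
  proof (rule lipschitz_onI)
    fix x y
    have "\<bar>\<eta> x - \<eta> y\<bar> \<le> \<bar>2 * infdist x K / d - 2 * infdist y K / d\<bar>"
      unfolding \<eta>_def by linarith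
    also have "2 * infdist x K / d - 2 * infdist y K / d = 2 / d * (infdist x K - infdist y K)"
      by (simp add: right_diff_distrib)
    also have "\<bar>\<dots>\<bar> = 2 / d * \<bar>infdist x K - infdist y K\<bar>"
      using d(1) by (simp only: abs_mult) simp
    also have "\<dots> \<le> 2 / d * dist x y" using d(1) by (intro mult_left_mono infdist_lipschitz) auto
    finally show "dist (\<eta> x) (\<eta> y) \<le> 2 / d * dist x y" by (simp add: dist_real_def)
  qed (use d in auto)
  show ?thesis
  proof (rule that[of \<eta> "{x. infdist x K < d / 2}" "{x. infdist x K \<le> d}"])
    show 0: "\<eta> x = 0" if "x \<notin> {x. infdist x K \<le> d}" for x
    proof -
      have "d < infdist x K" using that by simp
      then have "1 < infdist x K / d" using d(1) by (simp add: less_divide_eq)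
      then show ?thesis unfolding \<eta>_def by simp
    qed
    show "lipschitz_compact \<eta>" unfolding lipschitz_compact_def using lip d(2) 0 by blast
    show "open {x. infdist x K < d / 2}" by (intro open_Collect_less continuous_intros)
    show "K \<subseteq> {x. infdist x K < d / 2}" using d(1) by auto
    show "\<eta> x = 1" if "x \<in> {x. infdist x K < d / 2}" for x
      using that d(1) by (simp add: \<eta>_def field_simps)
    show "{x. infdist x K < d / 2} \<subseteq> {x. infdist x K \<le> d}" using d(1) by auto
  qed (use d in \<open>auto simp: \<eta>_def\<close>)
qed

lemma locally_lipschitz_on_mult:
  fixes f g :: "'a::metric_space \<Rightarrow> real"
  assumes f: "locally_lipschitz_on S f" and g: "locally_lipschitz_on S g"
  shows "locally_lipschitz_on S (\<lambda>x. f x * g x)"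
  unfolding locally_lipschitz_on_def
proof
  fix x assume x: "x \<in> S"
  obtain r L where f: "0 < r" "L-lipschitz_on (ball x r \<inter> S) f" using f x unfolding locally_lipschitz_on_def by blast
  obtain s M where g: "0 < s" "M-lipschitz_on (ball x s \<inter> S) g" using g x unfolding locally_lipschitz_on_def by blast
  have LM: "0 \<le> L" "0 \<le> M" using f g lipschitz_on_nonneg by blast+
  define t where "t = min r s"
  have t: "0 < t" using f g by (simp add: t_def)
  let ?A = "\<bar>f x\<bar> + L * t" and ?B = "\<bar>g x\<bar> + M * t"
  have bf: "\<bar>f y\<bar> \<le> ?A" if "y \<in> ball x t \<inter> S" for y
  proof -
    have "\<bar>f y - f x\<bar> \<le> L * dist y x" using lipschitz_onD[OF f(2), of y x] that x f(1) by (auto simp: dist_real_def t_def)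
    also have "\<dots> \<le> L * t" using that LM by (intro mult_left_mono) (auto simp: dist_commute)
    finally show ?thesis by linarith
  qed
  have bg: "\<bar>g y\<bar> \<le> ?B" if "y \<in> ball x t \<inter> S" for y
  proof -
    have "\<bar>g y - g x\<bar> \<le> M * dist y x" using lipschitz_onD[OF g(2), of y x] that x g(1) by (auto simp: dist_real_def t_def)
    also have "\<dots> \<le> M * t" using that LM by (intro mult_left_mono) (auto simp: dist_commute)
    finally show ?thesis by linarith
  qed
  have "(L * ?B + ?A * M)-lipschitz_on (ball x t \<inter> S) (\<lambda>x. f x * g x)"
  proof (rule lipschitz_onI)
    fix y z assume yz: "y \<in> ball x t \<inter> S" "z \<in> ball x t \<inter> S"
    have "f y * g y - f z * g z = (f y - f z) * g y + f z * (g y - g z)" by (simp add: algebra_simps)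
    then have "\<bar>f y * g y - f z * g z\<bar> \<le> \<bar>f y - f z\<bar> * \<bar>g y\<bar> + \<bar>f z\<bar> * \<bar>g y - g z\<bar>"
      by (metis abs_mult abs_triangle_ineq)
    also have "\<dots> \<le> (L * dist y z) * ?B + ?A * (M * dist y z)"
    proof (intro add_mono mult_mono)
      show "\<bar>f y - f z\<bar> \<le> L * dist y z" "\<bar>g y - g z\<bar> \<le> M * dist y z"
        using yz lipschitz_onD[OF f(2), of y z] lipschitz_onD[OF g(2), of y z] by (auto simp: dist_real_def t_def)
    qed (use LM t bf[OF yz(2)] bg[OF yz(1)] in auto)
    finally show "dist (f y * g y) (f z * g z) \<le> (L * ?B + ?A * M) * dist y z"
      by (simp add: dist_real_def algebra_simps)
  qed (use LM t in auto)
  then show "\<exists>r>0. \<exists>C. C-lipschitz_on (ball x r \<inter> S) (\<lambda>x. f x * g x)" using t by blast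
qed

lemma locally_lipschitz_on_compact:
  fixes f :: "'a::metric_space \<Rightarrow> 'b::metric_space"
  assumes f: "locally_lipschitz_on S f" and K: "compact K" "K \<subseteq> S"
  obtains L where "L-lipschitz_on K f"
proof -
  have "local_lipschitz {0::real} K (\<lambda>_. f)"
  proof (rule local_lipschitzI)
    fix t :: real and x assume "t \<in> {0}" "x \<in> K"
    then obtain r L where r: "0 < r" "L-lipschitz_on (ball x r \<inter> S) f"
      using f K unfolding locally_lipschitz_on_def by blast
    have "L-lipschitz_on (cball x (r/2) \<inter> K) f"
      using r(1) K(2) by (intro lipschitz_on_subset[OF r(2)]) auto
    then show "\<exists>u>0. \<exists>L. \<forall>t\<in>cball t u \<inter> {0}. L-lipschitz_on (cball x u \<inter> K) f"
      using r(1) by (intro exI[of _ "r/2"]) auto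
  qed
  then obtain L where "\<And>t::real. t \<in> {0} \<Longrightarrow> L-lipschitz_on K f"
    using local_lipschitz_compact_implies_lipschitz[where X = K and T = "{0::real}" and f = "\<lambda>_. f"] K by auto
  then show ?thesis using that by blast
qed

text \<open>A locally Lipschitz function on \<open>S\<close> that vanishes off a compact subset of \<open>S\<close> becomes globally
  Lipschitz when it is extended by zero.\<close>

lemma lipschitz_compact_zero_extension:
  fixes f :: "'a::euclidean_space \<Rightarrow> real"
  assumes "open S" and f: "locally_lipschitz_on S f" and K: "compact K" "K \<subseteq> S" "\<And>x. x \<in> S \<Longrightarrow> x \<notin> K \<Longrightarrow> f x = 0"
  shows "lipschitz_compact (\<lambda>x. if x \<in> S then f x else 0)" (is "lipschitz_compact ?f")
proof (cases "K = {}")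
  case True
  then have "?f = (\<lambda>_. 0)" using K by auto
  moreover have "lipschitz_compact (\<lambda>_::'a. 0::real)"
    unfolding lipschitz_compact_def by (intro conjI exI[of _ 0] exI[of _ "{}"] lipschitz_on_constant) auto
  ultimately show ?thesis by simp
next
  case False
  obtain d where d: "0 < d" "compact {x. infdist x K \<le> d}" "{x. infdist x K \<le> d} \<subseteq> S"
    using compact_infdist_nbhd[of K S] assms False by metis
  let ?K = "{x. infdist x K \<le> d}"
  obtain L where L: "L-lipschitz_on ?K f" using locally_lipschitz_on_compact[OF f d(2,3)] by blast
  have KK: "K \<subseteq> ?K" using d(1) by auto
  have L0: "0 \<le> L" using L lipschitz_on_nonneg by blast
  have "continuous_on K f" using lipschitz_on_continuous_on[OF L] KK continuous_on_subset by blast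
  then have "compact (f ` K)" using K(1) compact_continuous_image by blast
  then obtain B where "\<forall>y\<in>f ` K. norm y \<le> B" using compact_imp_bounded bounded_iff by metis
  then have B: "\<And>x. x \<in> K \<Longrightarrow> \<bar>f x\<bar> \<le> B" by simp
  then have B0: "0 \<le> B" using False by (meson abs_ge_zero ex_in_conv order_trans)
  have K0: "?f x = 0" if "x \<notin> K" for x using K(3) that by auto
  have far: "\<bar>?f x - ?f y\<bar> \<le> (L + B / d) * dist x y" if "x \<in> K" for x y
  proof (cases "y \<in> ?K")
    case True
    have "\<bar>?f x - ?f y\<bar> = dist (f x) (f y)" using that True d(3) KK by (auto simp: dist_real_def)
    also have "\<dots> \<le> L * dist x y" using that True KK by (intro lipschitz_onD[OF L]) auto
    also have "\<dots> \<le> (L + B / d) * dist x y" using B0 d(1) by (intro mult_right_mono) auto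
    finally show ?thesis .
  next
    case y: False
    have "?f y = 0" using y KK K0 by blast
    then have "\<bar>?f x - ?f y\<bar> \<le> B" using B[OF that] B0 by auto
    also have "\<dots> = B / d * d" using d(1) by simp
    also have "\<dots> \<le> B / d * dist x y"
    proof (rule mult_left_mono)
      have "infdist y K \<le> dist y x" using that by (rule infdist_le)
      then show "d \<le> dist x y" using y by (simp add: dist_commute)
    qed (use B0 d in auto)
    also have "\<dots> \<le> (L + B / d) * dist x y" using L0 by (intro mult_right_mono) auto
    finally show ?thesis .
  qed
  have "(L + B / d)-lipschitz_on UNIV ?f"
  proof (rule lipschitz_onI)
    fix x y
    show "dist (?f x) (?f y) \<le> (L + B / d) * dist x y"
    proof (cases "x \<in> K \<or> y \<in> K")
      case True
      then show ?thesis using far[of x y] far[of y x] 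
        by (auto simp: dist_real_def dist_commute abs_minus_commute simp del: if_split)
    next
      case False
      then have "dist (?f x) (?f y) = 0" using K0[of x] K0[of y] by (metis dist_self)
      then show ?thesis using L0 B0 d(1) by (metis add_nonneg_nonneg divide_nonneg_pos mult_nonneg_nonneg zero_le_dist)
    qed
  qed (use L0 B0 d in auto)
  then show ?thesis unfolding lipschitz_compact_def using K(1) K0 by blast
qed

lemma locally_lipschitz_on_lipschitz: "L-lipschitz_on UNIV f \<Longrightarrow> locally_lipschitz_on S f"
  unfolding locally_lipschitz_on_def by (meson lipschitz_on_subset subset_UNIV zero_less_one)

lemma lipschitz_compact_locally: "lipschitz_compact f \<Longrightarrow> locally_lipschitz_on S f"
  unfolding lipschitz_compact_def using locally_lipschitz_on_lipschitz by blast

lemma lipschitz_compact_mult: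
  assumes f: "lipschitz_compact f" and g: "lipschitz_compact g"
  shows "lipschitz_compact (\<lambda>x. f x * g x)"
proof -
  obtain K where "compact K" "\<And>x. x \<notin> K \<Longrightarrow> f x = 0"
    using f unfolding lipschitz_compact_def by blast
  then show ?thesis
    using lipschitz_compact_zero_extension[OF open_UNIV locally_lipschitz_on_mult[OF lipschitz_compact_locally[OF f] lipschitz_compact_locally[OF g]], of K]
    by simp
qed

lemma lipschitz_compact_shift:
  assumes "lipschitz_compact f"
  shows "lipschitz_compact (\<lambda>x. f (x + c))"
proof -
  obtain L K where LK: "L-lipschitz_on UNIV f" "compact K" "\<And>x. x \<notin> K \<Longrightarrow> f x = 0"
    using assms unfolding lipschitz_compact_def by blast
  have "L-lipschitz_on UNIV (\<lambda>x. f (x + c))"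
    using LK(1) unfolding lipschitz_on_def by (metis UNIV_I dist_add_cancel2)
  moreover have "compact ((+) (- c) ` K)" using LK(2) by (rule compact_translation)
  moreover have "f (x + c) = 0" if "x \<notin> (+) (- c) ` K" for x
    using LK(3)[of "x + c"] that by (force simp: image_iff)
  ultimately show ?thesis unfolding lipschitz_compact_def by blast
qed

lemma lipschitz_compact_borel: "lipschitz_compact f \<Longrightarrow> f \<in> borel_measurable borel"
  by (erule lipschitz_compactE) (auto intro: borel_measurable_continuous_onI)

lemma integrable_compact_bounded:
  fixes f :: "'a::euclidean_space \<Rightarrow> real"
  assumes "f \<in> borel_measurable borel" "compact K" "\<And>x. x \<notin> K \<Longrightarrow> f x = 0" "\<And>x. \<bar>f x\<bar> \<le> B"
  shows "integrable lborel f"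
proof (rule Bochner_Integration.integrable_bound)
  show "integrable lborel (\<lambda>x. B * indicator K x)"
    using assms(2) emeasure_compact_finite[OF assms(2)]
    by (intro integrable_mult_right integrable_real_indicator) (auto simp: compact_imp_closed borel_closed)
  show "AE x in lborel. norm (f x) \<le> norm (B * indicator K x)"
    using assms(3,4) by (intro AE_I2) (fastforce simp: indicator_def intro: order_trans abs_ge_self)
qed (use assms in auto)

lemma integrable_lipschitz_compact_mult:
  assumes f: "lipschitz_compact f" and g: "g \<in> borel_measurable borel" "\<And>x. \<bar>g x\<bar> \<le> B"
  shows "integrable lborel (\<lambda>x. f x * g x)"
proof -
  obtain K B' where K: "compact K" "\<And>x. x \<notin> K \<Longrightarrow> f x = 0" "\<And>x. \<bar>f x\<bar> \<le> B'" "0 \<le> B'"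
    using f by (rule lipschitz_compactE) blast
  show ?thesis
  proof (rule integrable_compact_bounded[OF _ K(1)])
    show "(\<lambda>x. f x * g x) \<in> borel_measurable borel" using g lipschitz_compact_borel[OF f] by measurable
    show "\<bar>f x * g x\<bar> \<le> B' * B" for x
      unfolding abs_mult using K(3,4) g(2) by (intro mult_mono) auto
  qed (use K in auto)
qed

section \<open>Directional derivatives and integration by parts\<close>

text \<open>Differentiability at \<open>x\<close> along the line through \<open>x\<close> with direction \<open>v\<close>, and the derivative of
  \<open>f\<close> along this line. The value \<open>0\<close> at points of non-differentiability makes the derivative of a
  continuous function Borel measurable.\<close>

definition dir_diff :: "'a::euclidean_space \<Rightarrow> ('a \<Rightarrow> real) \<Rightarrow> 'a \<Rightarrow> bool" where
  "dir_diff v f x \<longleftrightarrow> (\<lambda>t. f (x + t *\<^sub>R v)) differentiable (at 0)"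

definition dir_deriv :: "'a::euclidean_space \<Rightarrow> ('a \<Rightarrow> real) \<Rightarrow> 'a \<Rightarrow> real" where
  "dir_deriv v f x = (if dir_diff v f x then deriv (\<lambda>t. f (x + t *\<^sub>R v)) 0 else 0)"

lemma dir_diff_DERIV:
  "dir_diff v f x \<Longrightarrow> ((\<lambda>t. f (x + t *\<^sub>R v)) has_real_derivative dir_deriv v f x) (at 0)"
  unfolding dir_diff_def dir_deriv_def
  by (simp add: DERIV_deriv_iff_real_differentiable)

lemma dir_derivI:
  assumes "((\<lambda>t. f (x + t *\<^sub>R v)) has_real_derivative d) (at 0)"
  shows "dir_diff v f x" "dir_deriv v f x = d"
proof -
  show "dir_diff v f x" using assms real_differentiable_def unfolding dir_diff_def by blast
  then show "dir_deriv v f x = d" using dir_diff_DERIV DERIV_unique assms by blast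
qed

lemma dir_deriv_LIMSEQ:
  assumes "dir_diff v f x" "filterlim h (at 0) sequentially"
  shows "(\<lambda>k. (f (x + h k *\<^sub>R v) - f x) / h k) \<longlonglongrightarrow> dir_deriv v f x"
proof -
  have "((\<lambda>h. (f (x + h *\<^sub>R v) - f x) / h) \<longlongrightarrow> dir_deriv v f x) (at 0)"
    using dir_diff_DERIV[OF assms(1)] by (simp add: DERIV_def)
  then show ?thesis using assms(2) by (rule filterlim_compose)
qed

lemma dir_cong:
  assumes "open S" "x \<in> S" and eq: "\<And>y. y \<in> S \<Longrightarrow> f y = g y"
  shows "dir_diff v f x \<longleftrightarrow> dir_diff v g x" "dir_deriv v f x = dir_deriv v g x"
proof -
  have ev: "eventually (\<lambda>t::real. x + t *\<^sub>R v \<in> S) (nhds 0)"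
  proof -
    have "((\<lambda>t::real. x + t *\<^sub>R v) \<longlongrightarrow> x + 0 *\<^sub>R v) (nhds 0)" 
      by (intro tendsto_intros filterlim_ident)
    then show ?thesis using assms(1,2) topological_tendstoD by fastforce
  qed
  have iff: "((\<lambda>t. f (x + t *\<^sub>R v)) has_real_derivative d) (at 0) \<longleftrightarrow> ((\<lambda>t. g (x + t *\<^sub>R v)) has_real_derivative d) (at 0)" for d
    using ev eq by (intro DERIV_cong_ev refl) (auto elim!: eventually_mono)
  show 1: "dir_diff v f x \<longleftrightarrow> dir_diff v g x"
    unfolding dir_diff_def real_differentiable_def iff ..
  show "dir_deriv v f x = dir_deriv v g x"
    using 1 iff dir_diff_DERIV dir_derivI by (metis dir_deriv_def)
qed

lemma dir_deriv_shift:
  "dir_diff v (\<lambda>y. f (y + c)) x \<longleftrightarrow> dir_diff v f (x + c)"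
  "dir_deriv v (\<lambda>y. f (y + c)) x = dir_deriv v f (x + c)"
  unfolding dir_diff_def dir_deriv_def by (simp_all add: add_ac)

lemma dir_deriv_mult:
  assumes "dir_diff v f x" "dir_diff v g x"
  shows "dir_diff v (\<lambda>y. f y * g y) x" "dir_deriv v (\<lambda>y. f y * g y) x = dir_deriv v f x * g x + f x * dir_deriv v g x"
  using dir_derivI[OF DERIV_mult[OF dir_diff_DERIV[OF assms(1)] dir_diff_DERIV[OF assms(2)]]]
  by (auto simp: algebra_simps)

lemma has_derivative_dir:
  assumes "(f has_derivative D) (at x)"
  shows "dir_diff v f x" "dir_deriv v f x = D v"
proof -
  have "((\<lambda>t. x + t *\<^sub>R v) has_derivative (\<lambda>t. t *\<^sub>R v)) (at 0)"
    by (auto intro!: derivative_eq_intros)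
  then have "((\<lambda>t. f (x + t *\<^sub>R v)) has_derivative (\<lambda>t. D (t *\<^sub>R v))) (at 0)"
    using has_derivative_compose[of "\<lambda>t. x + t *\<^sub>R v" _ 0 UNIV f D] assms by simp
  moreover have "D (t *\<^sub>R v) = D v * t" for t
    using assms by (simp add: has_derivative_bounded_linear linear_cmul bounded_linear.linear)
  ultimately have "((\<lambda>t. f (x + t *\<^sub>R v)) has_real_derivative D v) (at 0)"
    by (simp add: has_field_derivative_def)
  then show "dir_diff v f x" "dir_deriv v f x = D v" using dir_derivI by blast+
qed

text \<open>A Cauchy criterion for differentiability, with a quantifier structure that makes the set of
  points of differentiability visibly Borel.\<close>

lemma differentiable_iff_quotients_Cauchy:
  fixes h :: "real \<Rightarrow> real"
  shows "h differentiable (at 0) \<longleftrightarrow>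
    (\<forall>n::nat. \<exists>m::nat. \<forall>s t. 0 < \<bar>s\<bar> \<and> \<bar>s\<bar> < 1 / real (Suc m) \<and> 0 < \<bar>t\<bar> \<and> \<bar>t\<bar> < 1 / real (Suc m) \<longrightarrow>
       \<bar>(h s - h 0) / s - (h t - h 0) / t\<bar> \<le> 1 / real (Suc n))" (is "_ \<longleftrightarrow> ?R")
proof -
  define Q where "Q = (\<lambda>s. (h s - h 0) / s)"
  have "h differentiable (at 0) \<longleftrightarrow> (\<exists>c. filtermap Q (at 0) \<le> nhds c)"
    by (simp add: real_differentiable_def DERIV_def Q_def filterlim_def)
  also have "\<dots> \<longleftrightarrow> cauchy_filter (filtermap Q (at 0))"
  proof
    assume "\<exists>c. filtermap Q (at 0) \<le> nhds c"
    then show "cauchy_filter (filtermap Q (at 0))"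
      using cauchy_filter_mono nhds_imp_cauchy_filter by blast
  next
    assume "cauchy_filter (filtermap Q (at 0))"
    then show "\<exists>c. filtermap Q (at 0) \<le> nhds c"
      using cauchy_filter_complete_converges[OF _ complete_UNIV, of "filtermap Q (at 0)"]
        trivial_limit_at[of "0::real"] by (simp add: filtermap_bot_iff)
  qed
  also have "\<dots> \<longleftrightarrow> ?R"
  proof
    assume *: "cauchy_filter (filtermap Q (at 0))"
    show ?R
    proof
      fix n :: nat
      obtain P where "eventually P (at 0)" and P: "\<And>s t. P s \<Longrightarrow> P t \<Longrightarrow> dist (Q s) (Q t) < 1 / real (Suc n)"
        using * unfolding cauchy_filter_metric_filtermap by (metis of_nat_0_less_iff zero_less_Suc zero_less_divide_1_iff)
      then obtain d where d: "0 < d" "\<And>s. s \<noteq> 0 \<Longrightarrow> \<bar>s\<bar> < d \<Longrightarrow> P s"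
        unfolding eventually_at by (auto simp: dist_real_def)
      obtain m where m: "1 / real (Suc m) < d" using d(1) nat_approx_posE by blast
      have "\<bar>Q s - Q t\<bar> \<le> 1 / real (Suc n)"
        if "0 < \<bar>s\<bar> \<and> \<bar>s\<bar> < 1 / real (Suc m) \<and> 0 < \<bar>t\<bar> \<and> \<bar>t\<bar> < 1 / real (Suc m)" for s t
        using P[of s t] d(2)[of s] d(2)[of t] that m by (simp add: dist_real_def)
      then show "\<exists>m::nat. \<forall>s t. 0 < \<bar>s\<bar> \<and> \<bar>s\<bar> < 1 / real (Suc m) \<and> 0 < \<bar>t\<bar> \<and> \<bar>t\<bar> < 1 / real (Suc m) \<longrightarrow>
         \<bar>(h s - h 0) / s - (h t - h 0) / t\<bar> \<le> 1 / real (Suc n)" unfolding Q_def by blast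
    qed
  next
    assume R: ?R
    show "cauchy_filter (filtermap Q (at 0))"
      unfolding cauchy_filter_metric_filtermap
    proof (intro allI impI)
      fix e :: real assume "0 < e"
      then obtain n where n: "1 / real (Suc n) < e" using nat_approx_posE by blast
      from R obtain m where m: "\<And>s t. 0 < \<bar>s\<bar> \<and> \<bar>s\<bar> < 1 / real (Suc m) \<and> 0 < \<bar>t\<bar> \<and> \<bar>t\<bar> < 1 / real (Suc m) \<Longrightarrow>
         \<bar>Q s - Q t\<bar> \<le> 1 / real (Suc n)" unfolding Q_def by blast
      have "eventually (\<lambda>s. 0 < \<bar>s\<bar> \<and> \<bar>s\<bar> < 1 / real (Suc m)) (at (0::real))"
        unfolding eventually_at by (intro exI[of _ "1 / real (Suc m)"]) (auto simp: dist_real_def)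
      moreover have "dist (Q s) (Q t) < e"
        if "0 < \<bar>s\<bar> \<and> \<bar>s\<bar> < 1 / real (Suc m)" "0 < \<bar>t\<bar> \<and> \<bar>t\<bar> < 1 / real (Suc m)" for s t
        using m[of s t] that n by (simp add: dist_real_def)
      ultimately show "\<exists>P. eventually P (at 0) \<and> (\<forall>x y. P x \<and> P y \<longrightarrow> dist (Q x) (Q y) < e)"
        by blast
    qed
  qed
  finally show ?thesis .
qed

lemma borel_dir_diff:
  fixes f :: "'a::euclidean_space \<Rightarrow> real"
  assumes f: "continuous_on UNIV f"
  shows "{x. dir_diff v f x} \<in> sets borel"
proof -
  have cont: "continuous_on UNIV (\<lambda>x. f (x + s *\<^sub>R v))" for s
    by (intro continuous_on_compose2[OF f] continuous_intros) auto
  define C where "C = (\<lambda>(n::nat) (m::nat). \<Inter>s\<in>{s. 0 < \<bar>s\<bar> \<and> \<bar>s\<bar> < 1 / real (Suc m)}. \<Inter>t\<in>{t. 0 < \<bar>t\<bar> \<and> \<bar>t\<bar> < 1 / real (Suc m)}.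
     {x. \<bar>(f (x + s *\<^sub>R v) - f x) / s - (f (x + t *\<^sub>R v) - f x) / t\<bar> \<le> 1 / real (Suc n)})"
  \<comment> \<open>The intersections over \<open>s\<close> and \<open>t\<close> are uncountable, but the sets intersected are closed.\<close>
  have "closed (C n m)" for n m
    unfolding C_def
    by (intro closed_INT ballI closed_Collect_le continuous_intros cont f) auto
  then have C: "C n m \<in> sets borel" for n m by auto
  have "{x. dir_diff v f x} = (\<Inter>n. \<Union>m. C n m)"
    unfolding dir_diff_def differentiable_iff_quotients_Cauchy C_def by (intro set_eqI) (simp, blast)
  then show ?thesis using C by auto
qed

lemma one_over_Suc_at_0: "filterlim (\<lambda>k. 1 / real (Suc k)) (at 0) sequentially"
  unfolding filterlim_at using LIMSEQ_inverse_real_of_nat by (auto simp: divide_inverse)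

lemma borel_measurable_dir_deriv:
  fixes f :: "'a::euclidean_space \<Rightarrow> real"
  assumes f: "continuous_on UNIV f"
  shows "dir_deriv v f \<in> borel_measurable borel"
proof -
  have cont: "continuous_on UNIV (\<lambda>x. f (x + s *\<^sub>R v))" for s
    by (intro continuous_on_compose2[OF f] continuous_intros) auto
  let ?D = "{x. dir_diff v f x}"
  let ?q = "\<lambda>k x. indicator ?D x * ((f (x + (1 / real (Suc k)) *\<^sub>R v) - f x) / (1 / real (Suc k)))"
  have [measurable]: "?D \<in> sets borel" by (rule borel_dir_diff[OF f])
  have [measurable]: "(\<lambda>x. f (x + s *\<^sub>R v)) \<in> borel_measurable borel" "f \<in> borel_measurable borel" for s
    using cont f by (auto intro: borel_measurable_continuous_onI)
  show ?thesis
  proof (rule borel_measurable_LIMSEQ_metric)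
    show "?q k \<in> borel_measurable borel" for k by measurable
    fix x show "(\<lambda>k. ?q k x) \<longlonglongrightarrow> dir_deriv v f x"
      using dir_deriv_LIMSEQ[OF _ one_over_Suc_at_0, of v f x]
      by (cases "dir_diff v f x") (simp_all add: dir_deriv_def)
  qed
qed

text \<open>A Borel set all of whose slices parallel to a fixed subspace are null is null: integrate its
  translates over the subspace and use Fubini's theorem.\<close>

lemma negligible_if_slices_negligible:
  fixes E :: "'a::euclidean_space set" and h :: "'b::euclidean_space \<Rightarrow> 'a"
  assumes E: "E \<in> sets borel" and h: "continuous_on UNIV h"
    and slices: "\<And>x. negligible {w. x + h w \<in> E}"
  shows "negligible E"
proof -
  have [measurable]: "h \<in> borel_measurable borel" using h by (rule borel_measurable_continuous_onI)
  have [measurable]: "E \<in> sets borel" by fact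
  have hE: "{w. x + h w \<in> E} \<in> sets borel" for x
  proof -
    have "(\<lambda>w. x + h w) -` E \<inter> space borel \<in> sets borel" by measurable
    then show ?thesis by (simp add: vimage_def)
  qed
  have "AE w in lborel. x + h w \<notin> E" for x
    using slices[of x] hE[of x] unfolding negligible_iff_null_sets
    by (intro AE_I[where N = "{w. x + h w \<in> E}"]) (auto simp: null_sets_completion_iff)
  then have "AE x in lborel. AE w in lborel. x + h w \<notin> E" by simp
  moreover have "{p \<in> space (lborel \<Otimes>\<^sub>M lborel). (case p of (x::'a, w::'b) \<Rightarrow> x + h w \<notin> E)} \<in> sets (lborel \<Otimes>\<^sub>M lborel)"
    by measurable
  ultimately have "AE w in lborel. AE x in lborel. x + h w \<notin> E"
    using lborel_pair.AE_commute[of "\<lambda>x w. x + h w \<notin> E"] by (auto simp: split_beta)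
  then obtain w where "AE x in lborel. x + h w \<notin> E"
    using eventually_happens'[of "ae_filter (lborel::'b measure)"] 
    by (auto simp: ae_filter_eq_bot_iff)
  moreover have "{x. x + h w \<in> E} \<in> sets borel"
  proof -
    have "(\<lambda>x. x + h w) -` E \<inter> space borel \<in> sets borel" by measurable
    then show ?thesis by (simp add: vimage_def)
  qed
  ultimately have "{x. x + h w \<in> E} \<in> null_sets lborel"
    by (simp add: AE_iff_null_sets)
  then have "negligible {x. x + h w \<in> E}" 
    by (simp add: negligible_iff_null_sets null_sets_completionI)
  then have "negligible ((+) (h w) ` {x. x + h w \<in> E})" by (rule negligible_translation)
  moreover have "E \<subseteq> (+) (h w) ` {x. x + h w \<in> E}"
    by (auto intro!: image_eqI[where x = "x - h w" for x])
  ultimately show ?thesis by (rule negligible_subset)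
qed

lemma lipschitz_dir_diff_AE:
  fixes f :: "'a::euclidean_space \<Rightarrow> real"
  assumes f: "L-lipschitz_on UNIV f"
  shows "AE x in lborel. dir_diff v f x"
proof -
  have cont: "continuous_on UNIV f" using f by (rule lipschitz_on_continuous_on)
  let ?E = "- {x. dir_diff v f x}"
  have E: "?E \<in> sets borel" using borel_dir_diff[OF cont] by (metis borel_comp)
  have "negligible ?E"
  proof (rule negligible_if_slices_negligible[OF E])
    show "continuous_on UNIV (\<lambda>t::real. t *\<^sub>R v)" by (intro continuous_intros)
    fix x
    define p where "p = (\<lambda>t. f (x + t *\<^sub>R v))"
    have "(L * norm v)-lipschitz_on UNIV p"
    proof (rule lipschitz_onI)
      fix s t :: real
      have "dist (p s) (p t) \<le> L * dist (x + s *\<^sub>R v) (x + t *\<^sub>R v)"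
        unfolding p_def using f by (rule lipschitz_onD) auto
      also have "\<dots> = L * norm v * dist s t"
        by (simp add: dist_norm scaleR_diff_left[symmetric] dist_real_def mult_ac)
      finally show "dist (p s) (p t) \<le> L * norm v * dist s t" .
    qed (use lipschitz_on_nonneg[OF f] in simp)
    then have "negligible {t. \<not> p differentiable (at t)}" by (rule lipschitz_differentiable_negligible)
    moreover have "dir_diff v f (x + t *\<^sub>R v)" if pt: "p differentiable (at t)" for t
    proof -
      have "dir_diff v f (x + t *\<^sub>R v) \<longleftrightarrow> (\<lambda>s. p (t + s)) differentiable (at 0)"
        unfolding dir_diff_def p_def by (simp add: algebra_simps)
      moreover obtain d where "(p has_real_derivative d) (at t)"
        using pt real_differentiable_def by blast
      then have "((\<lambda>s. p (t + s)) has_real_derivative d) (at 0)"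
        using DERIV_shift[of p d 0 t] by (simp add: add.commute)
      ultimately show ?thesis using real_differentiable_def by blast
    qed
    ultimately show "negligible {t. x + t *\<^sub>R v \<in> ?E}"
      by (elim negligible_subset) auto
  qed
  then have "?E \<in> null_sets lborel"
    using E by (simp add: negligible_iff_null_sets null_sets_completion_iff)
  from AE_I'[OF this] show ?thesis by auto
qed

lemma lipschitz_dir_deriv_bound:
  fixes f :: "'a::euclidean_space \<Rightarrow> real"
  assumes f: "L-lipschitz_on UNIV f"
  shows "\<bar>dir_deriv v f x\<bar> \<le> L * norm v"
proof (cases "dir_diff v f x")
  case True
  have "0 \<le> L" using f lipschitz_on_nonneg by blast
  show ?thesis
  proof (rule tendsto_upperbound)
    show "(\<lambda>k. \<bar>(f (x + (1 / real (Suc k)) *\<^sub>R v) - f x) / (1 / real (Suc k))\<bar>) \<longlonglongrightarrow> \<bar>dir_deriv v f x\<bar>"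
      by (intro tendsto_intros dir_deriv_LIMSEQ[OF True one_over_Suc_at_0])
    show "\<forall>\<^sub>F k in sequentially. \<bar>(f (x + (1 / real (Suc k)) *\<^sub>R v) - f x) / (1 / real (Suc k))\<bar> \<le> L * norm v"
    proof (intro always_eventually allI)
      fix k
      have "\<bar>f (x + (1 / real (Suc k)) *\<^sub>R v) - f x\<bar> \<le> L * norm v * (1 / real (Suc k))"
        using lipschitz_onD[OF f, of "x + (1 / real (Suc k)) *\<^sub>R v" x] by (simp add: dist_norm dist_real_def)
      then show "\<bar>(f (x + (1 / real (Suc k)) *\<^sub>R v) - f x) / (1 / real (Suc k))\<bar> \<le> L * norm v"
        by (simp only: abs_divide) (simp add: field_simps)
    qed
  qed simp
next
  case False
  then show ?thesis using f lipschitz_on_nonneg by (fastforce simp: dir_deriv_def)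
qed

lemma lipschitz_compact_borel_dir: "lipschitz_compact f \<Longrightarrow> dir_deriv v f \<in> borel_measurable borel"
  by (erule lipschitz_compactE) (auto intro: borel_measurable_dir_deriv)

lemma lipschitz_compact_dir_diff_AE: "lipschitz_compact f \<Longrightarrow> AE x in lborel. dir_diff v f x"
  by (erule lipschitz_compactE) (auto intro: lipschitz_dir_diff_AE)

lemma lipschitz_compact_dir_deriv_bound:
  assumes "lipschitz_compact f"
  obtains B where "\<And>x. \<bar>dir_deriv v f x\<bar> \<le> B" "0 \<le> B"
proof -
  obtain L where L: "L-lipschitz_on UNIV f" using assms unfolding lipschitz_compact_def by blast
  then show ?thesis
    using that[of "L * norm v"] lipschitz_dir_deriv_bound[OF L] lipschitz_on_nonneg[OF L] by auto
qed

lemma dir_deriv_outside_support: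
  assumes "closed K" "\<And>x. x \<notin> K \<Longrightarrow> f x = 0" "x \<notin> K"
  shows "dir_deriv v f x = 0"
proof -
  have "dir_deriv v f x = dir_deriv v (\<lambda>_. 0) x"
    using assms by (intro dir_cong(2)[of "- K"]) auto
  also have "\<dots> = 0" by (intro dir_derivI(2)) (auto intro!: derivative_eq_intros)
  finally show ?thesis .
qed

lemma integral_translation:
  fixes f :: "'a::euclidean_space \<Rightarrow> real"
  assumes "f \<in> borel_measurable borel"
  shows "(LINT x|lborel. f (x + c)) = (LINT x|lborel. f x)"
proof -
  have "(LINT x|lborel. f x) = (LINT x|distr lborel borel ((+) c). f x)"
    by (simp add: lborel_distr_plus)
  also have "\<dots> = (LINT x|lborel. f (c + x))" using assms by (intro integral_distr) auto
  finally show ?thesis by (simp add: add.commute)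
qed

lemma integrable_translation:
  fixes f :: "'a::euclidean_space \<Rightarrow> real"
  assumes "integrable lborel f"
  shows "integrable lborel (\<lambda>x. f (x + c))"
proof -
  have "integrable (distr lborel borel ((+) c)) f"
    using assms by (simp add: lborel_distr_plus)
  then have "integrable lborel (\<lambda>x. f (c + x))" 
    using assms by (subst (asm) integrable_distr_eq) auto
  then show ?thesis by (simp add: add.commute)
qed

text \<open>Difference quotients of a compactly supported Lipschitz function converge almost everywhere
  and boundedly, hence also under the integral sign. The varying factor \<open>G k\<close> is needed for the
  additivity of directional derivatives.\<close>

lemma lipschitz_compact_quotients_LIMSEQ_seq:
  fixes f g :: "'a::euclidean_space \<Rightarrow> real"
  assumes f: "lipschitz_compact f" and g: "\<And>k. G k \<in> borel_measurable borel" "\<And>k x. \<bar>G k x\<bar> \<le> B"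
    and g0: "g \<in> borel_measurable borel" "\<And>x. (\<lambda>k. G k x) \<longlonglongrightarrow> g x"
    and h: "filterlim h (at 0) sequentially" "\<And>k. \<bar>h k\<bar> \<le> 1"
  shows "(\<lambda>k. LINT x|lborel. (f (x + h k *\<^sub>R v) - f x) / h k * G k x) \<longlonglongrightarrow> (LINT x|lborel. dir_deriv v f x * g x)"
proof -
  obtain L K where LK: "L-lipschitz_on UNIV f" "compact K" "\<And>x. x \<notin> K \<Longrightarrow> f x = 0"
    using f unfolding lipschitz_compact_def by blast
  have L: "0 \<le> L" using LK lipschitz_on_nonneg by blast
  have B: "0 \<le> B" using g(2)[of 0 0] by linarith
  have fm[measurable]: "f \<in> borel_measurable borel" by (rule lipschitz_compact_borel[OF f])
  note g(1)[measurable] g0(1)[measurable] lipschitz_compact_borel_dir[OF f, measurable]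
  obtain R where R: "\<And>x. x \<in> K \<Longrightarrow> norm x \<le> R" 
    using compact_imp_bounded[OF LK(2)] by (auto simp: bounded_iff)
  let ?C = "cball (0::'a) (R + norm v)"
  show ?thesis
  proof (rule integral_dominated_convergence[where w = "\<lambda>x. L * norm v * B * indicator ?C x"])
    show "integrable lborel (\<lambda>x. L * norm v * B * indicator ?C x)"
      by (intro integrable_mult_right integrable_real_indicator) (auto simp: emeasure_compact_finite[OF compact_cball, simplified])
    show "AE x in lborel. (\<lambda>k. (f (x + h k *\<^sub>R v) - f x) / h k * G k x) \<longlonglongrightarrow> dir_deriv v f x * g x"
      using lipschitz_compact_dir_diff_AE[OF f, of v]
      by eventually_elim (rule tendsto_mult[OF dir_deriv_LIMSEQ[OF _ h(1)] g0(2)])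
    show "AE x in lborel. norm ((f (x + h k *\<^sub>R v) - f x) / h k * G k x) \<le> L * norm v * B * indicator ?C x" for k
    proof (intro AE_I2)
      fix x
      have "\<bar>f (x + h k *\<^sub>R v) - f x\<bar> \<le> L * norm v * \<bar>h k\<bar>"
        using lipschitz_onD[OF LK(1), of "x + h k *\<^sub>R v" x] by (simp add: dist_norm dist_real_def mult_ac)
      then have "\<bar>(f (x + h k *\<^sub>R v) - f x) / h k\<bar> \<le> L * norm v"
        using L by (cases "h k = 0") (auto simp: field_simps)
      then have 1: "\<bar>(f (x + h k *\<^sub>R v) - f x) / h k * G k x\<bar> \<le> L * norm v * B"
        unfolding abs_mult using g(2) L by (intro mult_mono) auto
      show "norm ((f (x + h k *\<^sub>R v) - f x) / h k * G k x) \<le> L * norm v * B * indicator ?C x"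
      proof (cases "x \<in> ?C")
        case False
        have "norm x \<le> norm (x + h k *\<^sub>R v) + \<bar>h k\<bar> * norm v"
          using norm_triangle_ineq4[of "x + h k *\<^sub>R v" "h k *\<^sub>R v"] by simp
        moreover have "\<bar>h k\<bar> * norm v \<le> norm v" using h(2)[of k] mult_right_mono[of "\<bar>h k\<bar>" 1 "norm v"] by simp
        ultimately have "R < norm (x + h k *\<^sub>R v)" using False by simp
        then have "x + h k *\<^sub>R v \<notin> K" using R by force
        moreover have "x \<notin> K" using R[of x] False norm_ge_zero[of v] by force
        ultimately show ?thesis using False LK(3) by simp
      qed (use 1 in simp)
    qed
  qed measurable
qed

lemma lipschitz_compact_quotients_LIMSEQ:
  fixes f g :: "'a::euclidean_space \<Rightarrow> real"
  assumes f: "lipschitz_compact f" and g: "g \<in> borel_measurable borel" "\<And>x. \<bar>g x\<bar> \<le> B"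
    and h: "filterlim h (at 0) sequentially" "\<And>k. \<bar>h k\<bar> \<le> 1"
  shows "(\<lambda>k. LINT x|lborel. (f (x + h k *\<^sub>R v) - f x) / h k * g x) \<longlonglongrightarrow> (LINT x|lborel. dir_deriv v f x * g x)"
  using lipschitz_compact_quotients_LIMSEQ_seq[OF f, of "\<lambda>_. g" B g h v] assms by simp

text \<open>Since Lebesgue measure is translation invariant, the difference quotients have integral \<open>0\<close>.\<close>

theorem integral_dir_deriv_eq_0:
  fixes f :: "'a::euclidean_space \<Rightarrow> real"
  assumes f: "lipschitz_compact f"
  shows "(LINT x|lborel. dir_deriv v f x) = 0"
proof -
  have i: "integrable lborel f" using integrable_lipschitz_compact_mult[OF f, of "\<lambda>_. 1" 1] by simp
  have "(LINT x|lborel. (f (x + t *\<^sub>R v) - f x) / t * 1) = 0" for t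
    using i integrable_translation[OF i, of "t *\<^sub>R v"] integral_translation[OF lipschitz_compact_borel[OF f]]
    by simp
  moreover have "(\<lambda>k. LINT x|lborel. (f (x + (1 / real (Suc k)) *\<^sub>R v) - f x) / (1 / real (Suc k)) * 1) \<longlonglongrightarrow> (LINT x|lborel. dir_deriv v f x * 1)"
    by (rule lipschitz_compact_quotients_LIMSEQ[OF f _ _ one_over_Suc_at_0, of "\<lambda>_. 1" 1]) auto
  ultimately have "(\<lambda>k::nat. 0) \<longlonglongrightarrow> (LINT x|lborel. dir_deriv v f x * 1)"
    by (simp only:)
  then show ?thesis using LIMSEQ_unique[of "\<lambda>_. 0::real"] by fastforce
qed

theorem integral_by_parts:
  fixes f g :: "'a::euclidean_space \<Rightarrow> real"
  assumes f: "lipschitz_compact f" and g: "lipschitz_compact g"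
  shows "(LINT x|lborel. dir_deriv v f x * g x) = - (LINT x|lborel. f x * dir_deriv v g x)"
proof -
  obtain B where B: "\<And>x. \<bar>dir_deriv v f x\<bar> \<le> B" using lipschitz_compact_dir_deriv_bound[OF f] by metis
  obtain B' where B': "\<And>x. \<bar>dir_deriv v g x\<bar> \<le> B'" using lipschitz_compact_dir_deriv_bound[OF g] by metis
  have i: "integrable lborel (\<lambda>x. dir_deriv v f x * g x)" "integrable lborel (\<lambda>x. f x * dir_deriv v g x)"
    using integrable_lipschitz_compact_mult[OF g lipschitz_compact_borel_dir[OF f] B]
      integrable_lipschitz_compact_mult[OF f lipschitz_compact_borel_dir[OF g] B'] by (simp_all add: mult.commute)
  note [measurable] = lipschitz_compact_borel[OF f] lipschitz_compact_borel[OF g]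
    lipschitz_compact_borel_dir[OF f] lipschitz_compact_borel_dir[OF g]
    lipschitz_compact_borel_dir[OF lipschitz_compact_mult[OF f g]]
  have "0 = (LINT x|lborel. dir_deriv v (\<lambda>x. f x * g x) x)"
    by (rule integral_dir_deriv_eq_0[OF lipschitz_compact_mult[OF f g], symmetric])
  also have "\<dots> = (LINT x|lborel. dir_deriv v f x * g x + f x * dir_deriv v g x)"
  proof (rule integral_cong_AE)
    show "AE x in lborel. dir_deriv v (\<lambda>x. f x * g x) x = dir_deriv v f x * g x + f x * dir_deriv v g x"
      using lipschitz_compact_dir_diff_AE[OF f, of v] lipschitz_compact_dir_diff_AE[OF g, of v]
      by eventually_elim (rule dir_deriv_mult)
  qed measurable
  finally show ?thesis using i by simp
qed

text \<open>The symmetry of the distributional second derivatives of \<open>f\<close>. For the proof, the derivative of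
  \<open>f\<close> in the direction \<open>v\<close> is replaced by a difference quotient, to which integration by parts in the
  direction \<open>w\<close> applies; a translation then moves the difference quotient from \<open>dir_deriv w f\<close> to
  \<open>g\<close>.\<close>

theorem integral_dir_deriv_swap:
  fixes f g :: "'a::euclidean_space \<Rightarrow> real"
  assumes f: "lipschitz_compact f" and g: "lipschitz_compact g"
  shows "(LINT x|lborel. dir_deriv v f x * dir_deriv w g x) = (LINT x|lborel. dir_deriv w f x * dir_deriv v g x)"
proof -
  obtain B where B: "\<And>x. \<bar>dir_deriv w f x\<bar> \<le> B" using lipschitz_compact_dir_deriv_bound[OF f] by metis
  obtain B' where B': "\<And>x. \<bar>dir_deriv w g x\<bar> \<le> B'" using lipschitz_compact_dir_deriv_bound[OF g] by metis
  note bf = lipschitz_compact_borel_dir[OF f] and bg = lipschitz_compact_borel_dir[OF g]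
  have eq: "(LINT x|lborel. (f (x + t *\<^sub>R v) - f x) / t * dir_deriv w g x)
     = (LINT x|lborel. (g (x + (- t) *\<^sub>R v) - g x) / (- t) * dir_deriv w f x)" if "t \<noteq> 0" for t
  proof -
    have ft: "lipschitz_compact (\<lambda>x. f (x + t *\<^sub>R v))" and gt: "lipschitz_compact (\<lambda>x. g (x + (- t) *\<^sub>R v))"
      by (rule lipschitz_compact_shift, fact)+
    have i1: "integrable lborel (\<lambda>x. f (x + t *\<^sub>R v) * dir_deriv w g x)" "integrable lborel (\<lambda>x. f x * dir_deriv w g x)"
      using integrable_lipschitz_compact_mult[OF ft bg B'] integrable_lipschitz_compact_mult[OF f bg B'] by auto
    have i2: "integrable lborel (\<lambda>x. g (x + (- t) *\<^sub>R v) * dir_deriv w f x)" "integrable lborel (\<lambda>x. g x * dir_deriv w f x)"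
      using integrable_lipschitz_compact_mult[OF gt bf B] integrable_lipschitz_compact_mult[OF g bf B] by auto
    have [measurable]: "dir_deriv w f \<in> borel_measurable borel" "g \<in> borel_measurable borel"
      using bf lipschitz_compact_borel[OF g] by auto
    have "(LINT x|lborel. f (x + t *\<^sub>R v) * dir_deriv w g x) = - (LINT x|lborel. dir_deriv w f (x + t *\<^sub>R v) * g x)"
      using integral_by_parts[OF ft g, of w] by (simp add: dir_deriv_shift)
    also have "(LINT x|lborel. dir_deriv w f (x + t *\<^sub>R v) * g x)
        = (LINT x|lborel. (\<lambda>x. dir_deriv w f x * g (x + (- t) *\<^sub>R v)) (x + t *\<^sub>R v))"
      by (simp add: add.assoc)
    also have "\<dots> = (LINT x|lborel. dir_deriv w f x * g (x + (- t) *\<^sub>R v))"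
      by (rule integral_translation) measurable
    finally have 1: "(LINT x|lborel. f (x + t *\<^sub>R v) * dir_deriv w g x) = - (LINT x|lborel. g (x + (- t) *\<^sub>R v) * dir_deriv w f x)"
      by (simp add: mult.commute)
    have 2: "(LINT x|lborel. f x * dir_deriv w g x) = - (LINT x|lborel. g x * dir_deriv w f x)"
      using integral_by_parts[OF f g, of w] by (simp add: mult.commute)
    have "(LINT x|lborel. (f (x + t *\<^sub>R v) - f x) / t * dir_deriv w g x)
      = (LINT x|lborel. f (x + t *\<^sub>R v) * dir_deriv w g x - f x * dir_deriv w g x) / t"
      by (simp add: left_diff_distrib)
    also have "\<dots> = ((LINT x|lborel. g (x + (- t) *\<^sub>R v) * dir_deriv w f x) - (LINT x|lborel. g x * dir_deriv w f x)) / (- t)"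
      using i1 1 2 that by (simp add: field_simps)
    also have "\<dots> = (LINT x|lborel. g (x + (- t) *\<^sub>R v) * dir_deriv w f x - g x * dir_deriv w f x) / (- t)"
      using i2 by simp
    also have "\<dots> = (LINT x|lborel. (g (x + (- t) *\<^sub>R v) - g x) / (- t) * dir_deriv w f x)"
      by (subst integral_divide_zero[symmetric]) (simp add: algebra_simps diff_divide_distrib)
    finally show ?thesis .
  qed
  have m: "filterlim (\<lambda>k. - (1 / real (Suc k))) (at 0) sequentially"
    using one_over_Suc_at_0 unfolding filterlim_at by (auto intro: tendsto_eq_intros)
  have "(\<lambda>k. LINT x|lborel. (f (x + (1 / real (Suc k)) *\<^sub>R v) - f x) / (1 / real (Suc k)) * dir_deriv w g x)
      \<longlonglongrightarrow> (LINT x|lborel. dir_deriv v f x * dir_deriv w g x)"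
    by (rule lipschitz_compact_quotients_LIMSEQ[OF f bg B' one_over_Suc_at_0]) simp
  moreover have "(\<lambda>k. LINT x|lborel. (g (x + (- (1 / real (Suc k))) *\<^sub>R v) - g x) / (- (1 / real (Suc k))) * dir_deriv w f x)
      \<longlonglongrightarrow> (LINT x|lborel. dir_deriv v g x * dir_deriv w f x)"
    by (rule lipschitz_compact_quotients_LIMSEQ[OF g bf B m]) simp
  moreover have "(LINT x|lborel. (f (x + (1 / real (Suc k)) *\<^sub>R v) - f x) / (1 / real (Suc k)) * dir_deriv w g x)
     = (LINT x|lborel. (g (x + (- (1 / real (Suc k))) *\<^sub>R v) - g x) / (- (1 / real (Suc k))) * dir_deriv w f x)" for k
    by (rule eq) simp
  ultimately have "(LINT x|lborel. dir_deriv v f x * dir_deriv w g x) = (LINT x|lborel. dir_deriv v g x * dir_deriv w f x)"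
    by (simp only: LIMSEQ_unique)
  then show ?thesis by (simp add: mult.commute)
qed

lemma locally_lipschitz_dir_diff_AE:
  fixes f :: "'a::euclidean_space \<Rightarrow> real"
  assumes "open S" and f: "locally_lipschitz_on S f" and K: "compact K" "K \<subseteq> S"
  shows "AE x in lborel. x \<in> K \<longrightarrow> dir_diff v f x"
proof -
  obtain \<eta> U K' where \<eta>: "lipschitz_compact \<eta>" "open U" "K \<subseteq> U" "\<And>x. x \<in> U \<Longrightarrow> \<eta> x = 1"
    "compact K'" "K' \<subseteq> S" "\<And>x. x \<notin> K' \<Longrightarrow> \<eta> x = 0" "U \<subseteq> K'"
    using lipschitz_cutoff[OF K(1) assms(1) K(2)] by metis
  let ?f = "\<lambda>x. if x \<in> S then \<eta> x * f x else 0"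
  have "lipschitz_compact ?f"
    using \<eta> by (intro lipschitz_compact_zero_extension[OF assms(1) _ \<eta>(5,6)] locally_lipschitz_on_mult lipschitz_compact_locally f) auto
  from lipschitz_compact_dir_diff_AE[OF this, of v] show ?thesis
  proof eventually_elim
    case (elim x)
    have "x \<in> K \<Longrightarrow> dir_diff v ?f x \<longleftrightarrow> dir_diff v f x"
      using \<eta> by (intro dir_cong(1)[of U]) auto
    then show ?case using elim by blast
  qed
qed

section \<open>Rademacher's theorem\<close>

lemma dir_deriv_scale: 
  assumes "dir_diff v f x" shows "dir_diff (c *\<^sub>R v) f x" "dir_deriv (c *\<^sub>R v) f x = c * dir_deriv v f x"
proof -
  have "((\<lambda>t. f (x + t *\<^sub>R v)) has_real_derivative dir_deriv v f x) (at (c * 0))"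
    using dir_diff_DERIV[OF assms] by simp
  then have "((\<lambda>t. f (x + (c * t) *\<^sub>R v)) has_real_derivative dir_deriv v f x * c) (at 0)"
    by (rule DERIV_chain2) (auto intro!: derivative_eq_intros)
  then have "((\<lambda>t. f (x + t *\<^sub>R (c *\<^sub>R v))) has_real_derivative c * dir_deriv v f x) (at 0)"
    by (simp add: mult.commute)
  then show "dir_diff (c *\<^sub>R v) f x" "dir_deriv (c *\<^sub>R v) f x = c * dir_deriv v f x" using dir_derivI by blast+
qed

text \<open>A bounded function orthogonal to all compactly supported Lipschitz functions has integral \<open>0\<close>
  over bounded open sets, whose indicator functions are limits of such functions.\<close>

lemma integral_open_eq_0_if_orthogonal_lipschitz:
  fixes m :: "'a::euclidean_space \<Rightarrow> real"
  assumes m: "m \<in> borel_measurable borel" "\<And>x. \<bar>m x\<bar> \<le> B"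
    and orth: "\<And>\<psi>. lipschitz_compact \<psi> \<Longrightarrow> (LINT x|lborel. \<psi> x * m x) = 0"
    and U: "open U" "bounded U"
  shows "(LINT x|lborel. indicator U x * m x) = 0"
proof -
  have "U \<noteq> UNIV" using U(2) not_bounded_UNIV by blast
  then have cU: "closed (- U)" "- U \<noteq> {}" using U(1) by auto
  define \<psi> where "\<psi> k x = min 1 (real k * infdist x (- U))" for k x
  have supp: "\<psi> k x = 0" if "x \<notin> U" for k x using that by (simp add: \<psi>_def)
  have K: "compact (closure U)" using U(2) by simp
  have lip: "lipschitz_compact (\<psi> k)" for k
  proof -
    have "(real k)-lipschitz_on UNIV (\<psi> k)"
    proof (rule lipschitz_onI)
      fix x y
      have "\<bar>\<psi> k x - \<psi> k y\<bar> \<le> \<bar>real k * infdist x (- U) - real k * infdist y (- U)\<bar>"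
        unfolding \<psi>_def by linarith
      also have "\<dots> = real k * \<bar>infdist x (- U) - infdist y (- U)\<bar>"
        by (simp only: right_diff_distrib[symmetric] abs_mult abs_of_nat)
      also have "\<dots> \<le> real k * dist x y" by (intro mult_left_mono infdist_lipschitz) auto
      finally show "dist (\<psi> k x) (\<psi> k y) \<le> real k * dist x y" by (simp add: dist_real_def)
    qed simp
    then show ?thesis unfolding lipschitz_compact_def using K supp closure_subset by blast
  qed
  have lim: "(\<lambda>k. \<psi> k x) \<longlonglongrightarrow> indicator U x" for x
  proof (cases "x \<in> U")
    case True
    then have "0 < infdist x (- U)"
      using cU by (metis ComplD in_closed_iff_infdist_zero infdist_nonneg order_less_le)
    then obtain n where n: "1 < real n * infdist x (- U)" using reals_Archimedean3 by blast
    have "\<psi> k x = 1" if "n \<le> k" for k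
    proof -
      have "real n * infdist x (- U) \<le> real k * infdist x (- U)"
        using that by (intro mult_right_mono) (auto simp: infdist_nonneg)
      then show ?thesis using n by (simp add: \<psi>_def)
    qed
    then have "\<forall>\<^sub>F k in sequentially. \<psi> k x = 1" by (intro eventually_sequentiallyI[of n])
    then show ?thesis using True by (simp add: tendsto_eventually)
  qed (simp add: supp)
  have [measurable]: "U \<in> sets borel" "\<psi> k \<in> borel_measurable borel" "m \<in> borel_measurable borel" for k
    using U lipschitz_compact_borel[OF lip] m(1) by auto
  have "(\<lambda>k. LINT x|lborel. \<psi> k x * m x) \<longlonglongrightarrow> (LINT x|lborel. indicator U x * m x)"
  proof (rule integral_dominated_convergence[where w = "\<lambda>x. B * indicator U x"])
    show "integrable lborel (\<lambda>x. B * indicator U x)"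
      using emeasure_bounded_finite[OF U(2)] by (intro integrable_mult_right integrable_real_indicator) auto
    show "AE x in lborel. (\<lambda>k. \<psi> k x * m x) \<longlonglongrightarrow> indicator U x * m x"
      by (intro AE_I2 tendsto_mult lim tendsto_const)
    show "AE x in lborel. norm (\<psi> k x * m x) \<le> B * indicator U x" for k
    proof (intro AE_I2)
      fix x
      have "\<bar>\<psi> k x\<bar> \<le> 1" using infdist_nonneg[of x "- U"] by (auto simp: \<psi>_def)
      then have "\<bar>\<psi> k x * m x\<bar> \<le> 1 * B" unfolding abs_mult using m(2) by (intro mult_mono) auto
      then show "norm (\<psi> k x * m x) \<le> B * indicator U x"
        using supp[of x k] by (auto simp: indicator_def)
    qed
  qed measurable
  then show ?thesis using orth[OF lip] LIMSEQ_unique[OF tendsto_const] by fastforce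
qed

text \<open>The measure with density \<open>1 + m / (B + 1)\<close> has the same value as Lebesgue measure on every box,
  hence coincides with it, and densities are unique.\<close>

lemma AE_zero_if_orthogonal_lipschitz:
  fixes m :: "'a::euclidean_space \<Rightarrow> real"
  assumes m: "m \<in> borel_measurable borel" "\<And>x. \<bar>m x\<bar> \<le> B"
    and orth: "\<And>\<psi>. lipschitz_compact \<psi> \<Longrightarrow> (LINT x|lborel. \<psi> x * m x) = 0"
  shows "AE x in lborel. m x = 0"
proof -
  note [measurable] = m(1)
  have B: "0 \<le> B" using m(2)[of 0] by linarith
  define d where "d x = 1 + m x / (B + 1)" for x
  have [measurable]: "d \<in> borel_measurable borel" unfolding d_def by measurable
  have d0: "0 \<le> d x" for x using m(2)[of x] B by (simp add: d_def field_simps abs_le_iff)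
  have "lborel = density lborel (\<lambda>x. ennreal (d x))"
  proof (rule lborel_eqI)
    fix l u :: 'a assume lu: "\<And>b. b \<in> Basis \<Longrightarrow> l \<bullet> b \<le> u \<bullet> b"
    have fin: "emeasure lborel (box l u) < \<infinity>" by (rule emeasure_bounded_finite[OF bounded_box])
    have im: "integrable lborel (\<lambda>x. indicator (box l u) x * m x)"
      using m(2) by (intro integrable_compact_bounded[OF _ compact_cbox[of l u], of _ B])
        (auto simp: indicator_def B box_subset_cbox[THEN subsetD])
    have ii: "integrable lborel (\<lambda>x. indicator (box l u) x :: real)" using fin by (intro integrable_real_indicator) auto
    have eq: "d x * indicator (box l u) x = indicator (box l u) x + indicator (box l u) x * m x / (B + 1)" for x
      by (simp add: d_def algebra_simps)
    have "emeasure (density lborel (\<lambda>x. ennreal (d x))) (box l u) = (\<integral>\<^sup>+x. ennreal (d x * indicator (box l u) x) \<partial>lborel)"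
      by (subst emeasure_density) (auto simp: ennreal_mult' d0 ennreal_indicator intro!: nn_integral_cong)
    also have "\<dots> = ennreal (LINT x|lborel. d x * indicator (box l u) x)"
    proof (rule nn_integral_eq_integral)
      show "integrable lborel (\<lambda>x. d x * indicator (box l u) x)" unfolding eq using ii im by simp
    qed (simp add: d0)
    also have "(LINT x|lborel. d x * indicator (box l u) x) = measure lborel (box l u)"
      unfolding eq using ii im integral_open_eq_0_if_orthogonal_lipschitz[OF m orth open_box bounded_box]
      by simp
    also have "ennreal \<dots> = emeasure lborel (box l u)" using fin by (simp add: emeasure_eq_ennreal_measure)
    finally show "emeasure (density lborel (\<lambda>x. ennreal (d x))) (box l u) = (\<Prod>b\<in>Basis. (u - l) \<bullet> b)"
      using lu by (simp add: emeasure_lborel_box)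
  qed simp
  then have "density lborel (\<lambda>x. 1) = density lborel (\<lambda>x. ennreal (d x))" by (simp add: density_1)
  then have "AE x in lborel. 1 = ennreal (d x)"
    by (subst (asm) sigma_finite_measure.density_unique_iff[OF sigma_finite_lborel]) auto
  then show ?thesis
  proof eventually_elim
    case (elim x)
    then have "d x = 1" using d0[of x] by (metis ennreal_1 ennreal_inj zero_le_one)
    then show ?case using B by (simp add: d_def)
  qed
qed

text \<open>Directional derivatives are additive in the direction almost everywhere. Tested against a
  Lipschitz function \<open>\<psi>\<close>, the difference quotient in the direction \<open>v + w\<close> splits into the one in the
  direction \<open>w\<close> and a translate by \<open>t w\<close> of the one in the direction \<open>v\<close>; the translation is moved to
  \<open>\<psi>\<close>, where it disappears in the limit.\<close>

lemma lipschitz_compact_dir_deriv_add: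
  fixes f :: "'a::euclidean_space \<Rightarrow> real"
  assumes f: "lipschitz_compact f"
  shows "AE x in lborel. dir_deriv (v + w) f x = dir_deriv v f x + dir_deriv w f x"
proof -
  have "\<forall>v. \<exists>B. \<forall>x. \<bar>dir_deriv v f x\<bar> \<le> B"
    by (metis lipschitz_compact_dir_deriv_bound[OF f])
  then obtain B where B: "\<And>v x. \<bar>dir_deriv v f x\<bar> \<le> B v" by metis
  note bd[measurable] = lipschitz_compact_borel_dir[OF f]
  let ?m = "\<lambda>x. dir_deriv (v + w) f x - dir_deriv v f x - dir_deriv w f x"
  have "AE x in lborel. ?m x = 0"
  proof (rule AE_zero_if_orthogonal_lipschitz)
    show "?m \<in> borel_measurable borel" by measurable
    show "\<bar>?m x\<bar> \<le> B (v + w) + B v + B w" for x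
      using B[of "v + w" x] B[of v x] B[of w x] by linarith
    fix \<psi> :: "'a \<Rightarrow> real" assume \<psi>: "lipschitz_compact \<psi>"
    obtain C where C: "continuous_on UNIV \<psi>" "\<And>x. \<bar>\<psi> x\<bar> \<le> C" using \<psi> by (rule lipschitz_compactE) blast
    have i: "integrable lborel (\<lambda>x. \<psi> x * dir_deriv z f x)" for z
      by (rule integrable_lipschitz_compact_mult[OF \<psi> bd B])
    let ?h = "\<lambda>k. 1 / real (Suc k)"
    let ?q = "\<lambda>z k x. (f (x + ?h k *\<^sub>R z) - f x) / ?h k"
    note [measurable] = lipschitz_compact_borel[OF \<psi>] lipschitz_compact_borel[OF f]
    have fs: "integrable lborel (\<lambda>x. \<psi> x * f (x + c))" for c
    proof -
      obtain B' where "\<And>x. \<bar>f x\<bar> \<le> B'" using f by (rule lipschitz_compactE) blast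
      then show ?thesis
        by (intro integrable_lipschitz_compact_mult[OF \<psi>, of _ B']) (auto intro!: lipschitz_compact_borel lipschitz_compact_shift f)
    qed
    have lim: "(\<lambda>k. LINT x|lborel. ?q z k x * \<psi> x) \<longlonglongrightarrow> (LINT x|lborel. dir_deriv z f x * \<psi> x)" for z
      by (rule lipschitz_compact_quotients_LIMSEQ[OF f _ C(2) one_over_Suc_at_0]) auto
    have "(\<lambda>k. LINT x|lborel. ?q v k x * \<psi> (x + (- ?h k) *\<^sub>R w)) \<longlonglongrightarrow> (LINT x|lborel. dir_deriv v f x * \<psi> x)"
    proof (rule lipschitz_compact_quotients_LIMSEQ_seq[OF f _ C(2) _ _ one_over_Suc_at_0])
      fix x
      have "(\<lambda>k. x + (- ?h k) *\<^sub>R w) \<longlonglongrightarrow> x + (- 0) *\<^sub>R w"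
        using one_over_Suc_at_0 by (intro tendsto_intros) (simp add: filterlim_at)
      then show "(\<lambda>k. \<psi> (x + (- ?h k) *\<^sub>R w)) \<longlonglongrightarrow> \<psi> x"
        using C(1) continuous_on_tendsto_compose[OF C(1)] by fastforce
    qed (auto intro!: lipschitz_compact_borel lipschitz_compact_shift \<psi>)
    moreover have "(LINT x|lborel. ?q v k x * \<psi> (x + (- ?h k) *\<^sub>R w)) = (LINT x|lborel. ?q (v + w) k x * \<psi> x) - (LINT x|lborel. ?q w k x * \<psi> x)" for k
    proof -
      have "(LINT x|lborel. ?q v k x * \<psi> (x + (- ?h k) *\<^sub>R w))
        = (LINT x|lborel. (\<lambda>x. ?q v k x * \<psi> (x + (- ?h k) *\<^sub>R w)) (x + ?h k *\<^sub>R w))"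
        by (rule integral_translation[symmetric]) measurable
      also have "\<dots> = (LINT x|lborel. ?q (v + w) k x * \<psi> x - ?q w k x * \<psi> x)"
        by (intro Bochner_Integration.integral_cong refl) (simp add: algebra_simps)
      also have "\<dots> = (LINT x|lborel. ?q (v + w) k x * \<psi> x) - (LINT x|lborel. ?q w k x * \<psi> x)"
      proof (rule Bochner_Integration.integral_diff)
        have "integrable lborel (\<lambda>x. ?q z k x * \<psi> x)" for z
        proof -
          have "?q z k x * \<psi> x = (\<psi> x * f (x + ?h k *\<^sub>R z) - \<psi> x * f (x + 0)) / ?h k" for x
            by (simp only: add_0_right times_divide_eq_left left_diff_distrib mult.commute[of "\<psi> x"])
          then show ?thesis
            by (simp only:) (intro integrable_divide_zero Bochner_Integration.integrable_diff fs)
        qed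
        then show "integrable lborel (\<lambda>x. ?q (v + w) k x * \<psi> x)" "integrable lborel (\<lambda>x. ?q w k x * \<psi> x)"
          by blast+
      qed
      finally show ?thesis .
    qed
    ultimately have "(\<lambda>k. (LINT x|lborel. ?q (v + w) k x * \<psi> x) - (LINT x|lborel. ?q w k x * \<psi> x)) \<longlonglongrightarrow> (LINT x|lborel. dir_deriv v f x * \<psi> x)"
      by simp
    moreover have "(\<lambda>k. (LINT x|lborel. ?q (v + w) k x * \<psi> x) - (LINT x|lborel. ?q w k x * \<psi> x)) \<longlonglongrightarrow>
       (LINT x|lborel. dir_deriv (v + w) f x * \<psi> x) - (LINT x|lborel. dir_deriv w f x * \<psi> x)"
      by (intro tendsto_diff lim)
    ultimately have "(LINT x|lborel. dir_deriv v f x * \<psi> x) = (LINT x|lborel. dir_deriv (v + w) f x * \<psi> x) - (LINT x|lborel. dir_deriv w f x * \<psi> x)"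
      by (rule LIMSEQ_unique)
    then show "(LINT x|lborel. \<psi> x * ?m x) = 0"
      using i by (simp add: right_diff_distrib mult.commute)
  qed
  then show ?thesis by eventually_elim simp
qed

lemma lipschitz_compact_dir_deriv_linear:
  fixes f :: "'a::euclidean_space \<Rightarrow> real"
  assumes f: "lipschitz_compact f"
  shows "AE x in lborel. dir_deriv v f x = (\<Sum>b\<in>Basis. (v \<bullet> b) * dir_deriv b f x)"
proof -
  have "AE x in lborel. dir_deriv (\<Sum>b\<in>A. (v \<bullet> b) *\<^sub>R b) f x = (\<Sum>b\<in>A. (v \<bullet> b) * dir_deriv b f x)"
    if "finite A" "A \<subseteq> Basis" for A
    using that
  proof (induction A rule: finite_induct)
    case empty
    have "dir_deriv 0 f x = 0" for x by (intro dir_derivI(2)) (auto intro!: derivative_eq_intros)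
    then show ?case by simp
  next
    case (insert b A)
    have "AE x in lborel. dir_deriv (\<Sum>b\<in>A. (v \<bullet> b) *\<^sub>R b) f x = (\<Sum>b\<in>A. (v \<bullet> b) * dir_deriv b f x)"
      using insert by auto
    moreover note lipschitz_compact_dir_deriv_add[OF f, of "(v \<bullet> b) *\<^sub>R b" "\<Sum>b\<in>A. (v \<bullet> b) *\<^sub>R b"]
      lipschitz_compact_dir_diff_AE[OF f, of b]
    ultimately show ?case
      by eventually_elim (use insert in \<open>simp add: dir_deriv_scale\<close>)
  qed
  from this[of Basis] show ?thesis by (simp add: euclidean_representation)
qed

text \<open>Rademacher's theorem. At almost every point the derivatives in a countable dense set of
  directions exist and are given by one linear map; by compactness of the unit sphere and the
  Lipschitz bound, this map is the derivative.\<close>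

theorem lipschitz_compact_differentiable_AE:
  fixes f :: "'a::euclidean_space \<Rightarrow> real"
  assumes f: "lipschitz_compact f"
  shows "AE x in lborel. f differentiable (at x)"
proof -
  obtain L where L: "L-lipschitz_on UNIV f" using f unfolding lipschitz_compact_def by blast
  have L0: "0 \<le> L" using L lipschitz_on_nonneg by blast
  obtain D :: "'a set" where D: "countable D" "\<And>X. open X \<Longrightarrow> X \<noteq> {} \<Longrightarrow> \<exists>d\<in>D. d \<in> X"
    using countable_dense_setE by blast
  have "AE x in lborel. \<forall>v\<in>D. dir_diff v f x \<and> dir_deriv v f x = (\<Sum>b\<in>Basis. (v \<bullet> b) * dir_deriv b f x)"
    using D(1) lipschitz_compact_dir_diff_AE[OF f] lipschitz_compact_dir_deriv_linear[OF f]
    by (simp add: AE_ball_countable)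
  then show ?thesis
  proof eventually_elim
    case (elim x)
    define l where "l v = (\<Sum>b\<in>Basis. (v \<bullet> b) * dir_deriv b f x)" for v
    define C where "C = (\<Sum>b\<in>Basis. \<bar>dir_deriv b f x\<bar>)"
    have C0: "0 \<le> C" by (auto simp: C_def intro!: sum_nonneg)
    have lin: "linear l"
      unfolding l_def by (rule linearI) (simp_all add: inner_add_left distrib_right sum.distrib sum_distrib_left mult.assoc)
    have lC: "\<bar>l v\<bar> \<le> C * norm v" for v
    proof -
      have "\<bar>l v\<bar> \<le> (\<Sum>b\<in>Basis. \<bar>(v \<bullet> b) * dir_deriv b f x\<bar>)" unfolding l_def by (rule sum_abs)
      also have "\<dots> \<le> (\<Sum>b\<in>Basis. \<bar>dir_deriv b f x\<bar> * norm v)"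
        by (intro sum_mono) (simp add: abs_mult mult.commute mult_right_mono Basis_le_norm)
      finally show ?thesis by (simp add: C_def sum_distrib_right)
    qed
    have dv: "\<exists>d>0. \<forall>t. 0 < t \<and> t < d \<longrightarrow> \<bar>f (x + t *\<^sub>R v) - f x - t * l v\<bar> \<le> e * t" if v: "v \<in> D" and e: "0 < e" for v e
    proof -
      have "((\<lambda>h. (f (x + h *\<^sub>R v) - f x) / h) \<longlongrightarrow> l v) (at 0)"
        using dir_diff_DERIV[of v f x] elim v by (simp add: DERIV_def l_def)
      then obtain d where d: "0 < d" "\<And>h. h \<noteq> 0 \<Longrightarrow> \<bar>h\<bar> < d \<Longrightarrow> \<bar>(f (x + h *\<^sub>R v) - f x) / h - l v\<bar> < e"
        using e unfolding LIM_def by (auto simp: dist_real_def)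
      have "\<bar>f (x + t *\<^sub>R v) - f x - t * l v\<bar> \<le> e * t" if t: "0 < t" "t < d" for t
      proof -
        have "f (x + t *\<^sub>R v) - f x - t * l v = ((f (x + t *\<^sub>R v) - f x) / t - l v) * t"
          using t by (simp add: field_simps)
        also have "\<bar>\<dots>\<bar> \<le> e * t"
          unfolding abs_mult using d(2)[of t] t by (intro mult_mono) auto
        finally show ?thesis .
      qed
      then show ?thesis using d(1) by blast
    qed
    have "(f has_derivative l) (at x)"
      unfolding has_derivative_at_alt
    proof (intro conjI allI impI)
      show "bounded_linear l" using lin by (simp add: linear_linear)
      fix e :: real assume e: "0 < e"
      define \<epsilon> where "\<epsilon> = e / (L + 1 + C)"
      have \<epsilon>: "0 < \<epsilon>" using e L0 C0 by (simp add: \<epsilon>_def)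
      have "sphere 0 1 \<subseteq> (\<Union>v\<in>D. ball v \<epsilon>)"
      proof
        fix u :: 'a assume "u \<in> sphere 0 1"
        obtain d where "d \<in> D" "d \<in> ball u \<epsilon>" using D(2)[of "ball u \<epsilon>"] \<epsilon> by auto
        then show "u \<in> (\<Union>v\<in>D. ball v \<epsilon>)" by (auto simp: dist_commute)
      qed
      then obtain D' where D': "D' \<subseteq> D" "finite D'" "sphere 0 1 \<subseteq> (\<Union>v\<in>D'. ball v \<epsilon>)"
        using compactE_image[OF compact_sphere, of D "\<lambda>v. ball v \<epsilon>"] by (metis open_ball)
      have "\<forall>v\<in>D'. \<exists>d>0. \<forall>t. 0 < t \<and> t < d \<longrightarrow> \<bar>f (x + t *\<^sub>R v) - f x - t * l v\<bar> \<le> \<epsilon> * t"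
        using dv D' \<epsilon> by blast
      then obtain \<delta> where \<delta>: "\<And>v. v \<in> D' \<Longrightarrow> 0 < \<delta> v \<and> (\<forall>t. 0 < t \<and> t < \<delta> v \<longrightarrow> \<bar>f (x + t *\<^sub>R v) - f x - t * l v\<bar> \<le> \<epsilon> * t)"
        by metis
      define d where "d = Min (insert 1 (\<delta> ` D'))"
      have d: "0 < d" "\<And>v. v \<in> D' \<Longrightarrow> d \<le> \<delta> v"
        using D'(2) \<delta> by (auto simp: d_def)
      show "\<exists>d>0. \<forall>y. norm (y - x) < d \<longrightarrow> norm (f y - f x - l (y - x)) \<le> e * norm (y - x)"
      proof (intro exI conjI allI impI)
        fix y assume y: "norm (y - x) < d"
        show "norm (f y - f x - l (y - x)) \<le> e * norm (y - x)"
        proof (cases "y = x")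
          case True
          then show ?thesis using linear_0[OF lin] by simp
        next
          case False
          define t where "t = norm (y - x)"
          define u where "u = (y - x) /\<^sub>R t"
          have t: "0 < t" "t < d" using False y by (auto simp: t_def)
          have u: "norm u = 1" "y = x + t *\<^sub>R u" using t False by (auto simp: u_def t_def)
          then obtain v where v: "v \<in> D'" "norm (u - v) < \<epsilon>"
            using D'(3) by (force simp: dist_norm norm_minus_commute)
          have 1: "\<bar>f (x + t *\<^sub>R u) - f (x + t *\<^sub>R v)\<bar> \<le> L * (t * \<epsilon>)"
          proof -
            have "\<bar>f (x + t *\<^sub>R u) - f (x + t *\<^sub>R v)\<bar> \<le> L * dist (x + t *\<^sub>R u) (x + t *\<^sub>R v)"
              using lipschitz_onD[OF L, of "x + t *\<^sub>R u" "x + t *\<^sub>R v"] by (simp add: dist_real_def)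
            also have "\<dots> = L * (t * norm (u - v))"
              using t by (simp add: dist_norm scaleR_diff_right[symmetric])
            also have "\<dots> \<le> L * (t * \<epsilon>)" using L0 t v by (intro mult_left_mono) auto
            finally show ?thesis .
          qed
          have 2: "\<bar>f (x + t *\<^sub>R v) - f x - t * l v\<bar> \<le> \<epsilon> * t"
            using \<delta>[OF v(1)] d(2)[OF v(1)] t by auto
          have 3: "\<bar>t * l v - t * l u\<bar> \<le> C * (t * \<epsilon>)"
          proof -
            have "\<bar>t * l v - t * l u\<bar> = t * \<bar>l (v - u)\<bar>"
              using t linear_diff[OF lin, of v u] by (simp add: abs_mult right_diff_distrib[symmetric])
            also have "\<dots> \<le> t * (C * \<epsilon>)"
              using t lC[of "v - u"] v C0 mult_left_mono[of "norm (v - u)" \<epsilon> C]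
              by (intro mult_left_mono) (auto simp: norm_minus_commute)
            finally show ?thesis by (simp add: mult_ac)
          qed
          have "\<bar>f y - f x - t * l u\<bar> \<le> L * (t * \<epsilon>) + \<epsilon> * t + C * (t * \<epsilon>)"
            using 1 2 3 u(2) by simp
          also have "L * (t * \<epsilon>) + \<epsilon> * t + C * (t * \<epsilon>) = e * t" 
          proof -
            have "L * (t * \<epsilon>) + \<epsilon> * t + C * (t * \<epsilon>) = ((L + 1 + C) * \<epsilon>) * t" by (simp add: algebra_simps)
            also have "(L + 1 + C) * \<epsilon> = e" using L0 C0 by (simp add: \<epsilon>_def)
            finally show ?thesis .
          qed
          finally have "\<bar>f y - f x - t * l u\<bar> \<le> e * t" .
          moreover have "l (y - x) = t * l u" using linear_cmul[OF lin, of t u] u(2) by simp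
          ultimately show ?thesis by (simp only: real_norm_def t_def[symmetric])
        qed
      qed (use d in auto)
    qed
    then show ?case by (auto simp: differentiable_def)
  qed
qed

theorem locally_lipschitz_differentiable_AE:
  fixes f :: "'a::euclidean_space \<Rightarrow> real"
  assumes f: "locally_lipschitz_on UNIV f"
  shows "AE x in lborel. f differentiable (at x)"
proof -
  have "AE x in lborel. x \<in> ball 0 (real n) \<longrightarrow> f differentiable (at x)" for n
  proof -
    obtain \<eta> U K' where \<eta>: "lipschitz_compact \<eta>" "open U" "cball (0::'a) (real n) \<subseteq> U" "\<And>x. x \<in> U \<Longrightarrow> \<eta> x = 1"
      "compact K'" "K' \<subseteq> UNIV" "\<And>x. x \<notin> K' \<Longrightarrow> \<eta> x = 0"
      using lipschitz_cutoff[OF compact_cball open_UNIV, of 0 "real n"] by (metis subset_UNIV)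
    let ?f = "\<lambda>x. \<eta> x * f x"
    have "lipschitz_compact (\<lambda>x. if x \<in> UNIV then ?f x else 0)"
      using \<eta> by (intro lipschitz_compact_zero_extension[OF open_UNIV _ \<eta>(5,6)] locally_lipschitz_on_mult lipschitz_compact_locally f) auto
    then have "AE x in lborel. ?f differentiable (at x)"
      using lipschitz_compact_differentiable_AE by simp
    then show ?thesis
    proof eventually_elim
      case (elim x)
      show ?case
      proof
        assume x: "x \<in> ball 0 (real n)"
        obtain D where D: "(?f has_derivative D) (at x)" using elim by (auto simp: differentiable_def)
        have "(f has_derivative D) (at x)"
          by (rule has_derivative_transform_within_open[OF D \<eta>(2)]) (use x \<eta> in auto)
        then show "f differentiable (at x)" by (auto simp: differentiable_def)
      qed
    qed
  qed
  then have "AE x in lborel. \<forall>n. x \<in> ball 0 (real n) \<longrightarrow> f differentiable (at x)"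
    by (subst AE_all_countable) blast
  then show ?thesis
  proof eventually_elim
    case (elim x)
    obtain n where "norm x < real n" using reals_Archimedean2 by blast
    then have "x \<in> ball 0 (real n)" by simp
    then show ?case using elim by blast
  qed
qed

section \<open>Gradients, second derivatives and points of rank two\<close>

lemma has_partial_iff: "has_partial i f x \<longleftrightarrow> dir_diff (axis i 1) f x"
  by (simp add: has_partial_def dir_diff_def)

lemma partial_eq_dir_deriv: "dir_diff (axis i 1) f x \<Longrightarrow> partial i f x = dir_deriv (axis i 1) f x"
  by (simp add: partial_def dir_deriv_def)

lemma has_derivative_partial: "(f has_derivative D) (at x) \<Longrightarrow> partial i f x = D (axis i 1)"
  using has_derivative_dir[of f D x "axis i 1"] by (simp add: partial_eq_dir_deriv)

lemma has_derivative_grad: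
  fixes f :: "real^'n::finite \<Rightarrow> real"
  assumes "f differentiable (at x)"
  shows "(f has_derivative (\<lambda>h. grad f x \<bullet> h)) (at x)"
proof -
  obtain D where D: "(f has_derivative D) (at x)" using assms by (auto simp: differentiable_def)
  have lin: "linear D" using D by (simp add: has_derivative_linear)
  have "D h = grad f x \<bullet> h" for h
  proof -
    have "D h = D (\<Sum>i\<in>UNIV. h $ i *\<^sub>R axis i 1)"
      using basis_expansion[of h] by (simp add: scalar_mult_eq_scaleR)
    also have "\<dots> = (\<Sum>i\<in>UNIV. h $ i * D (axis i 1))"
      by (simp add: linear_sum[OF lin] linear_cmul[OF lin])
    also have "\<dots> = grad f x \<bullet> h"
      by (simp add: inner_vec_def grad_def has_derivative_partial[OF D] mult.commute)
    finally show ?thesis .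
  qed
  then have "D = (\<lambda>h. grad f x \<bullet> h)" by auto
  with D show ?thesis by simp
qed

lemma grad_eqI: "(f has_derivative (\<lambda>h. g \<bullet> h)) (at x) \<Longrightarrow> grad f x = g"
  by (simp add: vec_eq_iff grad_def has_derivative_partial inner_axis)

lemma Ck_Suc_imp: "Ck (Suc k) S f \<Longrightarrow> Ck k S f"
proof (induction k arbitrary: f)
  case 0
  then show ?case by (auto intro: continuous_at_imp_continuous_on differentiable_imp_continuous_within)
next
  case (Suc k)
  then show ?case by simp
qed

lemma Ck_1D:
  assumes "Ck (Suc 0) S f"
  shows "x \<in> S \<Longrightarrow> f differentiable (at x)" "continuous_on S (partial i f)" "continuous_on S (grad f)" "continuous_on S f"
proof -
  show "x \<in> S \<Longrightarrow> f differentiable (at x)" "continuous_on S (partial i f)" using assms by auto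
  show "continuous_on S (grad f)" unfolding grad_def using assms by (auto intro!: continuous_intros)
  show "continuous_on S f" using Ck_Suc_imp[OF assms] by simp
qed

lemma Ck_2D:
  assumes "Ck 2 S f"
  shows "Ck (Suc 0) S f" "Ck (Suc 0) S (partial i f)"
  using assms Ck_Suc_imp[of "Suc 0" S f] by (auto simp: numeral_2_eq_2)

lemma C1_locally_lipschitz:
  fixes f :: "real^'n::finite \<Rightarrow> real"
  assumes "open S" and der: "\<And>x. x \<in> S \<Longrightarrow> (f has_derivative (\<lambda>h. g x \<bullet> h)) (at x)" and g: "continuous_on S g"
  shows "locally_lipschitz_on S f"
  unfolding locally_lipschitz_on_def
proof
  fix x assume "x \<in> S"
  then obtain r where r: "0 < r" "cball x r \<subseteq> S" using assms(1) open_contains_cball by blast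
  have "compact (g ` cball x r)"
    using r g continuous_on_subset compact_continuous_image compact_cball by metis
  then obtain B where "\<forall>y\<in>g ` cball x r. norm y \<le> B" using compact_imp_bounded bounded_iff by metis
  then have B: "\<And>y. y \<in> cball x r \<Longrightarrow> norm (g y) \<le> B" by auto
  have B0: "0 \<le> B" using B[of x] r norm_ge_zero order_trans by (metis centre_in_cball less_imp_le)
  have "B-lipschitz_on (cball x r) f"
  proof (rule bounded_derivative_imp_lipschitz[where f' = "\<lambda>x h. g x \<bullet> h"])
    show "(f has_derivative (\<lambda>h. g y \<bullet> h)) (at y within cball x r)" if "y \<in> cball x r" for y
      using der r that by (meson has_derivative_at_withinI subsetD)
    show "onorm (\<lambda>h. g y \<bullet> h) \<le> B" if "y \<in> cball x r" for y
    proof (rule onorm_le)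
      fix h
      have "norm (g y \<bullet> h) \<le> norm (g y) * norm h" by (simp add: Cauchy_Schwarz_ineq2)
      also have "\<dots> \<le> B * norm h" using B[OF that] by (intro mult_right_mono) auto
      finally show "norm (g y \<bullet> h) \<le> B * norm h" .
    qed
  qed (use B0 in auto)
  then have "B-lipschitz_on (ball x r \<inter> S) f" by (rule lipschitz_on_subset) auto
  then show "\<exists>r>0. \<exists>C. C-lipschitz_on (ball x r \<inter> S) f" using r by blast
qed

lemma Ck_1_locally_lipschitz:
  fixes f :: "real^'n::finite \<Rightarrow> real"
  assumes "open S" "Ck (Suc 0) S f"
  shows "locally_lipschitz_on S f"
  using C1_locally_lipschitz[OF assms(1), of f "grad f"] Ck_1D[OF assms(2)] has_derivative_grad by blast

text \<open>Both mixed second derivatives are the limit of the same second difference quotient as soon as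
  the gradient is differentiable at the point.\<close>

lemma second_difference_bound:
  fixes f :: "'a::real_normed_vector \<Rightarrow> real"
  assumes f: "\<And>y. y \<in> ball x r \<Longrightarrow> (f has_derivative f' y) (at y)" and r: "0 < r"
    and D: "((\<lambda>y. f' y v) has_derivative D) (at x)" and e: "0 < e"
  shows "\<exists>d>0. \<forall>t. 0 < t \<and> t < d \<longrightarrow> \<bar>f (x + t *\<^sub>R v + t *\<^sub>R w) - f (x + t *\<^sub>R v) - f (x + t *\<^sub>R w) + f x - t^2 * D w\<bar> \<le> e * t^2"
proof -
  define M where "M = 2 * norm v + norm w + 1"
  have M: "0 < M" by (simp add: M_def add_nonneg_pos)
  have lin: "linear D" using D by (rule has_derivative_linear)
  obtain d where d: "0 < d" "\<And>y. norm (y - x) < d \<Longrightarrow> norm (f' y v - f' x v - D (y - x)) \<le> e / M * norm (y - x)"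
    using D e M unfolding has_derivative_at_alt by (meson divide_pos_pos)
  define d' where "d' = min d r / M"
  have d': "0 < d'" using d r M by (simp add: d'_def)
  have near: "norm (s *\<^sub>R v + t *\<^sub>R w) < min d r" if "0 \<le> s" "s \<le> t" "t < d'" for s t
  proof -
    have "norm (s *\<^sub>R v + t *\<^sub>R w) \<le> s * norm v + t * norm w"
      using norm_triangle_ineq[of "s *\<^sub>R v" "t *\<^sub>R w"] that by simp
    also have "\<dots> \<le> t * norm v + t * norm w" using that by (intro add_mono mult_right_mono) auto
    also have "\<dots> \<le> t * M" using that by (simp add: M_def algebra_simps)
    also have "\<dots> < d' * M" using that M by simp
    also have "\<dots> = min d r" using M by (simp add: d'_def)
    finally show ?thesis .
  qed
  have near0: "norm (s *\<^sub>R v) < min d r" if "0 \<le> s" "s \<le> t" "t < d'" for s t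
  proof -
    have "norm (s *\<^sub>R v) \<le> t * norm v" using that by (simp add: mult_right_mono)
    also have "\<dots> \<le> t * M" using that by (intro mult_left_mono) (auto simp: M_def)
    also have "\<dots> < d' * M" using that M by simp
    also have "\<dots> = min d r" using M by (simp add: d'_def)
    finally show ?thesis .
  qed
  have "\<bar>f (x + t *\<^sub>R v + t *\<^sub>R w) - f (x + t *\<^sub>R v) - f (x + t *\<^sub>R w) + f x - t^2 * D w\<bar> \<le> e * t^2"
    if t: "0 < t" "t < d'" for t
  proof -
    define p where "p s = f (x + s *\<^sub>R v + t *\<^sub>R w) - f (x + s *\<^sub>R v)" for s
    have "(p has_real_derivative (f' (x + s *\<^sub>R v + t *\<^sub>R w) v - f' (x + s *\<^sub>R v) v)) (at s)" if s: "0 \<le> s" "s \<le> t" for s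
    proof -
      have "x - (x + s *\<^sub>R v + t *\<^sub>R w) = - (s *\<^sub>R v + t *\<^sub>R w)" "x - (x + s *\<^sub>R v) = - (s *\<^sub>R v)" by simp_all
      then have "x + s *\<^sub>R v + t *\<^sub>R w \<in> ball x r" "x + s *\<^sub>R v \<in> ball x r"
        using near[OF s t(2)] near0[OF s t(2)] by (simp_all only: mem_ball dist_norm norm_minus_cancel min_less_iff_conj)
      from f[OF this(1)] f[OF this(2)] 
      have 1: "(f has_derivative f' (x + s *\<^sub>R v + t *\<^sub>R w)) (at (x + s *\<^sub>R v + t *\<^sub>R w))" and 2: "(f has_derivative f' (x + s *\<^sub>R v)) (at (x + s *\<^sub>R v))" .
      have a1: "((\<lambda>s. x + s *\<^sub>R v + t *\<^sub>R w) has_derivative (\<lambda>h. h *\<^sub>R v)) (at s)"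
        and a2: "((\<lambda>s. x + s *\<^sub>R v) has_derivative (\<lambda>h. h *\<^sub>R v)) (at s)"
        by (auto intro!: derivative_eq_intros)
      have "(p has_derivative (\<lambda>h. f' (x + s *\<^sub>R v + t *\<^sub>R w) (h *\<^sub>R v) - f' (x + s *\<^sub>R v) (h *\<^sub>R v))) (at s)"
        unfolding p_def using has_derivative_compose[OF a1 1] has_derivative_compose[OF a2 2] by (rule has_derivative_diff)
      moreover have "(\<lambda>h. f' (x + s *\<^sub>R v + t *\<^sub>R w) (h *\<^sub>R v) - f' (x + s *\<^sub>R v) (h *\<^sub>R v)) = (*) (f' (x + s *\<^sub>R v + t *\<^sub>R w) v - f' (x + s *\<^sub>R v) v)"
        using linear_cmul[OF has_derivative_linear[OF 1]] linear_cmul[OF has_derivative_linear[OF 2]]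
        by (intro ext) (simp add: left_diff_distrib right_diff_distrib mult.commute)
      ultimately show ?thesis by (simp add: has_field_derivative_def)
    qed
    then obtain s where s: "0 < s" "s < t" "p t - p 0 = (t - 0) * (f' (x + s *\<^sub>R v + t *\<^sub>R w) v - f' (x + s *\<^sub>R v) v)"
      using MVT2[OF t(1), of p "\<lambda>s. f' (x + s *\<^sub>R v + t *\<^sub>R w) v - f' (x + s *\<^sub>R v) v"] by blast
    let ?y1 = "x + s *\<^sub>R v + t *\<^sub>R w" and ?y2 = "x + s *\<^sub>R v"
    have n1: "norm (?y1 - x) \<le> t * (norm v + norm w)"
    proof -
      have "?y1 - x = s *\<^sub>R v + t *\<^sub>R w" by simp
      then have "norm (?y1 - x) \<le> norm (s *\<^sub>R v) + norm (t *\<^sub>R w)" by (simp only: norm_triangle_ineq)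
      also have "\<dots> \<le> t * norm v + t * norm w" using s t by (intro add_mono) (auto intro: mult_right_mono)
      finally show ?thesis by (simp add: distrib_left)
    qed
    have n2: "norm (?y2 - x) \<le> t * norm v" using s t by (auto intro: mult_right_mono)
    have "norm (?y1 - x) < d" "norm (?y2 - x) < d"
      using near[of s t] near0[of s t] s t by (auto simp: algebra_simps)
    then have b1: "norm (f' ?y1 v - f' x v - D (?y1 - x)) \<le> e / M * (t * (norm v + norm w))"
      and b2: "norm (f' ?y2 v - f' x v - D (?y2 - x)) \<le> e / M * (t * norm v)"
      using d(2)[of ?y1] d(2)[of ?y2] n1 n2 e M
      by (meson divide_nonneg_nonneg less_imp_le mult_left_mono order_trans)+
    have "D (?y1 - x) - D (?y2 - x) = t * D w"
      using linear_diff[OF lin, of "?y1 - x" "?y2 - x"] linear_cmul[OF lin, of t w] by simp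
    then have "\<bar>(f' ?y1 v - f' ?y2 v) - t * D w\<bar> \<le> e / M * (t * (norm v + norm w)) + e / M * (t * norm v)"
      using b1 b2 unfolding real_norm_def by linarith
    also have "\<dots> = e / M * (t * (2 * norm v + norm w))" by (simp add: algebra_simps)
    also have "\<dots> \<le> e / M * (t * M)" using e M t by (intro mult_left_mono) (auto simp: M_def)
    also have "\<dots> = e * t" using M by simp
    finally have b: "\<bar>(f' ?y1 v - f' ?y2 v) - t * D w\<bar> \<le> e * t" .
    have "f (x + t *\<^sub>R v + t *\<^sub>R w) - f (x + t *\<^sub>R v) - f (x + t *\<^sub>R w) + f x = p t - p 0"
      by (simp add: p_def)
    also have "p t - p 0 = t * (f' ?y1 v - f' ?y2 v)" using s(3) by simp
    finally have "f (x + t *\<^sub>R v + t *\<^sub>R w) - f (x + t *\<^sub>R v) - f (x + t *\<^sub>R w) + f x - t^2 * D w = t * ((f' ?y1 v - f' ?y2 v) - t * D w)"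
      by (simp add: power2_eq_square right_diff_distrib)
    also have "\<bar>\<dots>\<bar> \<le> t * (e * t)" using b t by (simp add: abs_mult mult_left_mono)
    finally show ?thesis by (simp add: power2_eq_square mult_ac)
  qed
  then show ?thesis using d' by blast
qed

lemma second_derivative_symmetric:
  fixes f :: "'a::real_normed_vector \<Rightarrow> real"
  assumes f: "\<And>y. y \<in> ball x r \<Longrightarrow> (f has_derivative f' y) (at y)" and r: "0 < r"
    and D: "((\<lambda>y. f' y v) has_derivative Dv) (at x)" "((\<lambda>y. f' y w) has_derivative Dw) (at x)"
  shows "Dv w = Dw v"
proof -
  have "\<bar>Dv w - Dw v\<bar> \<le> 0 + e" if e: "0 < e" for e
  proof -
    have e2: "0 < e / 2" using e by simp
    obtain d where d: "0 < d" "\<And>t. 0 < t \<and> t < d \<longrightarrow> \<bar>f (x + t *\<^sub>R v + t *\<^sub>R w) - f (x + t *\<^sub>R v) - f (x + t *\<^sub>R w) + f x - t^2 * Dv w\<bar> \<le> e/2 * t^2"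
      using second_difference_bound[OF f r D(1) e2] by blast
    obtain d' where d': "0 < d'" "\<And>t. 0 < t \<and> t < d' \<longrightarrow> \<bar>f (x + t *\<^sub>R w + t *\<^sub>R v) - f (x + t *\<^sub>R w) - f (x + t *\<^sub>R v) + f x - t^2 * Dw v\<bar> \<le> e/2 * t^2"
      using second_difference_bound[OF f r D(2) e2] by blast
    define t where "t = min d d' / 2"
    have t: "0 < t" "t < d" "t < d'" using d d' by (auto simp: t_def)
    have sw: "x + t *\<^sub>R w + t *\<^sub>R v = x + t *\<^sub>R v + t *\<^sub>R w" by (simp add: add_ac)
    define X where "X = f (x + t *\<^sub>R v + t *\<^sub>R w) - f (x + t *\<^sub>R v) - f (x + t *\<^sub>R w) + f x"
    have "\<bar>X - t^2 * Dv w\<bar> \<le> e/2 * t^2" using d(2)[of t] t by (simp add: X_def)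
    moreover have "\<bar>X - t^2 * Dw v\<bar> \<le> e/2 * t^2"
      using d'(2)[of t] t unfolding sw by (simp add: X_def algebra_simps)
    ultimately have "\<bar>t^2 * Dv w - t^2 * Dw v\<bar> \<le> e * t^2" by linarith
    then have "\<bar>t^2 * (Dv w - Dw v)\<bar> \<le> e * t^2" by (simp only: right_diff_distrib)
    then have "t^2 * \<bar>Dv w - Dw v\<bar> \<le> t^2 * e" by (simp only: abs_mult abs_power2 mult.commute)
    then show ?thesis using t by simp
  qed
  then have "\<bar>Dv w - Dw v\<bar> \<le> 0" by (rule field_le_epsilon)
  then show ?thesis by simp
qed

lemma partial_partial_commute:
  fixes f :: "real^'n::finite \<Rightarrow> real"
  assumes S: "open S" "x \<in> S" and f: "\<And>y. y \<in> S \<Longrightarrow> f differentiable (at y)"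
    and ij: "partial i f differentiable (at x)" "partial j f differentiable (at x)"
  shows "partial j (partial i f) x = partial i (partial j f) x"
proof -
  obtain r where r: "0 < r" "ball x r \<subseteq> S" using S openE by blast
  have "((\<lambda>y. grad f y \<bullet> axis k 1) has_derivative (\<lambda>h. grad (partial k f) x \<bullet> h)) (at x)"
    if "partial k f differentiable (at x)" for k
    using has_derivative_grad[OF that] by (simp add: inner_axis grad_def)
  from second_derivative_symmetric[of x r f "\<lambda>y h. grad f y \<bullet> h", OF _ r(1) this[OF ij(1)] this[OF ij(2)]]
  have "grad (partial i f) x \<bullet> axis j 1 = grad (partial j f) x \<bullet> axis i 1"
    using r f has_derivative_grad by blast
  then show ?thesis by (simp add: inner_axis grad_def)
qed

lemma vector_2_axis: "vector [s, t] = s *\<^sub>R axis 1 1 + t *\<^sub>R (axis 2 1 :: real^2)"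
  by (simp add: vec_eq_iff forall_2 axis_def)

text \<open>The map \<open>(u, v)\<close> pulls null sets back to null sets where its Jacobian minor with respect to the
  \<open>i\<close>-th and \<open>j\<close>-th coordinate does not vanish: on each affine plane spanned by these two directions
  its differential is injective, and slices by such planes detect null sets.\<close>

lemma negligible_vimage_rank_2:
  fixes u v :: "real^'n::finite \<Rightarrow> real" and N :: "(real^2) set"
  assumes "open S" and u: "Ck (Suc 0) S u" and v: "Ck (Suc 0) S v" and N: "negligible N"
  shows "negligible {x \<in> S. partial i u x * partial j v x \<noteq> partial j u x * partial i v x \<and> vector [u x, v x] \<in> N}"
proof -
  obtain N' where N': "N' \<in> null_sets lborel" "N \<subseteq> N'"
    using N unfolding negligible_iff_null_sets null_sets_completion_iff2 by auto
  have nN': "negligible N'" using N'(1) by (simp add: negligible_iff_null_sets null_sets_completionI)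
  define T where "T = {x \<in> S. partial i u x * partial j v x - partial j u x * partial i v x \<noteq> 0}"
  have "open T"
  proof -
    have "continuous_on S (\<lambda>x. partial i u x * partial j v x - partial j u x * partial i v x)"
      using Ck_1D(2)[OF u] Ck_1D(2)[OF v] by (intro continuous_intros)
    then have "open (S \<inter> (\<lambda>x. partial i u x * partial j v x - partial j u x * partial i v x) -` (- {0}))"
      by (rule continuous_open_preimage[OF _ assms(1)]) (simp add: open_Compl)
    moreover have "T = S \<inter> (\<lambda>x. partial i u x * partial j v x - partial j u x * partial i v x) -` (- {0})"
      by (auto simp: T_def)
    ultimately show ?thesis by simp
  qed
  have TS: "T \<subseteq> S" by (auto simp: T_def)
  let ?p = "\<lambda>x. vector [u x, v x] :: real^2"
  let ?E = "{x \<in> T. ?p x \<in> N'}"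
  have cp: "continuous_on T ?p"
    unfolding vector_2_axis using Ck_1D(4)[OF u] Ck_1D(4)[OF v] TS
    by (intro continuous_intros) (auto intro: continuous_on_subset)
  have "?E \<in> sets borel"
  proof -
    have "?p \<in> borel_measurable (restrict_space borel T)" using cp by (rule borel_measurable_continuous_on_restrict)
    then have "?p -` N' \<inter> space (restrict_space borel T) \<in> sets (restrict_space borel T)"
      using N'(1) by (intro measurable_sets) auto
    then have "?p -` N' \<inter> T \<in> sets borel"
      using \<open>open T\<close> by (auto simp: sets_restrict_space space_restrict_space)
    then show ?thesis by (simp add: vimage_def Int_def conj_commute)
  qed
  then have "negligible ?E"
  proof (rule negligible_if_slices_negligible)
    let ?h = "\<lambda>w :: real^2. w $ 1 *\<^sub>R axis i 1 + w $ 2 *\<^sub>R axis j 1 :: real^'n"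
    show "continuous_on UNIV ?h" by (intro continuous_intros)
    fix x
    define W where "W = {w. x + ?h w \<in> T}"
    have "negligible {w \<in> W. ?p (x + ?h w) \<in> N'}"
    proof (rule negligible_differentiable_vimage[OF nN'])
      fix w assume w: "w \<in> W"
      let ?y = "x + ?h w"
      have y: "?y \<in> S" using w TS by (auto simp: W_def)
      let ?L = "\<lambda>k. (grad u ?y \<bullet> ?h k) *\<^sub>R axis 1 1 + (grad v ?y \<bullet> ?h k) *\<^sub>R axis 2 1 :: real^2"
      have h: "((\<lambda>w. x + ?h w) has_derivative ?h) (at w)"
        by (auto intro!: derivative_eq_intros bounded_linear_imp_has_derivative bounded_linear_vec_nth)
      have "((\<lambda>w. u (x + ?h w)) has_derivative (\<lambda>k. grad u ?y \<bullet> ?h k)) (at w)"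
        "((\<lambda>w. v (x + ?h w)) has_derivative (\<lambda>k. grad v ?y \<bullet> ?h k)) (at w)"
        using has_derivative_compose[OF h has_derivative_grad[OF Ck_1D(1)[OF u y]]]
          has_derivative_compose[OF h has_derivative_grad[OF Ck_1D(1)[OF v y]]] .
      then have "((\<lambda>w. ?p (x + ?h w)) has_derivative ?L) (at w)"
        unfolding vector_2_axis by (auto intro!: derivative_eq_intros)
      then show "((\<lambda>w. ?p (x + ?h w)) has_derivative ?L) (at w within W)" by (rule has_derivative_at_withinI)
      show "inj ?L"
      proof (rule injI)
        fix k l assume eq: "?L k = ?L l"
        define m where "m = k - l"
        have "grad u ?y \<bullet> ?h k = grad u ?y \<bullet> ?h l" "grad v ?y \<bullet> ?h k = grad v ?y \<bullet> ?h l"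
          using eq by (auto simp: vec_eq_iff forall_2 axis_def)
        then have e: "partial i u ?y * m $ 1 + partial j u ?y * m $ 2 = 0" "partial i v ?y * m $ 1 + partial j v ?y * m $ 2 = 0"
          by (auto simp: grad_def inner_add_right inner_axis m_def algebra_simps)
        define J where "J = partial i u ?y * partial j v ?y - partial j u ?y * partial i v ?y"
        have J: "J \<noteq> 0" using w by (simp add: W_def T_def J_def)
        have "J * m $ 1 = partial j v ?y * (partial i u ?y * m $ 1 + partial j u ?y * m $ 2) - partial j u ?y * (partial i v ?y * m $ 1 + partial j v ?y * m $ 2)"
          by (simp add: J_def algebra_simps)
        moreover have "J * m $ 2 = partial i u ?y * (partial i v ?y * m $ 1 + partial j v ?y * m $ 2) - partial i v ?y * (partial i u ?y * m $ 1 + partial j u ?y * m $ 2)"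
          by (simp add: J_def algebra_simps)
        ultimately have "m $ 1 = 0" "m $ 2 = 0" using J e by auto
        then show "k = l" by (simp add: m_def vec_eq_iff forall_2)
      qed
    qed
    then show "negligible {w. x + ?h w \<in> ?E}" by (simp add: W_def)
  qed
  then show ?thesis by (rule negligible_subset) (use N' in \<open>auto simp: T_def\<close>)
qed

section \<open>Test functions and the linearized equation\<close>

lemma Ck_subset: "Ck k S f \<Longrightarrow> T \<subseteq> S \<Longrightarrow> Ck k T f"
  by (induction k arbitrary: f) (auto intro: continuous_on_subset)

lemma Ck_const: "Ck k UNIV (\<lambda>_::real^'n::finite. c)"
proof (induction k arbitrary: c)
  case (Suc k)
  have "partial i (\<lambda>_. c) = (\<lambda>_::real^'n. 0)" for i
    using has_derivative_partial[OF has_derivative_const] by (intro ext) blast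
  then show ?case using Suc[of 0] by simp
qed simp

lemma Ck_add:
  fixes f g :: "real^'n::finite \<Rightarrow> real"
  shows "Ck k UNIV f \<Longrightarrow> Ck k UNIV g \<Longrightarrow> Ck k UNIV (\<lambda>x. f x + g x)"
proof (induction k arbitrary: f g)
  case (Suc k)
  have "partial i (\<lambda>x. f x + g x) = (\<lambda>x. partial i f x + partial i g x)" for i
  proof
    fix x
    have "f differentiable (at x)" "g differentiable (at x)" using Suc.prems by auto
    from has_derivative_add[OF this[THEN has_derivative_grad]] show "partial i (\<lambda>x. f x + g x) x = partial i f x + partial i g x"
      by (simp add: has_derivative_partial inner_axis grad_def)
  qed
  then show ?case using Suc by (auto intro!: differentiable_add)
qed (auto intro: continuous_intros)

lemma Ck_mult:
  fixes f g :: "real^'n::finite \<Rightarrow> real"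
  shows "Ck k UNIV f \<Longrightarrow> Ck k UNIV g \<Longrightarrow> Ck k UNIV (\<lambda>x. f x * g x)"
proof (induction k arbitrary: f g)
  case (Suc k)
  have "partial i (\<lambda>x. f x * g x) = (\<lambda>x. f x * partial i g x + partial i f x * g x)" for i
  proof
    fix x
    have "f differentiable (at x)" "g differentiable (at x)" using Suc.prems by auto
    from has_derivative_mult[OF this[THEN has_derivative_grad]] show "partial i (\<lambda>x. f x * g x) x = f x * partial i g x + partial i f x * g x"
      by (simp add: has_derivative_partial inner_axis grad_def)
  qed
  moreover have "Ck k UNIV (\<lambda>x. f x * partial i g x + partial i f x * g x)" for i
    using Suc.prems Ck_Suc_imp[OF Suc.prems(1)] Ck_Suc_imp[OF Suc.prems(2)]
    by (intro Ck_add Suc.IH) auto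
  ultimately show ?case using Suc by (auto intro!: differentiable_mult)
qed (auto intro: continuous_intros)

text \<open>The functions \<open>s\<^sup>-\<^sup>m exp(-1/s)\<close>, extended by zero to \<open>s \<le> 0\<close>, are closed under differentiation
  up to linear combinations.\<close>

definition flat_exp :: "nat \<Rightarrow> real \<Rightarrow> real" where
  "flat_exp m s = (if 0 < s then (1 / s) ^ m * exp (- (1 / s)) else 0)"

lemma flat_exp_tendsto_0: "(flat_exp m \<longlongrightarrow> 0) (at_right 0)"
proof -
  have "((\<lambda>y::real. y ^ m / exp y) \<longlongrightarrow> 0) at_top" by (rule tendsto_power_div_exp_0)
  moreover have "filterlim (\<lambda>s::real. 1 / s) at_top (at_right 0)"
    using filterlim_inverse_at_top_right by (simp add: inverse_eq_divide)
  ultimately have "((\<lambda>s::real. (1 / s) ^ m / exp (1 / s)) \<longlongrightarrow> 0) (at_right 0)" by (rule filterlim_compose)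
  moreover have "eventually (\<lambda>s. (1 / s) ^ m / exp (1 / s) = flat_exp m s) (at_right 0)"
    unfolding eventually_at_right_field flat_exp_def by (intro exI[of _ 1]) (auto simp: exp_minus divide_inverse)
  ultimately show ?thesis by (rule Lim_transform_eventually)
qed

lemma flat_exp_deriv:
  "(flat_exp m has_real_derivative (flat_exp (m + 2) s - real m * flat_exp (m + 1) s)) (at s)"
proof (cases s "0::real" rule: linorder_cases)
  case greater
  have d: "((\<lambda>s. 1 / s) has_real_derivative - (1 / s)\<^sup>2) (at s)"
    using greater by (auto intro!: derivative_eq_intros simp: power2_eq_square)
  have e: "((\<lambda>s. exp (- (1 / s))) has_real_derivative exp (- (1 / s)) * (1 / s)\<^sup>2) (at s)"
    using DERIV_chain2[OF DERIV_exp DERIV_minus[OF d]] by simp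
  have eq: "real m * (- y\<^sup>2 * y ^ (m - Suc 0)) * E + E * y\<^sup>2 * y ^ m = y ^ (m + 2) * E - real m * (y ^ (m + 1) * E)" for y E :: real
    by (cases m) (simp_all add: algebra_simps power2_eq_square)
  have "((\<lambda>s. (1 / s) ^ m * exp (- (1 / s))) has_real_derivative (flat_exp (m + 2) s - real m * flat_exp (m + 1) s)) (at s)"
    using DERIV_mult[OF DERIV_power[OF d, of m] e] greater unfolding eq by (simp add: flat_exp_def)
  moreover have ev: "eventually (\<lambda>y. flat_exp m y = (1 / y) ^ m * exp (- (1 / y))) (nhds s)"
    using eventually_nhds_in_open[of "{0<..}" s] greater
    by (auto simp: flat_exp_def elim: eventually_mono)
  ultimately show ?thesis using DERIV_cong_ev[OF refl ev refl] by blast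
next
  case less
  have "((\<lambda>_. 0) has_real_derivative (flat_exp (m + 2) s - real m * flat_exp (m + 1) s)) (at s)"
    using less by (simp add: flat_exp_def)
  moreover have ev: "eventually (\<lambda>y. flat_exp m y = 0) (nhds s)"
    using eventually_nhds_in_open[of "{..<0}" s] less
    by (auto simp: flat_exp_def elim: eventually_mono)
  ultimately show ?thesis using DERIV_cong_ev[OF refl ev refl] by blast
next
  case equal
  have "((\<lambda>h. (flat_exp m (0 + h) - flat_exp m 0) / h) \<longlongrightarrow> 0) (at 0)"
  proof (rule filterlim_split_at_real)
    have "eventually (\<lambda>h. 0 = (flat_exp m (0 + h) - flat_exp m 0) / h) (at_left 0)"
      unfolding eventually_at_left_field by (intro exI[of _ "-1"]) (auto simp: flat_exp_def)
    then show "((\<lambda>h. (flat_exp m (0 + h) - flat_exp m 0) / h) \<longlongrightarrow> 0) (at_left 0)"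
      by (rule Lim_transform_eventually[OF tendsto_const])
    have "eventually (\<lambda>h. flat_exp (m + 1) h = (flat_exp m (0 + h) - flat_exp m 0) / h) (at_right 0)"
      unfolding eventually_at_right_field by (intro exI[of _ 1]) (auto simp: flat_exp_def)
    then show "((\<lambda>h. (flat_exp m (0 + h) - flat_exp m 0) / h) \<longlongrightarrow> 0) (at_right 0)"
      by (rule Lim_transform_eventually[OF flat_exp_tendsto_0])
  qed
  then show ?thesis using equal by (simp add: DERIV_def flat_exp_def)
qed

text \<open>Smooth functions that are positive exactly on the ball of radius \<open>r\<close> about \<open>c\<close>. The index \<open>m\<close>
  makes the family closed under differentiation in the sense of \<open>bump_has_derivative\<close>.\<close>

definition bump :: "nat \<Rightarrow> real^'n::finite \<Rightarrow> real \<Rightarrow> real^'n \<Rightarrow> real" where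
  "bump m c r x = flat_exp m (r\<^sup>2 - (x - c) \<bullet> (x - c))"

lemma Ck_coordinate:
  fixes c :: "real^'n::finite"
  shows "Ck k UNIV (\<lambda>x. s * (x - c) $ i)"
proof (cases k)
  case 0
  then show ?thesis by (auto intro!: continuous_intros)
next
  case (Suc k')
  have d: "((\<lambda>x. s * (x - c) $ i) has_derivative (\<lambda>h. s * h $ i)) (at x)" for x :: "real^'n"
    by (auto intro!: derivative_eq_intros bounded_linear_imp_has_derivative bounded_linear_vec_nth)
  have "partial j (\<lambda>x. s * (x - c) $ i) = (\<lambda>_. s * (if i = j then 1 else 0))" for j
    using has_derivative_partial[OF d] by (intro ext) (auto simp: axis_def)
  then show ?thesis using d Suc by (auto simp: differentiable_def intro: Ck_const)
qed

lemma bump_has_derivative: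
  "(bump m c r has_derivative (\<lambda>h. (bump (m + 2) c r x - real m * bump (m + 1) c r x) * (- 2 * ((x - c) \<bullet> h)))) (at x)"
proof -
  have "((\<lambda>x. r\<^sup>2 - (x - c) \<bullet> (x - c)) has_derivative (\<lambda>h. - 2 * ((x - c) \<bullet> h))) (at x)"
    by (auto intro!: derivative_eq_intros simp: inner_commute)
  from has_derivative_compose[OF this, of "flat_exp m"] flat_exp_deriv[of m] show ?thesis
    unfolding bump_def has_field_derivative_def by blast
qed

lemma Ck_bump: "Ck k UNIV (bump m c r)"
proof (induction k arbitrary: m)
  case 0
  show ?case using bump_has_derivative[of m c r]
    by (auto intro!: continuous_at_imp_continuous_on has_derivative_continuous)
next
  case (Suc k)
  have p: "partial i (bump m c r) = (\<lambda>x. (bump (m + 2) c r x + (- real m) * bump (m + 1) c r x) * (- 2 * (x - c) $ i))" for i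
    using has_derivative_partial[OF bump_has_derivative[of m c r]] by (intro ext) (simp add: inner_axis)
  have "Ck k UNIV (partial i (bump m c r))" for i
    unfolding p by (intro Ck_mult Ck_add Ck_const Ck_coordinate Suc.IH)
  moreover have "bump m c r differentiable (at x)" for x
    using bump_has_derivative differentiable_def by blast
  ultimately show ?case by simp
qed

lemma bump_pos_iff: 
  assumes "0 < r" shows "0 < bump m c r x \<longleftrightarrow> dist c x < r" "0 \<le> bump m c r x"
proof -
  have "0 < r\<^sup>2 - (x - c) \<bullet> (x - c) \<longleftrightarrow> norm (x - c) < r"
    using assms power_strict_mono[of "norm (x - c)" r 2] power2_less_imp_less[of "norm (x - c)" r]
    by (auto simp: power2_norm_eq_inner)
  moreover have "0 < bump m c r x \<longleftrightarrow> 0 < r\<^sup>2 - (x - c) \<bullet> (x - c)" by (simp add: bump_def flat_exp_def)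
  ultimately show "0 < bump m c r x \<longleftrightarrow> dist c x < r" by (simp add: dist_norm norm_minus_commute)
  show "0 \<le> bump m c r x" by (simp add: bump_def flat_exp_def)
qed

lemma bump_test_function:
  assumes "0 < r" "cball c r \<subseteq> S"
  shows "bump m c r \<in> test_functions S"
proof -
  have sub: "{x \<in> S. bump m c r x \<noteq> 0} \<subseteq> cball c r"
    using bump_pos_iff[OF assms(1), of m c] by (force simp: less_le)
  then have cl: "closure {x \<in> S. bump m c r x \<noteq> 0} \<subseteq> cball c r" by (rule closure_minimal) simp
  then have "compact (closure {x \<in> S. bump m c r x \<noteq> 0})"
    using compact_Int_closed[OF compact_cball closed_closure, of c r "{x \<in> S. bump m c r x \<noteq> 0}"]
    by (simp add: Int_absorb1)
  then show ?thesis
    using cl assms(2) Ck_subset[OF Ck_bump subset_UNIV] by (auto simp: test_functions_def compact_support_in_def)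
qed

text \<open>Passing from integrals over \<open>S\<close> with respect to completed Lebesgue measure to integrals of
  Borel functions on the whole space.\<close>

lemma set_lebesgue_integral_eq_lborel:
  fixes p p' :: "'a::euclidean_space \<Rightarrow> real"
  assumes p': "p' \<in> borel_measurable borel" and ae: "AE x in lborel. (if x \<in> S then p x else 0) = p' x"
  shows "(LINT x:S|lebesgue. p x) = (LINT x|lborel. p' x)"
    "integrable lborel p' \<Longrightarrow> set_integrable lebesgue S p"
proof -
  have eq: "(\<lambda>x. indicator S x *\<^sub>R p x) = (\<lambda>x. if x \<in> S then p x else 0)" by (auto simp: indicator_def)
  have ae': "AE x in lebesgue. (if x \<in> S then p x else 0) = p' x" using AE_completion[OF ae] .
  have m': "p' \<in> borel_measurable lebesgue" using p' by (simp add: measurable_completion)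
  have m: "(\<lambda>x. if x \<in> S then p x else 0) \<in> borel_measurable lebesgue"
    using ae' by (intro borel_measurable_AE[OF m']) (auto elim: eventually_mono)
  have "(LINT x:S|lebesgue. p x) = (LINT x|lebesgue. p' x)"
    unfolding set_lebesgue_integral_def eq by (rule integral_cong_AE[OF m m' ae'])
  also have "\<dots> = (LINT x|lborel. p' x)" using p' by (intro integral_completion) simp
  finally show "(LINT x:S|lebesgue. p x) = (LINT x|lborel. p' x)" .
  assume "integrable lborel p'"
  then have "integrable lebesgue p'" using p' by (simp add: integrable_completion)
  then show "set_integrable lebesgue S p"
    unfolding set_integrable_def eq using integrable_cong_AE[OF m m' ae'] by simp
qed

lemma continuous_eq_0_if_orthogonal_test_functions:
  fixes p :: "real^'n::finite \<Rightarrow> real"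
  assumes S: "open S" and p: "continuous_on S p"
    and orth: "\<And>\<psi>. \<psi> \<in> test_functions S \<Longrightarrow> (LINT x:S|lebesgue. p x * \<psi> x) = 0"
    and "x \<in> S"
  shows "p x = 0"
proof -
  have "s * p x \<le> 0" if s: "s = 1 \<or> s = -1" for s :: real
  proof (rule ccontr)
    assume "\<not> s * p x \<le> 0"
    then have sp: "0 < s * p x" by simp
    have "continuous_on S (\<lambda>x. s * p x)" using p by (intro continuous_intros)
    then have "open (S \<inter> (\<lambda>x. s * p x) -` {0<..})" using S by (intro continuous_open_preimage) auto
    then obtain r where r: "0 < r" "cball x r \<subseteq> S \<inter> (\<lambda>x. s * p x) -` {0<..}"
      using sp \<open>x \<in> S\<close> open_contains_cball by (metis IntI vimage_eq greaterThan_iff)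
    let ?b = "bump 0 x r"
    let ?p' = "\<lambda>y. indicator (cball x r) y *\<^sub>R (p y * ?b y)"
    have cb: "continuous_on UNIV ?b" using Ck_bump[of 0 0] by simp
    have "continuous_on (cball x r) (\<lambda>y. p y * ?b y)"
      using r cb p by (intro continuous_intros) (auto intro: continuous_on_subset)
    then have int: "integrable lborel ?p'" by (rule borel_integrable_compact[OF compact_cball])
    have "0 = (LINT y:S|lebesgue. p y * ?b y)"
      using orth[OF bump_test_function[of r x S 0]] r by auto
    also have "\<dots> = (LINT y|lborel. ?p' y)"
    proof (rule set_lebesgue_integral_eq_lborel(1))
      show "?p' \<in> borel_measurable borel" using int by auto
      have "?b y = 0" if "y \<notin> cball x r" for y
        using bump_pos_iff[OF r(1), of 0 x y] that by auto
      then show "AE y in lborel. (if y \<in> S then p y * ?b y else 0) = ?p' y"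
        using r by (intro AE_I2) (auto simp: indicator_def)
    qed
    finally have "(LINT y|lborel. s * ?p' y) = 0" by simp
    moreover have nn: "0 \<le> s * ?p' y" for y
    proof (cases "y \<in> cball x r")
      case True
      then have "0 < s * p y" using r by auto
      then have "0 \<le> (s * p y) * ?b y" using bump_pos_iff(2)[OF r(1), of 0 x y] by (rule mult_nonneg_nonneg[OF less_imp_le])
      then show ?thesis using True by (simp add: mult.assoc)
    qed simp
    ultimately have "AE y in lborel. s * ?p' y = 0"
      using integral_nonneg_eq_0_iff_AE[of lborel "\<lambda>y. s * ?p' y"] int by simp
    then have "AE y in lborel. y \<notin> ball x r"
    proof eventually_elim
      case (elim y)
      show ?case
      proof
        assume y: "y \<in> ball x r"
        then have yr: "y \<in> cball x r" by auto
        then have "0 < s * p y" using r(2) by blast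
        moreover have "0 < ?b y" using y bump_pos_iff(1)[OF r(1), of 0 x y] by auto
        ultimately show False using elim yr by auto
      qed
    qed
    then have "ball x r \<in> null_sets lborel" by (simp add: AE_iff_null_sets)
    then have "negligible (ball x r)" by (simp add: negligible_iff_null_sets null_sets_completionI)
    then show False using r(1) open_not_negligible[of "ball x r"] by simp
  qed
  from this[of 1] this[of "-1"] show ?thesis by simp
qed

lemma dir_deriv_differentiable:
  "f differentiable (at x) \<Longrightarrow> dir_diff v f x" "f differentiable (at x) \<Longrightarrow> dir_deriv (axis i 1) f x = partial i f x"
  using has_derivative_dir partial_eq_dir_deriv by (metis differentiable_def)+

text \<open>Multiplying by a cutoff function turns a locally Lipschitz function on an open set into a
  compactly supported Lipschitz function on the whole space with the same germs along a given
  compact set.\<close>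

lemma lipschitz_compact_localize:
  fixes f :: "'b \<Rightarrow> 'a::euclidean_space \<Rightarrow> real"
  assumes S: "open S" and K: "compact K" "K \<subseteq> S" and f: "\<And>i. locally_lipschitz_on S (f i)"
  obtains f' U where "\<And>i. lipschitz_compact (f' i)" "open U" "K \<subseteq> U" "U \<subseteq> S" "\<And>i x. x \<in> U \<Longrightarrow> f' i x = f i x"
    "\<And>i v x. x \<in> U \<Longrightarrow> dir_diff v (f' i) x = dir_diff v (f i) x" "\<And>i v x. x \<in> U \<Longrightarrow> dir_deriv v (f' i) x = dir_deriv v (f i) x"
proof -
  obtain \<eta> U K' where \<eta>: "lipschitz_compact \<eta>" "open U" "K \<subseteq> U" "\<And>x. x \<in> U \<Longrightarrow> \<eta> x = 1"
    "compact K'" "K' \<subseteq> S" "\<And>x. x \<notin> K' \<Longrightarrow> \<eta> x = 0" "U \<subseteq> K'"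
    using lipschitz_cutoff[OF K(1) S K(2)] by metis
  define f' where "f' i x = (if x \<in> S then \<eta> x * f i x else 0)" for i x
  show ?thesis
  proof (rule that[of f' U])
    show "lipschitz_compact (f' i)" for i
      unfolding f'_def using \<eta>
      by (intro lipschitz_compact_zero_extension[OF S _ \<eta>(5,6)] locally_lipschitz_on_mult lipschitz_compact_locally f) auto
    show eq: "f' i x = f i x" if "x \<in> U" for i x using \<eta> that by (auto simp: f'_def)
    show "dir_diff v (f' i) x = dir_diff v (f i) x" "dir_deriv v (f' i) x = dir_deriv v (f i) x" if "x \<in> U" for i v x
      using dir_cong[OF \<eta>(2) that eq] by auto
  qed (use \<eta> in auto)
qed

lemma test_function_lipschitz_compact:
  fixes \<psi> :: "real^'n::finite \<Rightarrow> real"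
  assumes S: "open S" and \<psi>: "\<psi> \<in> test_functions S"
  defines "K \<equiv> closure {x \<in> S. \<psi> x \<noteq> 0}" and "\<psi>' \<equiv> (\<lambda>x. if x \<in> S then \<psi> x else 0)"
  shows "compact K" "K \<subseteq> S" "\<And>x. x \<notin> K \<Longrightarrow> \<psi>' x = 0" "lipschitz_compact \<psi>'"
    "\<And>x. x \<in> S \<Longrightarrow> dir_deriv (axis i 1) \<psi>' x = partial i \<psi> x"
proof -
  show K: "compact K" "K \<subseteq> S" using \<psi> by (auto simp: test_functions_def compact_support_in_def K_def)
  show 0: "\<psi>' x = 0" if "x \<notin> K" for x
    using that closure_subset[of "{x \<in> S. \<psi> x \<noteq> 0}"] by (auto simp: \<psi>'_def K_def)
  have 00: "\<psi> x = 0" if "x \<in> S" "x \<notin> K" for x using 0[OF that(2)] that(1) by (simp add: \<psi>'_def)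
  have C: "Ck (Suc 0) S \<psi>" using \<psi> unfolding test_functions_def by blast
  show "lipschitz_compact \<psi>'"
    unfolding \<psi>'_def by (intro lipschitz_compact_zero_extension[OF S Ck_1_locally_lipschitz[OF S C] K] 00)
  show "dir_deriv (axis i 1) \<psi>' x = partial i \<psi> x" if "x \<in> S" for x
  proof -
    have "dir_deriv (axis i 1) \<psi>' x = dir_deriv (axis i 1) \<psi> x"
      using that by (intro dir_cong(2)[OF S]) (auto simp: \<psi>'_def)
    then show ?thesis using dir_deriv_differentiable(2)[OF Ck_1D(1)[OF C that]] by simp
  qed
qed

text \<open>A weak solution of \<open>div T = G\<close> with \<open>T\<close> of class \<open>C\<^sup>1\<close> and \<open>G\<close> continuous is a classical one.\<close>

lemma divergence_eq_if_weak:
  fixes T :: "'n::finite \<Rightarrow> real^'n \<Rightarrow> real"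
  assumes S: "open S" and T: "\<And>i. Ck (Suc 0) S (T i)" and G: "continuous_on S G"
    and weak: "\<And>\<psi>. \<psi> \<in> test_functions S \<Longrightarrow> (LINT x:S|lebesgue. (\<Sum>i\<in>UNIV. T i x * partial i \<psi> x) + G x * \<psi> x) = 0"
    and "x \<in> S"
  shows "(\<Sum>i\<in>UNIV. partial i (T i) x) = G x"
proof -
  have "G x - (\<Sum>i\<in>UNIV. partial i (T i) x) = 0"
  proof (rule continuous_eq_0_if_orthogonal_test_functions[OF S _ _ \<open>x \<in> S\<close>])
    show "continuous_on S (\<lambda>x. G x - (\<Sum>i\<in>UNIV. partial i (T i) x))"
      using G Ck_1D(2)[OF T] by (intro continuous_intros)
    fix \<psi> assume \<psi>: "\<psi> \<in> test_functions S"
    define K where "K = closure {x \<in> S. \<psi> x \<noteq> 0}"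
    define \<psi>' where "\<psi>' = (\<lambda>x. if x \<in> S then \<psi> x else 0)"
    note t = test_function_lipschitz_compact[OF S \<psi>, folded K_def \<psi>'_def]
    have t3: "\<psi>' x = 0" if "x \<notin> K" for x using t(3)[OF that] by (simp add: \<psi>'_def)
    have t3': "\<psi> x = 0" if "x \<in> S" "x \<notin> K" for x using t3[OF that(2)] that(1) by (simp add: \<psi>'_def)
    obtain T' U where T': "\<And>i. lipschitz_compact (T' i)" "open U" "K \<subseteq> U" "U \<subseteq> S" "\<And>i x. x \<in> U \<Longrightarrow> T' i x = T i x"
      "\<And>i v x. x \<in> U \<Longrightarrow> dir_deriv v (T' i) x = dir_deriv v (T i) x"
      by (rule lipschitz_compact_localize[of S K T, OF S t(1,2) Ck_1_locally_lipschitz[OF S T]]) blast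
    have d0: "dir_deriv v \<psi>' x = 0" if "x \<notin> K" for x v
      using dir_deriv_outside_support[OF compact_imp_closed[OF t(1)] t3 that] .
    define p where "p i x = T' i x * dir_deriv (axis i 1) \<psi>' x" for i x
    define q where "q i x = dir_deriv (axis i 1) (T' i) x * \<psi>' x" for i x
    have G': "integrable lborel (\<lambda>x. if x \<in> S then G x * \<psi> x else 0)"
    proof -
      have "continuous_on K (\<lambda>x. G x * \<psi> x)"
        using G \<psi> t(2) Ck_1D(4)[of S \<psi>] unfolding test_functions_def
        by (intro continuous_intros) (auto intro: continuous_on_subset)
      from borel_integrable_compact[OF t(1) this] show ?thesis
        by (rule Bochner_Integration.integrable_cong[THEN iffD1, rotated -1])
          (use t(2) t3' in \<open>auto simp: indicator_def\<close>)
    qed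
    have intp: "integrable lborel (p i)" for i
    proof -
      obtain B where "\<And>x. \<bar>dir_deriv (axis i 1) \<psi>' x\<bar> \<le> B" using lipschitz_compact_dir_deriv_bound[OF t(4)] by metis
      from integrable_lipschitz_compact_mult[OF T'(1) lipschitz_compact_borel_dir[OF t(4)] this] show ?thesis
        by (simp add: p_def[abs_def])
    qed
    have intq: "integrable lborel (q i)" for i
    proof -
      obtain B where "\<And>x. \<bar>dir_deriv (axis i 1) (T' i) x\<bar> \<le> B" using lipschitz_compact_dir_deriv_bound[OF T'(1)] by metis
      from integrable_lipschitz_compact_mult[OF t(4) lipschitz_compact_borel_dir[OF T'(1)] this] show ?thesis
        by (simp add: q_def[abs_def] mult.commute)
    qed
    have peq: "p i x = (if x \<in> S then T i x * partial i \<psi> x else 0)" for i x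
    proof (cases "x \<in> K")
      case True
      then show ?thesis using T' t(2) t(5) by (auto simp: p_def)
    next
      case False
      then show ?thesis using t(5)[of x i] d0[OF False, of "axis i 1"] by (auto simp: p_def)
    qed
    have qeq: "q i x = (if x \<in> S then partial i (T i) x * \<psi> x else 0)" for i x
    proof (cases "x \<in> K")
      case True
      then have "x \<in> U" "x \<in> S" using T' by auto
      then show ?thesis using T'(6)[of x "axis i 1" i] dir_deriv_differentiable(2)[OF Ck_1D(1)[OF T]] by (auto simp: q_def \<psi>'_def)
    next
      case False
      then show ?thesis using t3[OF False] t3' by (auto simp: q_def)
    qed
    let ?g = "\<lambda>x. if x \<in> S then G x * \<psi> x else 0"
    have [measurable]: "p i \<in> borel_measurable borel" "q i \<in> borel_measurable borel" "?g \<in> borel_measurable borel" for i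
      using intp[of i] intq[of i] G' by auto
    have "0 = (LINT x:S|lebesgue. (\<Sum>i\<in>UNIV. T i x * partial i \<psi> x) + G x * \<psi> x)"
      using weak[OF \<psi>] by simp
    also have "\<dots> = (LINT x|lborel. (\<Sum>i\<in>UNIV. p i x) + ?g x)"
    proof (rule set_lebesgue_integral_eq_lborel(1))
      show "(\<lambda>x. (\<Sum>i\<in>UNIV. p i x) + ?g x) \<in> borel_measurable borel" by measurable
    qed (auto simp: peq)
    also have "\<dots> = (\<Sum>i\<in>UNIV. LINT x|lborel. p i x) + (LINT x|lborel. ?g x)"
      using intp G' by simp
    also have "(\<Sum>i\<in>UNIV. LINT x|lborel. p i x) = (\<Sum>i\<in>UNIV. - (LINT x|lborel. q i x))"
      using integral_by_parts[OF T'(1) t(4)] by (intro sum.cong refl) (simp add: p_def q_def)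
    also have "(\<Sum>i\<in>UNIV. - (LINT x|lborel. q i x)) + (LINT x|lborel. ?g x) = (LINT x|lborel. ?g x - (\<Sum>i\<in>UNIV. q i x))"
      using intq G' by (simp add: sum_negf)
    also have "\<dots> = (LINT x:S|lebesgue. (G x - (\<Sum>i\<in>UNIV. partial i (T i) x)) * \<psi> x)"
    proof (rule set_lebesgue_integral_eq_lborel(1)[symmetric])
      show "(\<lambda>x. ?g x - (\<Sum>i\<in>UNIV. q i x)) \<in> borel_measurable borel" by measurable
    qed (auto simp: qeq left_diff_distrib sum_distrib_right)
    finally show "(LINT x:S|lebesgue. (G x - (\<Sum>i\<in>UNIV. partial i (T i) x)) * \<psi> x) = 0" by simp
  qed
  then show ?thesis by simp
qed

text \<open>The equation \<open>div T = G\<close> differentiated in the direction of the \<open>j\<close>-th coordinate. As \<open>T\<close> is only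
  of class \<open>C\<^sup>1\<close>, the derivative of its divergence makes sense only when tested against \<open>\<psi>\<close>; the
  symmetry of second derivatives in the form of \<open>integral_dir_deriv_swap\<close> takes care of this.\<close>

lemma linearized_equation:
  fixes T :: "'n::finite \<Rightarrow> real^'n \<Rightarrow> real"
  assumes S: "open S" and T: "\<And>i. Ck (Suc 0) S (T i)" and G: "locally_lipschitz_on S G"
    and div: "\<And>x. x \<in> S \<Longrightarrow> (\<Sum>i\<in>UNIV. partial i (T i) x) = G x"
    and K: "compact K" "K \<subseteq> S" and \<psi>: "lipschitz_compact \<psi>" "\<And>x. x \<notin> K \<Longrightarrow> \<psi> x = 0"
  shows "integrable lborel (\<lambda>x. (\<Sum>i\<in>UNIV. partial j (T i) x * dir_deriv (axis i 1) \<psi> x))"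
    "integrable lborel (\<lambda>x. dir_deriv (axis j 1) G x * \<psi> x)"
    "(LINT x|lborel. (\<Sum>i\<in>UNIV. partial j (T i) x * dir_deriv (axis i 1) \<psi> x)) = - (LINT x|lborel. dir_deriv (axis j 1) G x * \<psi> x)"
proof -
  obtain T' U where T': "\<And>i. lipschitz_compact (T' i)" "open U" "K \<subseteq> U" "U \<subseteq> S" "\<And>i x. x \<in> U \<Longrightarrow> T' i x = T i x"
    "\<And>i v x. x \<in> U \<Longrightarrow> dir_deriv v (T' i) x = dir_deriv v (T i) x"
    by (rule lipschitz_compact_localize[of S K T, OF S K Ck_1_locally_lipschitz[OF S T]]) blast
  \<comment> \<open>A single function is a family over the type \<open>unit\<close>.\<close>
  obtain G' V where G': "\<And>i::unit. lipschitz_compact (G' i)" "open V" "K \<subseteq> V" "V \<subseteq> S" "\<And>i x. x \<in> V \<Longrightarrow> G' i x = G x"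
    "\<And>i v x. x \<in> V \<Longrightarrow> dir_deriv v (G' i) x = dir_deriv v G x"
    by (rule lipschitz_compact_localize[of S K "\<lambda>_. G", OF S K G]) blast
  have d0: "dir_deriv v \<psi> x = 0" if "x \<notin> K" for x v
    using dir_deriv_outside_support[of K \<psi> x] K(1) \<psi>(2) that by (auto simp: compact_imp_closed)
  have dd: "integrable lborel (\<lambda>x. dir_deriv v f x * dir_deriv w \<psi> x)" if f: "lipschitz_compact f" for f v w
  proof -
    obtain B where B: "\<And>x. \<bar>dir_deriv v f x\<bar> \<le> B" "0 \<le> B" using lipschitz_compact_dir_deriv_bound[OF f] by metis
    obtain C where C: "\<And>x. \<bar>dir_deriv w \<psi> x\<bar> \<le> C" using lipschitz_compact_dir_deriv_bound[OF \<psi>(1)] by metis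
    show ?thesis
    proof (rule integrable_compact_bounded[OF _ K(1), of _ "B * C"])
      show "(\<lambda>x. dir_deriv v f x * dir_deriv w \<psi> x) \<in> borel_measurable borel"
        using lipschitz_compact_borel_dir[OF f] lipschitz_compact_borel_dir[OF \<psi>(1)] by measurable
      show "\<bar>dir_deriv v f x * dir_deriv w \<psi> x\<bar> \<le> B * C" for x
        unfolding abs_mult using B C by (intro mult_mono) auto
    qed (simp add: d0)
  qed
  have eqT: "partial j (T i) x * dir_deriv (axis k 1) \<psi> x = dir_deriv (axis j 1) (T' i) x * dir_deriv (axis k 1) \<psi> x" for i j k x
  proof (cases "x \<in> K")
    case True
    then have "x \<in> U" "x \<in> S" using T' by auto
    then show ?thesis using T'(6)[of x "axis j 1" i] dir_deriv_differentiable(2)[OF Ck_1D(1)[OF T]] by auto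
  qed (simp add: d0)
  have eqG: "dir_deriv (axis j 1) G x * \<psi> x = dir_deriv (axis j 1) (G' ()) x * \<psi> x" for x
    using G'(3,6) \<psi>(2) by (cases "x \<in> K") auto
  show "integrable lborel (\<lambda>x. (\<Sum>i\<in>UNIV. partial j (T i) x * dir_deriv (axis i 1) \<psi> x))"
    unfolding eqT by (intro Bochner_Integration.integrable_sum dd T'(1))
  show "integrable lborel (\<lambda>x. dir_deriv (axis j 1) G x * \<psi> x)"
  proof -
    obtain B where "\<And>x. \<bar>dir_deriv (axis j 1) (G' ()) x\<bar> \<le> B" using lipschitz_compact_dir_deriv_bound[OF G'(1)] by metis
    from integrable_lipschitz_compact_mult[OF \<psi>(1) lipschitz_compact_borel_dir[OF G'(1)] this] show ?thesis
      unfolding eqG by (simp add: mult.commute)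
  qed
  have "(LINT x|lborel. (\<Sum>i\<in>UNIV. partial j (T i) x * dir_deriv (axis i 1) \<psi> x))
      = (\<Sum>i\<in>UNIV. LINT x|lborel. dir_deriv (axis j 1) (T' i) x * dir_deriv (axis i 1) \<psi> x)"
    unfolding eqT by (intro Bochner_Integration.integral_sum dd T'(1))
  also have "\<dots> = (\<Sum>i\<in>UNIV. LINT x|lborel. dir_deriv (axis i 1) (T' i) x * dir_deriv (axis j 1) \<psi> x)"
    by (intro sum.cong refl integral_dir_deriv_swap T'(1) \<psi>(1))
  also have "\<dots> = (LINT x|lborel. (\<Sum>i\<in>UNIV. dir_deriv (axis i 1) (T' i) x * dir_deriv (axis j 1) \<psi> x))"
    by (intro Bochner_Integration.integral_sum[symmetric] dd T'(1))
  also have "\<dots> = (LINT x|lborel. G' () x * dir_deriv (axis j 1) \<psi> x)"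
  proof (intro Bochner_Integration.integral_cong refl)
    fix x
    have "(\<Sum>i\<in>UNIV. dir_deriv (axis i 1) (T' i) x * dir_deriv (axis j 1) \<psi> x) = (\<Sum>i\<in>UNIV. partial i (T i) x) * dir_deriv (axis j 1) \<psi> x"
      unfolding eqT[symmetric] by (simp add: sum_distrib_right)
    also have "\<dots> = G' () x * dir_deriv (axis j 1) \<psi> x"
    proof (cases "x \<in> K")
      case True
      then have "x \<in> V" "x \<in> S" using G'(3) K(2) by auto
      then show ?thesis using div G'(5) by simp
    qed (simp add: d0)
    finally show "(\<Sum>i\<in>UNIV. dir_deriv (axis i 1) (T' i) x * dir_deriv (axis j 1) \<psi> x) = G' () x * dir_deriv (axis j 1) \<psi> x" .
  qed
  also have "\<dots> = - (LINT x|lborel. dir_deriv (axis j 1) (G' ()) x * \<psi> x)"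
    using integral_by_parts[OF G'(1) \<psi>(1), of "axis j 1"] by simp
  finally show "(LINT x|lborel. (\<Sum>i\<in>UNIV. partial j (T i) x * dir_deriv (axis i 1) \<psi> x)) = - (LINT x|lborel. dir_deriv (axis j 1) G x * \<psi> x)"
    unfolding eqG .
qed

section \<open>Curvature of level sets and the pointwise inequalities\<close>

text \<open>The Hessian matrix; its \<open>i\<close>-th row is the gradient of \<open>partial i w\<close>.\<close>

definition hess :: "(real^'n::finite \<Rightarrow> real) \<Rightarrow> real^'n \<Rightarrow> real^'n^'n" where
  "hess w x = (\<chi> i j. partial j (partial i w) x)"

lemma hess_symmetric:
  assumes "open S" "Ck 2 S w" "x \<in> S"
  shows "transpose (hess w x) = hess w x"
proof -
  have "partial j (partial i w) x = partial i (partial j w) x" for i j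
    using Ck_1D(1)[OF Ck_2D(1)[OF assms(2)]] Ck_1D(1)[OF Ck_2D(2)[OF assms(2)] assms(3)]
    by (intro partial_partial_commute[OF assms(1,3)]) auto
  then show ?thesis by (simp add: transpose_def hess_def vec_eq_iff)
qed

lemma has_derivative_partial_hess:
  assumes "Ck 2 S w" "x \<in> S"
  shows "(partial i w has_derivative (\<lambda>h. (hess w x *v h) $ i)) (at x)"
proof -
  have "(hess w x *v h) $ i = grad (partial i w) x \<bullet> h" for h
    by (simp add: hess_def matrix_vector_mult_def inner_vec_def grad_def)
  then show ?thesis using has_derivative_grad[OF Ck_1D(1)[OF Ck_2D(2)[OF assms(1)] assms(2)]] by simp
qed

lemma vec_expansion: "(\<Sum>i\<in>UNIV. v $ i *\<^sub>R axis i 1) = (v :: real^'n::finite)"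
  using basis_expansion[of v] by (simp add: scalar_mult_eq_scaleR)

lemma has_derivative_grad_hess:
  fixes w :: "real^'n::finite \<Rightarrow> real"
  assumes "Ck 2 S w" "x \<in> S"
  shows "(grad w has_derivative (\<lambda>h. hess w x *v h)) (at x)"
proof -
  have "((\<lambda>y. \<Sum>i\<in>UNIV. partial i w y *\<^sub>R (axis i 1 :: real^'n)) has_derivative (\<lambda>h. \<Sum>i\<in>UNIV. (hess w x *v h) $ i *\<^sub>R (axis i 1 :: real^'n))) (at x)"
    by (intro has_derivative_sum has_derivative_scaleR_left has_derivative_partial_hess[OF assms])
  then have "((\<lambda>y. \<Sum>i\<in>UNIV. grad w y $ i *\<^sub>R (axis i 1 :: real^'n)) has_derivative (\<lambda>h. \<Sum>i\<in>UNIV. (hess w x *v h) $ i *\<^sub>R (axis i 1 :: real^'n))) (at x)"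
    by (simp only: grad_def vec_lambda_beta)
  then show ?thesis by (simp only: vec_expansion)
qed

lemma norm_vec_power2: "(norm (v :: real^'n::finite))\<^sup>2 = (\<Sum>i\<in>UNIV. (v $ i)\<^sup>2)"
  by (simp add: norm_vec_def L2_set_def sum_nonneg)

lemma inner_symmetric_matrix:
  fixes H :: "real^'n::finite^'n"
  assumes "transpose H = H" shows "(H *v x) \<bullet> y = x \<bullet> (H *v y)"
  using dot_lmul_matrix[of x H y] assms by (metis inner_commute transpose_matrix_vector)

lemma has_derivative_norm_grad:
  assumes "Ck 2 S w" "x \<in> S" "grad w x \<noteq> 0"
  shows "((\<lambda>y. norm (grad w y)) has_derivative (\<lambda>h. unit_normal w x \<bullet> (hess w x *v h))) (at x)"
proof -
  have "((\<lambda>y. norm (grad w y)) has_derivative (\<lambda>h. (hess w x *v h) \<bullet> sgn (grad w x))) (at x)"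
    using has_derivative_compose[OF has_derivative_grad_hess[OF assms(1,2)] has_derivative_norm[OF assms(3)]] .
  then show ?thesis by (simp add: sgn_div_norm unit_normal_def inner_commute)
qed

lemma grad_norm_grad:
  assumes "open S" "Ck 2 S w" "x \<in> S" "grad w x \<noteq> 0"
  shows "grad (\<lambda>y. norm (grad w y)) x = hess w x *v unit_normal w x"
proof (rule grad_eqI)
  have "(\<lambda>h. unit_normal w x \<bullet> (hess w x *v h)) = (\<bullet>) (hess w x *v unit_normal w x)"
    by (intro ext inner_symmetric_matrix[OF hess_symmetric[OF assms(1-3)], symmetric])
  then show "((\<lambda>y. norm (grad w y)) has_derivative (\<bullet>) (hess w x *v unit_normal w x)) (at x)"
    using has_derivative_norm_grad[OF assms(2-4)] by (simp only:)
qed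

lemma unit_normal_inner: "grad w x \<noteq> 0 \<Longrightarrow> unit_normal w x \<bullet> unit_normal w x = 1"
  by (simp add: unit_normal_def dot_square_norm power2_eq_square)

text \<open>The differential of \<open>\<nu> = \<nabla>w / |\<nabla>w|\<close> is the Hessian followed by the orthogonal projection along \<open>\<nu>\<close>,
  divided by \<open>|\<nabla>w|\<close>.\<close>

lemma shape_matrix_mult:
  assumes "Ck 2 S w" "x \<in> S" "grad w x \<noteq> 0"
  shows "shape_matrix w x *v X = - (1 / norm (grad w x)) *\<^sub>R (hess w x *v X - (unit_normal w x \<bullet> (hess w x *v X)) *\<^sub>R unit_normal w x)"
proof -
  let ?N = "norm (grad w x)" and ?\<nu> = "unit_normal w x"
  define D where "D h = (1 / ?N) *\<^sub>R (hess w x *v h - (?\<nu> \<bullet> (hess w x *v h)) *\<^sub>R ?\<nu>)" for h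
  have N: "?N \<noteq> 0" using assms by simp
  have "((\<lambda>y. unit_normal w y $ i) has_derivative (\<lambda>h. D h $ i)) (at x)" for i
  proof -
    have "((\<lambda>y. partial i w y / norm (grad w y)) has_derivative
        (\<lambda>h. ((hess w x *v h) $ i * ?N - partial i w x * (?\<nu> \<bullet> (hess w x *v h))) / (?N * ?N))) (at x)"
      by (rule has_derivative_divide'[OF has_derivative_partial_hess[OF assms(1,2)] has_derivative_norm_grad[OF assms] N])
    moreover have "((hess w x *v h) $ i * ?N - partial i w x * (?\<nu> \<bullet> (hess w x *v h))) / (?N * ?N) = D h $ i" for h
      using N by (simp add: D_def unit_normal_def grad_def divide_simps)
    moreover have "(\<lambda>y. unit_normal w y $ i) = (\<lambda>y. partial i w y / norm (grad w y))"
      by (simp add: unit_normal_def grad_def divide_inverse mult.commute)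
    ultimately show ?thesis by simp
  qed
  from has_derivative_partial[OF this] have p: "partial j (\<lambda>y. unit_normal w y $ i) x = D (axis j 1) $ i" for i j .
  have lin: "linear D"
    unfolding D_def by (intro linearI) (simp_all add: matrix_vector_right_distrib matrix_vector_mult_scaleR inner_add_right algebra_simps)
  have "shape_matrix w x *v X = - (\<Sum>j\<in>UNIV. X $ j *\<^sub>R D (axis j 1))"
    by (simp add: vec_eq_iff matrix_vector_mult_def shape_matrix_def p sum_negf mult.commute)
  also have "(\<Sum>j\<in>UNIV. X $ j *\<^sub>R D (axis j 1)) = D (\<Sum>j\<in>UNIV. X $ j *\<^sub>R axis j 1)"
    by (simp add: linear_sum[OF lin] linear_cmul[OF lin])
  also have "(\<Sum>j\<in>UNIV. X $ j *\<^sub>R axis j 1) = X"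
    using basis_expansion[of X] by (simp add: scalar_mult_eq_scaleR)
  finally show ?thesis by (simp add: D_def)
qed

lemma bessel_inequality:
  fixes a :: "'a::euclidean_space"
  assumes "finite B" and orth: "pairwise orthogonal B" and norm1: "\<And>b. b \<in> B \<Longrightarrow> norm b = 1"
  shows "(\<Sum>b\<in>B. (a \<bullet> b)\<^sup>2) \<le> (norm a)\<^sup>2"
proof -
  define c where "c = (\<Sum>b\<in>B. (a \<bullet> b) *\<^sub>R b)"
  have cb: "c \<bullet> b = a \<bullet> b" if b: "b \<in> B" for b
  proof -
    have "c \<bullet> b = (\<Sum>b'\<in>B. (a \<bullet> b') * (b' \<bullet> b))" by (simp add: c_def inner_sum_left)
    also have "\<dots> = (\<Sum>b'\<in>B. if b' = b then a \<bullet> b else 0)"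
    proof (rule sum.cong[OF refl])
      fix b' assume "b' \<in> B"
      then show "(a \<bullet> b') * (b' \<bullet> b) = (if b' = b then a \<bullet> b else 0)"
        using orth b norm1[OF b] by (auto simp: pairwise_def orthogonal_def dot_square_norm)
    qed
    also have "\<dots> = a \<bullet> b" using b assms(1) by simp
    finally show ?thesis .
  qed
  have ac: "a \<bullet> c = (\<Sum>b\<in>B. (a \<bullet> b)\<^sup>2)" by (simp add: c_def inner_sum_right power2_eq_square)
  have cc: "c \<bullet> c = (\<Sum>b\<in>B. (a \<bullet> b)\<^sup>2)"
  proof -
    have "c \<bullet> c = (\<Sum>b\<in>B. (a \<bullet> b) * (c \<bullet> b))" by (subst (2) c_def) (simp add: inner_sum_right)
    then show ?thesis using cb by (simp add: power2_eq_square)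
  qed
  have "0 \<le> (a - c) \<bullet> (a - c)" by simp
  also have "\<dots> = a \<bullet> a - (\<Sum>b\<in>B. (a \<bullet> b)\<^sup>2)"
    by (simp add: inner_diff_left inner_diff_right inner_commute[of c a] ac cc)
  finally show ?thesis by (simp add: power2_norm_eq_inner)
qed

lemma sum_norm_image_orthonormal_le:
  fixes M :: "real^'n::finite^'n"
  assumes "finite B" "pairwise orthogonal B" "\<And>b. b \<in> B \<Longrightarrow> norm b = 1"
  shows "(\<Sum>b\<in>B. (norm (M *v b))\<^sup>2) \<le> (\<Sum>j\<in>UNIV. (norm (M *v axis j 1))\<^sup>2)"
proof -
  have n: "(norm (M *v b))\<^sup>2 = (\<Sum>i\<in>UNIV. (M $ i \<bullet> b)\<^sup>2)" for b
    by (simp add: norm_vec_power2 matrix_vector_mul_component)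
  have "(\<Sum>b\<in>B. (norm (M *v b))\<^sup>2) = (\<Sum>i\<in>UNIV. \<Sum>b\<in>B. (M $ i \<bullet> b)\<^sup>2)"
    unfolding n by (rule sum.swap)
  also have "\<dots> \<le> (\<Sum>i\<in>UNIV. (norm (M $ i))\<^sup>2)"
    by (intro sum_mono bessel_inequality assms)
  also have "\<dots> = (\<Sum>i\<in>UNIV. \<Sum>j\<in>UNIV. (M $ i $ j)\<^sup>2)"
    by (simp add: norm_vec_power2)
  also have "\<dots> = (\<Sum>j\<in>UNIV. (norm (M *v axis j 1))\<^sup>2)"
    unfolding n by (subst sum.swap) (simp add: inner_axis)
  finally show ?thesis .
qed

lemma subspace_curvature_space: "subspace (curvature_space w x \<kappa>)"
  unfolding subspace_def curvature_space_def tangent_space_def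
  by (auto simp: matrix_vector_right_distrib matrix_vector_mult_scaleR inner_add_left scaleR_add_right)

lemma sum_mset_eq_sum_count:
  fixes f :: "'b \<Rightarrow> real"
  shows "(\<Sum>x\<in>#M. f x) = (\<Sum>x\<in>set_mset M. real (count M x) * f x)"
proof -
  have "(\<Sum>x\<in>#M. f x) = (\<Sum>x\<in>A. real (count M x) * f x)" if "finite A" "set_mset M \<subseteq> A" for A
    using that(2)
  proof (induction M)
    case (add y M)
    have "(\<Sum>x\<in>A. real (count (add_mset y M) x) * f x) = (\<Sum>x\<in>A. real (count M x) * f x + (if x = y then f x else 0))"
      by (intro sum.cong refl) (auto simp: algebra_simps)
    also have "\<dots> = (\<Sum>x\<in>A. real (count M x) * f x) + f y"
      using that(1) add.prems by (simp add: sum.distrib)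
    finally show ?case using add by simp
  qed simp
  then show ?thesis by simp
qed

text \<open>The sum of the squared principal curvatures is at most the squared Frobenius norm of the
  Weingarten map: orthonormal bases of the eigenspaces form an orthonormal family, to which Bessel's
  inequality applies. (There is in fact equality, by the spectral theorem.)\<close>

lemma sum_principal_curvatures_le:
  fixes w :: "real^'n::finite \<Rightarrow> real"
  assumes "open S" "Ck 2 S w" "x \<in> S" "grad w x \<noteq> 0"
  defines "\<nu> \<equiv> unit_normal w x" and "H \<equiv> hess w x"
  shows "(norm (grad w x))\<^sup>2 * (\<Sum>\<kappa>\<in>#principal_curvatures w x. \<kappa>\<^sup>2)
     \<le> (\<Sum>j\<in>UNIV. (norm (H *v axis j 1))\<^sup>2) - 2 * (norm (H *v \<nu>))\<^sup>2 + (\<nu> \<bullet> (H *v \<nu>))\<^sup>2"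
proof -
  let ?N = "norm (grad w x)" and ?M = "principal_curvatures w x"
  have N: "0 < ?N" using assms by simp
  have \<nu>1: "\<nu> \<bullet> \<nu> = 1" unfolding \<nu>_def by (rule unit_normal_inner) fact
  have sym: "(H *v y) \<bullet> z = y \<bullet> (H *v z)" for y z
    unfolding H_def by (rule inner_symmetric_matrix[OF hess_symmetric[OF assms(1-3)]])
  have shape: "shape_matrix w x *v X = - (1 / ?N) *\<^sub>R (H *v X - (\<nu> \<bullet> (H *v X)) *\<^sub>R \<nu>)" for X
    unfolding \<nu>_def H_def by (rule shape_matrix_mult[OF assms(2-4)])
  have tang: "X \<bullet> \<nu> = 0" if "X \<in> curvature_space w x \<kappa>" for X \<kappa>
    using that N by (simp add: curvature_space_def tangent_space_def \<nu>_def unit_normal_def)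
  have eig: "H *v X - (\<nu> \<bullet> (H *v X)) *\<^sub>R \<nu> = (- ?N * \<kappa>) *\<^sub>R X" if "X \<in> curvature_space w x \<kappa>" for X \<kappa>
  proof -
    have "shape_matrix w x *v X = \<kappa> *\<^sub>R X" using that by (simp add: curvature_space_def)
    then have "- (1 / ?N) *\<^sub>R (H *v X - (\<nu> \<bullet> (H *v X)) *\<^sub>R \<nu>) = \<kappa> *\<^sub>R X" unfolding shape .
    then have "(- ?N) *\<^sub>R (- (1 / ?N) *\<^sub>R (H *v X - (\<nu> \<bullet> (H *v X)) *\<^sub>R \<nu>)) = (- ?N) *\<^sub>R (\<kappa> *\<^sub>R X)" by simp
    then show ?thesis using N by simp
  qed
  \<comment> \<open>On the tangent space, \<open>C\<close> is \<open>-|\<nabla>w|\<close> times the Weingarten map. The vector \<open>\<nu>\<close> is added to the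
    orthonormal family, since \<open>C \<nu>\<close> contributes to the Frobenius norm of \<open>C\<close> as well.\<close>
  define C where "C = matrix (\<lambda>X. H *v X - (\<nu> \<bullet> (H *v X)) *\<^sub>R \<nu>)"
  have lin: "linear (\<lambda>X. H *v X - (\<nu> \<bullet> (H *v X)) *\<^sub>R \<nu>)"
    by (intro linearI) (simp_all add: matrix_vector_right_distrib matrix_vector_mult_scaleR inner_add_right algebra_simps)
  have C: "C *v X = H *v X - (\<nu> \<bullet> (H *v X)) *\<^sub>R \<nu>" for X
    unfolding C_def using fun_cong[OF matrix_vector_mul(2)[OF lin], of X] by simp
  have nC: "(norm (C *v X))\<^sup>2 = (norm (H *v X))\<^sup>2 - (\<nu> \<bullet> (H *v X))\<^sup>2" for X
    unfolding C power2_norm_eq_inner using \<nu>1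
    by (simp add: inner_diff_left inner_diff_right inner_commute power2_eq_square algebra_simps)
  have "\<exists>B. B \<subseteq> curvature_space w x \<kappa> \<and> pairwise orthogonal B \<and> (\<forall>b\<in>B. norm b = 1) \<and> finite B \<and> card B = dim (curvature_space w x \<kappa>)" for \<kappa>
  proof -
    obtain B where "B \<subseteq> curvature_space w x \<kappa>" "pairwise orthogonal B" "\<And>b. b \<in> B \<Longrightarrow> norm b = 1" "independent B" "card B = dim (curvature_space w x \<kappa>)"
      using orthonormal_basis_subspace[OF subspace_curvature_space] by metis
    then show ?thesis using independent_imp_finite by blast
  qed
  then obtain B where B: "\<And>\<kappa>. B \<kappa> \<subseteq> curvature_space w x \<kappa>" "\<And>\<kappa>. pairwise orthogonal (B \<kappa>)" "\<And>\<kappa> b. b \<in> B \<kappa> \<Longrightarrow> norm b = 1"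
     "\<And>\<kappa>. finite (B \<kappa>)" "\<And>\<kappa>. card (B \<kappa>) = dim (curvature_space w x \<kappa>)" by metis
  have orth: "X \<bullet> Y = 0" if "X \<in> B \<kappa>" "Y \<in> B \<mu>" "\<kappa> \<noteq> \<mu>" for X Y \<kappa> \<mu>
  proof -
    have X: "X \<in> curvature_space w x \<kappa>" and Y: "Y \<in> curvature_space w x \<mu>" using B(1) that by auto
    have "(H *v X - (\<nu> \<bullet> (H *v X)) *\<^sub>R \<nu>) \<bullet> Y = (H *v X) \<bullet> Y" using tang[OF Y] by (simp add: inner_diff_left inner_commute[of \<nu> Y])
    then have 1: "(H *v X) \<bullet> Y = - ?N * \<kappa> * (X \<bullet> Y)" unfolding eig[OF X] by simp
    have "X \<bullet> (H *v Y - (\<nu> \<bullet> (H *v Y)) *\<^sub>R \<nu>) = X \<bullet> (H *v Y)" using tang[OF X] by (simp add: inner_diff_right)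
    then have 2: "X \<bullet> (H *v Y) = - ?N * \<mu> * (X \<bullet> Y)" unfolding eig[OF Y] by simp
    have "?N * (\<kappa> - \<mu>) * (X \<bullet> Y) = 0" using 1 2 sym[of X Y] by algebra
    then show ?thesis using N that(3) by auto
  qed
  let ?B = "\<Union>\<kappa>\<in>set_mset ?M. B \<kappa>"
  have disj: "B \<kappa> \<inter> B \<mu> = {}" if "\<kappa> \<noteq> \<mu>" for \<kappa> \<mu>
  proof (rule equals0I)
    fix X assume "X \<in> B \<kappa> \<inter> B \<mu>"
    then have "X \<bullet> X = 0" "norm X = 1" using orth[of X \<kappa> X \<mu>] that B(3)[of X \<kappa>] by auto
    then show False by (simp add: dot_square_norm)
  qed
  have \<nu>B: "\<nu> \<notin> ?B"
  proof
    assume "\<nu> \<in> ?B"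
    then obtain \<kappa> where "\<nu> \<in> curvature_space w x \<kappa>" using B(1) by auto
    then show False using tang \<nu>1 by fastforce
  qed
  have fin: "finite ?B" using B(4) by auto
  have "pairwise orthogonal (insert \<nu> ?B)"
    unfolding pairwise_def orthogonal_def
  proof (intro ballI impI)
    fix X Y assume XY: "X \<in> insert \<nu> ?B" "Y \<in> insert \<nu> ?B" "X \<noteq> Y"
    have 1: "X \<bullet> Y = 0" if X: "X \<in> ?B" and Y: "Y \<in> ?B"
    proof -
      obtain \<kappa> \<mu> where "X \<in> B \<kappa>" "Y \<in> B \<mu>" using X Y by blast
      then show ?thesis using orth[of X \<kappa> Y \<mu>] B(2)[of \<kappa>] XY(3) by (cases "\<kappa> = \<mu>") (auto simp: pairwise_def orthogonal_def)
    qed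
    have 2: "X \<bullet> \<nu> = 0" if "X \<in> ?B" for X using that tang B(1) by blast
    show "X \<bullet> Y = 0"
    proof (cases "X = \<nu>")
      case True
      then show ?thesis using XY 2[of Y] by (simp add: inner_commute[of \<nu> Y])
    next
      case False
      then show ?thesis using XY 1 2[of X] by (cases "Y = \<nu>") auto
    qed
  qed
  moreover have "norm b = 1" if "b \<in> insert \<nu> ?B" for b
    using that B(3) \<nu>1 by (auto simp: norm_eq_1)
  ultimately have "(\<Sum>b\<in>insert \<nu> ?B. (norm (C *v b))\<^sup>2) \<le> (\<Sum>j\<in>UNIV. (norm (C *v axis j 1))\<^sup>2)"
    using fin by (intro sum_norm_image_orthonormal_le) auto
  then have le: "(\<Sum>b\<in>?B. (norm (C *v b))\<^sup>2) \<le> (\<Sum>j\<in>UNIV. (norm (C *v axis j 1))\<^sup>2) - (norm (C *v \<nu>))\<^sup>2"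
    using fin \<nu>B by simp
  have "(\<Sum>j\<in>UNIV. (\<nu> \<bullet> (H *v axis j 1))\<^sup>2) = (\<Sum>j\<in>UNIV. ((H *v \<nu>) $ j)\<^sup>2)"
    by (simp flip: sym add: inner_axis)
  also have "\<dots> = (norm (H *v \<nu>))\<^sup>2" by (simp add: norm_vec_power2)
  finally have s1: "(\<Sum>j\<in>UNIV. (norm (C *v axis j 1))\<^sup>2) = (\<Sum>j\<in>UNIV. (norm (H *v axis j 1))\<^sup>2) - (norm (H *v \<nu>))\<^sup>2"
    unfolding nC by (simp add: sum_subtractf)
  have "(\<Sum>b\<in>?B. (norm (C *v b))\<^sup>2) = (\<Sum>\<kappa>\<in>set_mset ?M. \<Sum>b\<in>B \<kappa>. (norm (C *v b))\<^sup>2)"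
    using B(4) disj by (intro sum.UNION_disjoint) auto
  also have "\<dots> = (\<Sum>\<kappa>\<in>set_mset ?M. real (count ?M \<kappa>) * (?N\<^sup>2 * \<kappa>\<^sup>2))"
  proof (rule sum.cong[OF refl])
    fix \<kappa>
    have "(norm (C *v b))\<^sup>2 = ?N\<^sup>2 * \<kappa>\<^sup>2" if "b \<in> B \<kappa>" for b
    proof -
      have "C *v b = (- ?N * \<kappa>) *\<^sub>R b" using eig[of b \<kappa>] B(1)[of \<kappa>] that unfolding C by blast
      then show ?thesis using B(3)[OF that] by (simp add: power_mult_distrib)
    qed
    then show "(\<Sum>b\<in>B \<kappa>. (norm (C *v b))\<^sup>2) = real (count ?M \<kappa>) * (?N\<^sup>2 * \<kappa>\<^sup>2)"
      by (simp add: B(5) count_principal_curvatures)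
  qed
  also have "\<dots> = ?N\<^sup>2 * (\<Sum>\<kappa>\<in>#?M. \<kappa>\<^sup>2)"
    by (simp add: sum_mset_eq_sum_count sum_distrib_left mult_ac)
  finally show ?thesis using le s1 nC[of \<nu>] by linarith
qed

lemma coeff_matrix_mult:
  fixes \<xi> y :: "real^'n::finite"
  shows "coeff_matrix a \<xi> *v y = (deriv a (norm \<xi>) / norm \<xi> * (\<xi> \<bullet> y)) *\<^sub>R \<xi> + a (norm \<xi>) *\<^sub>R y"
proof -
  have "(\<Sum>k\<in>UNIV. (c * \<xi> $ h * \<xi> $ k + b * (if h = k then 1 else 0)) * y $ k) = c * (\<xi> \<bullet> y) * \<xi> $ h + b * y $ h" for b c h
  proof -
    have "(\<Sum>k\<in>UNIV. (c * \<xi> $ h * \<xi> $ k + b * (if h = k then 1 else 0)) * y $ k)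
        = (\<Sum>k\<in>UNIV. (c * \<xi> $ h) * (\<xi> $ k * y $ k) + (if h = k then b * y $ k else 0))"
      by (intro sum.cong refl) (simp add: algebra_simps)
    also have "\<dots> = c * \<xi> $ h * (\<xi> \<bullet> y) + b * y $ h"
      by (simp add: sum.distrib sum_distrib_left[symmetric] inner_vec_def)
    finally show ?thesis by (simp add: mult_ac)
  qed
  then have "(coeff_matrix a \<xi> *v y) $ h = deriv a (norm \<xi>) / norm \<xi> * (\<xi> \<bullet> y) * \<xi> $ h + a (norm \<xi>) * y $ h" for h
    unfolding matrix_vector_mult_def coeff_matrix_def vec_lambda_beta .
  then show ?thesis by (simp add: vec_eq_iff)
qed

lemma coeff_matrix_inner:
  fixes \<xi> y z :: "real^'n::finite"
  shows "(coeff_matrix a \<xi> *v y) \<bullet> z = deriv a (norm \<xi>) / norm \<xi> * (\<xi> \<bullet> y) * (\<xi> \<bullet> z) + a (norm \<xi>) * (y \<bullet> z)"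
  by (simp add: coeff_matrix_mult inner_add_left)

lemma coeff_matrix_nonneg:
  fixes \<xi> z :: "real^'n::finite"
  assumes "\<xi> \<noteq> 0" "0 < a (norm \<xi>) \<and> 0 < a (norm \<xi>) + deriv a (norm \<xi>) * norm \<xi>"
  shows "0 \<le> (coeff_matrix a \<xi> *v z) \<bullet> z"
proof -
  let ?N = "norm \<xi>"
  have N: "0 < ?N" using assms by simp
  have cs: "(\<xi> \<bullet> z)\<^sup>2 \<le> ?N\<^sup>2 * (z \<bullet> z)"
    using Cauchy_Schwarz_ineq[of \<xi> z] by (simp add: power2_norm_eq_inner)
  have "?N\<^sup>2 * ((coeff_matrix a \<xi> *v z) \<bullet> z) = (a ?N + deriv a ?N * ?N) * (\<xi> \<bullet> z)\<^sup>2 + a ?N * (?N\<^sup>2 * (z \<bullet> z) - (\<xi> \<bullet> z)\<^sup>2)"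
    using N by (simp add: coeff_matrix_inner field_simps power2_eq_square)
  also have "\<dots> \<ge> 0" using assms cs by (intro add_nonneg_nonneg mult_nonneg_nonneg[OF less_imp_le] zero_le_power2) auto
  finally have "0 \<le> ?N\<^sup>2 * ((coeff_matrix a \<xi> *v z) \<bullet> z)" .
  then show ?thesis using N by (metis mult_le_cancel_left_pos mult_zero_right zero_less_power)
qed

text \<open>With \<open>\<xi> = \<nabla>w\<close> and \<open>\<nu> = \<xi> / |\<xi>|\<close>, the matrix \<open>A(\<xi>)\<close> has the eigenvalue \<open>\<lambda>\<^sub>1\<close> in the direction \<open>\<nu>\<close> and
  \<open>\<lambda>\<^sub>2\<close> orthogonally to it, while \<open>\<nabla>|\<nabla>w| = H\<nu>\<close>. The right-hand side thus is a combination of the squared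
  Frobenius norm of \<open>H\<close>, \<open>|H\<nu>|\<^sup>2\<close> and \<open>(\<nu> \<bullet> H\<nu>)\<^sup>2\<close>, and equals the upper bound for the left-hand
  side that results from \<open>sum_principal_curvatures_le\<close>.\<close>

lemma curvature_terms_le:
  fixes w :: "real^'n::finite \<Rightarrow> real"
  assumes "open S" "Ck 2 S w" "x \<in> S" "grad w x \<noteq> 0"
    and a: "0 < a (norm (grad w x)) \<and> 0 < a (norm (grad w x)) + deriv a (norm (grad w x)) * norm (grad w x)"
  defines "\<nu> \<equiv> unit_normal w x" and "H \<equiv> hess w x" and "A \<equiv> coeff_matrix a (grad w x)" and "N \<equiv> norm (grad w x)"
  shows "eig1 a N * (norm (tangential_grad w (\<lambda>y. norm (grad w y)) x))\<^sup>2 + eig2 a N * N\<^sup>2 * (\<Sum>\<kappa>\<in>#principal_curvatures w x. \<kappa>\<^sup>2)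
    \<le> (\<Sum>j\<in>UNIV. (A *v (H *v axis j 1)) \<bullet> (H *v axis j 1)) - (A *v (H *v \<nu>)) \<bullet> (H *v \<nu>)"
proof -
  have N: "0 < N" using assms by simp
  have \<xi>: "grad w x = N *\<^sub>R \<nu>" using N by (simp add: \<nu>_def unit_normal_def N_def)
  have \<nu>1: "\<nu> \<bullet> \<nu> = 1" unfolding \<nu>_def by (rule unit_normal_inner) fact
  have sym: "(H *v y) \<bullet> z = y \<bullet> (H *v z)" for y z
    unfolding H_def by (rule inner_symmetric_matrix[OF hess_symmetric[OF assms(1-3)]])
  have A: "(A *v y) \<bullet> y = deriv a N * N * (\<nu> \<bullet> y)\<^sup>2 + a N * (norm y)\<^sup>2" for y
  proof -
    have "(A *v y) \<bullet> y = deriv a N / N * (grad w x \<bullet> y) * (grad w x \<bullet> y) + a N * (y \<bullet> y)"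
      by (simp add: A_def coeff_matrix_inner N_def)
    then show ?thesis using N by (simp add: \<xi> power2_norm_eq_inner) (simp add: power2_eq_square)
  qed
  define F where "F = (\<Sum>j\<in>UNIV. (norm (H *v axis j 1))\<^sup>2)"
  define h where "h = (norm (H *v \<nu>))\<^sup>2"
  define q where "q = (\<nu> \<bullet> (H *v \<nu>))\<^sup>2"
  have "tangential_grad w (\<lambda>y. norm (grad w y)) x = H *v \<nu> - ((H *v \<nu>) \<bullet> \<nu>) *\<^sub>R \<nu>"
    by (simp add: tangential_grad_def grad_norm_grad[OF assms(1-4)] H_def \<nu>_def)
  then have t: "(norm (tangential_grad w (\<lambda>y. norm (grad w y)) x))\<^sup>2 = h - q"
    using \<nu>1 unfolding h_def q_def power2_norm_eq_inner
    by (simp add: inner_diff_left inner_diff_right inner_commute[of "H *v \<nu>" \<nu>] power2_eq_square)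
  have k: "N\<^sup>2 * (\<Sum>\<kappa>\<in>#principal_curvatures w x. \<kappa>\<^sup>2) \<le> F - 2 * h + q"
    unfolding N_def F_def h_def q_def H_def \<nu>_def by (rule sum_principal_curvatures_le[OF assms(1-4)])
  have "(\<Sum>j\<in>UNIV. (\<nu> \<bullet> (H *v axis j 1))\<^sup>2) = (\<Sum>j\<in>UNIV. ((H *v \<nu>) $ j)\<^sup>2)"
    by (simp flip: sym add: inner_axis)
  also have "\<dots> = h" by (simp add: h_def norm_vec_power2)
  finally have s: "(\<Sum>j\<in>UNIV. (A *v (H *v axis j 1)) \<bullet> (H *v axis j 1)) = deriv a N * N * h + a N * F"
    by (simp add: A sum.distrib sum_distrib_left[symmetric] F_def)
  have "eig1 a N * (h - q) + a N * (N\<^sup>2 * (\<Sum>\<kappa>\<in>#principal_curvatures w x. \<kappa>\<^sup>2)) \<le> eig1 a N * (h - q) + a N * (F - 2 * h + q)"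
    using a k by (intro add_left_mono mult_left_mono) (auto simp: N_def)
  also have "\<dots> = deriv a N * N * h + a N * F - (deriv a N * N * q + a N * h)"
    by (simp add: eig1_def algebra_simps)
  finally show ?thesis unfolding t s unfolding A eig2_def h_def[symmetric] q_def[symmetric] by (simp only: mult.assoc)
qed

text \<open>A Picone type inequality. It is used with \<open>f = \<phi>\<close>, \<open>p = \<nabla>\<phi>\<close>, \<open>s = \<partial>\<^sub>nw\<close> and \<open>y = \<nabla>\<partial>\<^sub>nw\<close> at a point.
  With \<open>c = |\<xi>| f / s\<close> and \<open>Z = f H\<nu> + |\<xi>| p\<close>, which is then the gradient of \<open>|\<nabla>w| \<phi>\<close>, the right-hand
  side minus the left-hand side is \<open>A (Z - c y) \<bullet> (Z - c y) \<ge> 0\<close>.\<close>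

lemma picone_pointwise:
  fixes H :: "real^'n::finite^'n" and \<xi> p y \<nu> :: "real^'n" and f s :: real
  assumes \<xi>: "\<xi> \<noteq> 0" and a: "0 < a (norm \<xi>) \<and> 0 < a (norm \<xi>) + deriv a (norm \<xi>) * norm \<xi>"
    and s: "s \<noteq> 0"
  defines "\<nu> \<equiv> \<xi> /\<^sub>R norm \<xi>" and "A \<equiv> coeff_matrix a \<xi>"
  shows "(A *v y) \<bullet> ((2 * f\<^sup>2 / s) *\<^sub>R (H *v \<xi>) - ((norm \<xi>)\<^sup>2 * f\<^sup>2 / s\<^sup>2) *\<^sub>R y + (2 * (norm \<xi>)\<^sup>2 * f / s) *\<^sub>R p)
    - 2 * f * ((A *v (H *v \<xi>)) \<bullet> p) \<le> f\<^sup>2 * ((A *v (H *v \<nu>)) \<bullet> (H *v \<nu>)) + (norm \<xi>)\<^sup>2 * ((A *v p) \<bullet> p)"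
proof -
  let ?N = "norm \<xi>"
  have N: "0 < ?N" using \<xi> by simp
  have H\<xi>: "H *v \<xi> = ?N *\<^sub>R (H *v \<nu>)" using N by (simp add: \<nu>_def flip: matrix_vector_mult_scaleR)
  define G where "G y z = (A *v y) \<bullet> z" for y z
  have comm: "G y z = G z y" for y z
    by (simp only: G_def A_def coeff_matrix_inner inner_commute[of y z] mult_ac)
  have add: "G (y + z) v = G y v + G z v" "G (y - z) v = G y v - G z v" "G (r *\<^sub>R y) v = r * G y v" for y z v r
    by (simp_all add: G_def matrix_vector_right_distrib matrix_vector_mult_diff_distrib matrix_vector_mult_scaleR inner_add_left inner_diff_left)
  have add': "G v (y + z) = G v y + G v z" "G v (y - z) = G v y - G v z" "G v (r *\<^sub>R y) = r * G v y" for y z v r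
    by (simp_all add: G_def inner_add_right inner_diff_right)
  define c where "c = ?N * f / s"
  let ?h = "H *v \<nu>"
  let ?Z = "f *\<^sub>R ?h + ?N *\<^sub>R p"
  have "0 \<le> G (?Z - c *\<^sub>R y) (?Z - c *\<^sub>R y)"
    unfolding G_def A_def by (rule coeff_matrix_nonneg[OF \<xi> a])
  also have "\<dots> = f\<^sup>2 * G ?h ?h + ?N\<^sup>2 * G p p + 2 * f * ?N * G ?h p - 2 * c * (f * G y ?h + ?N * G y p) + c\<^sup>2 * G y y"
    by (simp add: add add' comm[of p ?h] comm[of ?h y] comm[of p y] power2_eq_square algebra_simps)
  finally have *: "2 * c * (f * G y ?h + ?N * G y p) - c\<^sup>2 * G y y - 2 * f * ?N * G ?h p \<le> f\<^sup>2 * G ?h ?h + ?N\<^sup>2 * G p p" by simp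
  have "(A *v y) \<bullet> ((2 * f\<^sup>2 / s) *\<^sub>R (H *v \<xi>) - (?N\<^sup>2 * f\<^sup>2 / s\<^sup>2) *\<^sub>R y + (2 * ?N\<^sup>2 * f / s) *\<^sub>R p) - 2 * f * ((A *v (H *v \<xi>)) \<bullet> p)
    = 2 * c * (f * G y ?h + ?N * G y p) - c\<^sup>2 * G y y - 2 * f * ?N * G ?h p"
    unfolding H\<xi> G_def[symmetric] by (simp add: add add' c_def power2_eq_square power_divide algebra_simps)
  then show ?thesis using * unfolding G_def by simp
qed

section \<open>The inequality for a single equation\<close>

lemma C1_on_pos_deriv:
  fixes a :: "real \<Rightarrow> real"
  assumes "a C1_differentiable_on {0<..}"
  shows "0 < t \<Longrightarrow> (a has_real_derivative deriv a t) (at t)" "continuous_on {0<..} (deriv a)" "continuous_on {0<..} a"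
proof -
  obtain D where D: "\<And>t. 0 < t \<Longrightarrow> (a has_vector_derivative D t) (at t)" "continuous_on {0<..} D"
    using assms unfolding C1_differentiable_on_def by auto
  have der: "(a has_real_derivative D t) (at t)" if "0 < t" for t
    using D(1)[OF that] by (simp add: has_real_derivative_iff_has_vector_derivative)
  then have eq: "deriv a t = D t" if "0 < t" for t using that DERIV_imp_deriv by blast
  show "0 < t \<Longrightarrow> (a has_real_derivative deriv a t) (at t)" using der eq by simp
  show "continuous_on {0<..} (deriv a)" using continuous_on_cong[OF refl, of "{0<..}" "deriv a" D] eq D(2) by auto
  show "continuous_on {0<..} a"
    using der by (intro continuous_at_imp_continuous_on ballI) (auto intro: DERIV_isCont)
qed

text \<open>The \<open>i\<close>-th component of the vector field \<open>a(|\<nabla>w|) \<nabla>w\<close>.\<close>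

definition flux :: "(real \<Rightarrow> real) \<Rightarrow> (real^'n::finite \<Rightarrow> real) \<Rightarrow> 'n \<Rightarrow> real^'n \<Rightarrow> real" where
  "flux a w i x = a (norm (grad w x)) * partial i w x"

text \<open>The matrix \<open>A(\<nabla>w)\<close> is the derivative of \<open>\<xi> \<mapsto> a(|\<xi>|) \<xi>\<close> at \<open>\<nabla>w\<close>.\<close>

lemma has_derivative_flux:
  fixes w :: "real^'n::finite \<Rightarrow> real"
  assumes a: "a C1_differentiable_on {0<..}" and w: "Ck 2 S w" "x \<in> S" "grad w x \<noteq> 0"
  shows "(flux a w i has_derivative (\<lambda>h. (coeff_matrix a (grad w x) *v (hess w x *v h)) $ i)) (at x)"
proof -
  let ?N = "norm (grad w x)"
  have N: "0 < ?N" using w by simp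
  have "((\<lambda>y. a (norm (grad w y))) has_derivative (\<lambda>h. deriv a ?N * (unit_normal w x \<bullet> (hess w x *v h)))) (at x)"
    using has_derivative_compose[OF has_derivative_norm_grad[OF w]] C1_on_pos_deriv(1)[OF a N]
    unfolding has_field_derivative_def by blast
  from has_derivative_mult[OF this has_derivative_partial_hess[OF w(1,2)]]
  have "(flux a w i has_derivative (\<lambda>h. a ?N * (hess w x *v h) $ i + deriv a ?N * (unit_normal w x \<bullet> (hess w x *v h)) * partial i w x)) (at x)"
    by (simp add: flux_def[abs_def])
  moreover have "a ?N * (hess w x *v h) $ i + deriv a ?N * (unit_normal w x \<bullet> (hess w x *v h)) * partial i w x
     = (coeff_matrix a (grad w x) *v (hess w x *v h)) $ i" for h
    by (simp add: coeff_matrix_mult unit_normal_def grad_def divide_inverse mult_ac)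
  ultimately show ?thesis by simp
qed

lemma continuous_on_hess:
  assumes "Ck 2 S w" shows "continuous_on S (hess w)"
  unfolding hess_def using Ck_1D(2)[OF Ck_2D(2)[OF assms]] by (intro continuous_intros)

lemma continuous_on_matrix_vector_mult:
  fixes M :: "'a::topological_space \<Rightarrow> real^'n::finite^'m::finite"
  assumes "continuous_on S M" "continuous_on S v"
  shows "continuous_on S (\<lambda>x. M x *v v x)"
  unfolding matrix_vector_mult_def using assms by (intro continuous_intros)

lemma continuous_on_norm_grad:
  assumes "Ck 2 S w" shows "continuous_on S (\<lambda>x. norm (grad w x))"
  using Ck_1D(3)[OF Ck_2D(1)[OF assms]] by (intro continuous_intros)

lemma continuous_on_coeff:
  fixes a :: "real \<Rightarrow> real"
  assumes a: "a C1_differentiable_on {0<..}" and w: "Ck 2 S w" "\<And>x. x \<in> S \<Longrightarrow> grad w x \<noteq> 0"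
  shows "continuous_on S (\<lambda>x. a (norm (grad w x)))" "continuous_on S (\<lambda>x. deriv a (norm (grad w x)))"
  using w by (auto intro!: continuous_on_compose2[OF C1_on_pos_deriv(3)[OF a]] continuous_on_compose2[OF C1_on_pos_deriv(2)[OF a]] continuous_on_norm_grad)

lemma Ck_1_flux:
  fixes w :: "real^'n::finite \<Rightarrow> real"
  assumes a: "a C1_differentiable_on {0<..}" and w: "Ck 2 S w" "\<And>x. x \<in> S \<Longrightarrow> grad w x \<noteq> 0"
  shows "Ck (Suc 0) S (flux a w i)"
proof -
  have "continuous_on S (\<lambda>x. (coeff_matrix a (grad w x) *v (hess w x *v axis j 1)) $ i)" for j
    unfolding coeff_matrix_mult using w
    by (intro continuous_intros continuous_on_matrix_vector_mult continuous_on_hess[OF w(1)] continuous_on_coeff[OF a w]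
        Ck_1D(3)[OF Ck_2D(1)[OF w(1)]]) auto
  moreover have "partial j (flux a w i) x = (coeff_matrix a (grad w x) *v (hess w x *v axis j 1)) $ i" if "x \<in> S" for j x
    using has_derivative_partial[OF has_derivative_flux[OF a w(1) that w(2)[OF that]]] .
  ultimately have "continuous_on S (partial j (flux a w i))" for j by (simp cong: continuous_on_cong)
  moreover have "flux a w i differentiable (at x)" if "x \<in> S" for x
    using has_derivative_flux[OF a w(1) that w(2)[OF that]] by (auto simp: differentiable_def)
  ultimately show ?thesis by simp
qed

lemma integrable_continuous_mult_bounded:
  fixes c p :: "'a::euclidean_space \<Rightarrow> real"
  assumes K: "compact K" "continuous_on K c" and p: "p \<in> borel_measurable borel" "\<And>x. \<bar>p x\<bar> \<le> B"
  shows "integrable lborel (\<lambda>x. indicator K x *\<^sub>R c x * p x)"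
proof -
  obtain C where "\<forall>y\<in>c ` K. norm y \<le> C"
    using compact_imp_bounded[OF compact_continuous_image[OF K(2,1)]] bounded_iff by metis
  then have C: "\<And>x. x \<in> K \<Longrightarrow> \<bar>c x\<bar> \<le> C" by simp
  have B: "0 \<le> B" using p(2)[of undefined] by linarith
  have [measurable]: "(\<lambda>x. indicator K x *\<^sub>R c x) \<in> borel_measurable borel"
    using borel_measurable_integrable[OF borel_integrable_compact[OF K]] by simp
  show ?thesis
  proof (rule integrable_compact_bounded[OF _ K(1)])
    show "(\<lambda>x. indicator K x *\<^sub>R c x * p x) \<in> borel_measurable borel" using p(1) by measurable
    show "\<bar>indicator K x *\<^sub>R c x * p x\<bar> \<le> max 0 C * B" for x
      unfolding abs_mult using C[of x] p(2)[of x] B by (intro mult_mono) (auto simp: indicator_def)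
  qed auto
qed

lemma quadratic_form_sum:
  "N\<^sup>2 * ((coeff_matrix a \<xi> *v P) \<bullet> P) = (\<Sum>h\<in>UNIV. \<Sum>k\<in>UNIV. (N\<^sup>2 * coeff_matrix a \<xi> $ h $ k) * (P $ k * P $ h))"
  by (simp add: inner_vec_def matrix_vector_mult_def sum_distrib_left sum_distrib_right mult_ac)

text \<open>The inequality for one equation \<open>div (a(|\<nabla>w|) \<nabla>w) = G\<close> with a remainder \<open>\<integral> \<Theta>\<close> that involves only
  \<open>\<nabla>G\<close>. The equation differentiated in the direction \<open>j\<close> is tested with \<open>\<partial>\<^sub>jw \<phi>\<^sup>2\<close>, summed over \<open>j\<close>,
  and subtracted from the equation differentiated in the direction \<open>n\<close> and tested with
  \<open>|\<nabla>w|\<^sup>2 \<phi>\<^sup>2 / \<partial>\<^sub>nw\<close>. The right-hand sides combine to \<open>\<integral> \<Theta>\<close>, and the left-hand sides are estimated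
  pointwise by \<open>curvature_terms_le\<close> and \<open>picone_pointwise\<close>. The sign of \<open>\<partial>\<^sub>nw\<close> plays no role here.\<close>

lemma poincare_inequality_with_remainder:
  fixes w \<phi> G :: "real^'n::finite \<Rightarrow> real" and n :: 'n
  assumes S: "open S" and a: "a C1_differentiable_on {0<..}"
    and a_pos: "\<And>t. 0 < t \<Longrightarrow> 0 < a t \<and> 0 < a t + deriv a t * t"
    and weak: "weak_solution S a w G" and w: "Ck 2 S w" and G: "locally_lipschitz_on S G"
    and wn: "\<And>x. x \<in> S \<Longrightarrow> partial n w x \<noteq> 0"
    and phi_lip: "locally_lipschitz_on S \<phi>" and phi_supp: "compact_support_in S \<phi>"
  defines "\<Theta> \<equiv> (\<lambda>x. if x \<in> S then ((\<Sum>j\<in>UNIV. dir_deriv (axis j 1) G x * partial j w x)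
                    - dir_deriv (axis n 1) G x * ((norm (grad w x))\<^sup>2 / partial n w x)) * (\<phi> x)\<^sup>2 else 0)"
  shows "integrable lborel \<Theta>"
    "(LINT x:S|lebesgue.
        (eig1 a (norm (grad w x)) * (norm (tangential_grad w (\<lambda>y. norm (grad w y)) x))\<^sup>2
         + eig2 a (norm (grad w x)) * (norm (grad w x))\<^sup>2
           * (\<Sum>\<kappa>\<in>#principal_curvatures w x. \<kappa>\<^sup>2)) * (\<phi> x)\<^sup>2) + (LINT x|lborel. \<Theta> x)
     \<le> (LINT x:S|lebesgue.
          (norm (grad w x))\<^sup>2 * ((coeff_matrix a (grad w x) *v grad \<phi> x) \<bullet> grad \<phi> x))"
proof -
  have gw: "grad w x \<noteq> 0" if "x \<in> S" for x
    using wn[OF that] by (auto simp: grad_def vec_eq_iff)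
  have w1: "Ck (Suc 0) S w" and w1i: "\<And>i. Ck (Suc 0) S (partial i w)" using Ck_2D[OF w] by auto
  note sol = Ck_1_flux[OF a w gw]
  define K where "K = closure {x \<in> S. \<phi> x \<noteq> 0}"
  have K: "compact K" "K \<subseteq> S" using phi_supp by (auto simp: compact_support_in_def K_def)
  have \<phi>0: "\<phi> x = 0" if "x \<in> S" "x \<notin> K" for x
    using that closure_subset[of "{x \<in> S. \<phi> x \<noteq> 0}"] by (auto simp: K_def)
  \<comment> \<open>\<open>P\<close> is the gradient of the zero extension \<open>f\<close> of \<open>\<phi>\<close> wherever its components exist, which is
    almost everywhere.\<close>
  define f where "f x = (if x \<in> S then \<phi> x else 0)" for x
  have lf: "lipschitz_compact f"
    unfolding f_def by (rule lipschitz_compact_zero_extension[OF S phi_lip K \<phi>0])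
  have f0: "f x = 0" if "x \<notin> K" for x using \<phi>0 that by (auto simp: f_def)
  have fS: "dir_diff v f x = dir_diff v \<phi> x" "dir_deriv v f x = dir_deriv v \<phi> x" if "x \<in> S" for v x
    using dir_cong[OF S that, of f \<phi> v] by (auto simp: f_def)
  define P where "P x = (\<chi> i. dir_deriv (axis i 1) f x)" for x

  have Gc: "continuous_on S G"
  proof (rule continuous_at_imp_continuous_on, rule ballI)
    fix x assume x: "x \<in> S"
    obtain r C where r: "0 < r" "C-lipschitz_on (ball x r \<inter> S) G" using G x unfolding locally_lipschitz_on_def by blast
    have "continuous_on (ball x r \<inter> S) G" using r(2) by (rule lipschitz_on_continuous_on)
    then show "isCont G x" using continuous_on_eq_continuous_at[OF open_Int[OF open_ball S], of x r G] x r(1) by auto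
  qed
  have div: "(\<Sum>i\<in>UNIV. partial i (flux a w i) x) = G x" if "x \<in> S" for x
  proof (rule divergence_eq_if_weak[OF S sol Gc _ that])
    fix \<psi> assume "\<psi> \<in> test_functions S"
    then have "(LINT x:S|lebesgue. a (norm (grad w x)) * (grad w x \<bullet> grad \<psi> x) + G x * \<psi> x) = 0"
      using weak unfolding weak_solution_def by blast
    moreover have "a (norm (grad w x)) * (grad w x \<bullet> grad \<psi> x) = (\<Sum>i\<in>UNIV. flux a w i x * partial i \<psi> x)" for x
      by (simp add: flux_def inner_vec_def grad_def sum_distrib_left mult_ac)
    ultimately show "(LINT x:S|lebesgue. (\<Sum>i\<in>UNIV. flux a w i x * partial i \<psi> x) + G x * \<psi> x) = 0" by simp
  qed

  \<comment> \<open>\<open>q\<close> is the factor of \<open>\<phi>\<^sup>2\<close> in the second test function, and \<open>g\<close> its gradient.\<close>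
  define q where "q x = (norm (grad w x))\<^sup>2 / partial n w x" for x
  define g where "g x = (2 / partial n w x) *\<^sub>R (hess w x *v grad w x) - ((norm (grad w x))\<^sup>2 / (partial n w x)\<^sup>2) *\<^sub>R (hess w x *v axis n 1)" for x
  have qd: "(q has_derivative (\<lambda>h. g x \<bullet> h)) (at x)" if x: "x \<in> S" for x
  proof -
    have sym: "(hess w x *v y) \<bullet> z = y \<bullet> (hess w x *v z)" for y z
      by (rule inner_symmetric_matrix[OF hess_symmetric[OF S w x]])
    have "((\<lambda>x. (norm (grad w x))\<^sup>2) has_derivative (\<lambda>h. 2 * (grad w x \<bullet> (hess w x *v h)))) (at x)"
      unfolding power2_norm_eq_inner
      by (rule has_derivative_eq_rhs[OF has_derivative_inner[OF has_derivative_grad_hess[OF w x] has_derivative_grad_hess[OF w x]]])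
        (simp add: inner_commute)
    from has_derivative_divide'[OF this has_derivative_partial_hess[OF w x] wn[OF x]]
    have "(q has_derivative (\<lambda>h. (2 * (grad w x \<bullet> (hess w x *v h)) * partial n w x - (norm (grad w x))\<^sup>2 * (hess w x *v h) $ n) / (partial n w x * partial n w x))) (at x)"
      by (simp add: q_def[abs_def])
    moreover have "(2 * (grad w x \<bullet> (hess w x *v h)) * partial n w x - (norm (grad w x))\<^sup>2 * (hess w x *v h) $ n) / (partial n w x * partial n w x) = g x \<bullet> h" for h
    proof -
      have "(hess w x *v axis n 1) \<bullet> h = (hess w x *v h) $ n"
        unfolding sym by (simp add: inner_axis')
      then show ?thesis using wn[OF x] by (simp add: g_def inner_diff_left sym field_simps power2_eq_square)
    qed
    ultimately show ?thesis by simp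
  qed
  have gc: "continuous_on S g"
    unfolding g_def using wn
    by (intro continuous_intros continuous_on_matrix_vector_mult continuous_on_hess[OF w] Ck_1D(2,3)[OF w1]) auto
  have ql: "locally_lipschitz_on S q" by (rule C1_locally_lipschitz[OF S qd gc])
  define \<psi>1 where "\<psi>1 j x = (if x \<in> S then partial j w x * (\<phi> x * \<phi> x) else 0)" for j x
  define \<psi>2 where "\<psi>2 x = (if x \<in> S then q x * (\<phi> x * \<phi> x) else 0)" for x
  have l1: "lipschitz_compact (\<psi>1 j)" for j
    unfolding \<psi>1_def
    by (intro lipschitz_compact_zero_extension[OF S _ K] locally_lipschitz_on_mult phi_lip Ck_1_locally_lipschitz[OF S w1i]) (simp add: \<phi>0)
  have l2: "lipschitz_compact \<psi>2"
    unfolding \<psi>2_def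
    by (intro lipschitz_compact_zero_extension[OF S _ K] locally_lipschitz_on_mult phi_lip ql) (simp add: \<phi>0)
  have z1: "\<psi>1 j x = 0" and z2: "\<psi>2 x = 0" if "x \<notin> K" for j x using \<phi>0 that by (auto simp: \<psi>1_def \<psi>2_def)
  note e1 = linearized_equation[OF S sol G div K l1 z1]
  note e2 = linearized_equation[OF S sol G div K l2 z2]
  let ?I1 = "\<lambda>j x. \<Sum>i\<in>UNIV. partial j (flux a w i) x * dir_deriv (axis i 1) (\<psi>1 j) x"
  let ?I2 = "\<lambda>x. \<Sum>i\<in>UNIV. partial n (flux a w i) x * dir_deriv (axis i 1) \<psi>2 x"
  define D where "D x = ?I2 x - (\<Sum>j\<in>UNIV. ?I1 j x)" for x
  have \<Theta>: "\<Theta> = (\<lambda>x. (\<Sum>j\<in>UNIV. dir_deriv (axis j 1) G x * \<psi>1 j x) - dir_deriv (axis n 1) G x * \<psi>2 x)"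
    unfolding \<Theta>_def q_def[symmetric]
    by (auto simp: \<psi>1_def \<psi>2_def fun_eq_iff left_diff_distrib sum_distrib_right power2_eq_square mult.assoc)
  show int\<Theta>: "integrable lborel \<Theta>"
    unfolding \<Theta> by (intro Bochner_Integration.integrable_diff Bochner_Integration.integrable_sum e1(2) e2(2))
  have intD: "integrable lborel D"
    unfolding D_def[abs_def] by (intro Bochner_Integration.integrable_diff Bochner_Integration.integrable_sum[of UNIV lborel ?I1] e1(1) e2(1))
  have D\<Theta>: "(LINT x|lborel. D x) = (LINT x|lborel. \<Theta> x)"
  proof -
    have "(LINT x|lborel. D x) = (LINT x|lborel. ?I2 x) - (\<Sum>j\<in>UNIV. LINT x|lborel. ?I1 j x)"
      unfolding D_def using e1(1) e2(1)
      by (subst Bochner_Integration.integral_diff) (auto intro!: Bochner_Integration.integrable_sum[of UNIV lborel ?I1] Bochner_Integration.integral_sum[of UNIV lborel ?I1])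
    also have "\<dots> = (\<Sum>j\<in>UNIV. LINT x|lborel. dir_deriv (axis j 1) G x * \<psi>1 j x) - (LINT x|lborel. dir_deriv (axis n 1) G x * \<psi>2 x)"
      by (simp add: e1(3) e2(3) sum_negf)
    also have "\<dots> = (LINT x|lborel. \<Theta> x)"
      unfolding \<Theta> using e1(2) e2(2) by simp
    finally show ?thesis .
  qed

  define R where "R x = (norm (grad w x))\<^sup>2 * ((coeff_matrix a (grad w x) *v P x) \<bullet> P x)" for x
  have P0: "P x = 0" if "x \<notin> K" for x
    using dir_deriv_outside_support[OF compact_imp_closed[OF K(1)] f0 that] by (simp add: P_def vec_eq_iff)
  have R_eq: "R x = (\<Sum>h\<in>UNIV. \<Sum>k\<in>UNIV. indicator K x *\<^sub>R ((norm (grad w x))\<^sup>2 * coeff_matrix a (grad w x) $ h $ k) * (P x $ k * P x $ h))" for x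
    unfolding R_def quadratic_form_sum by (cases "x \<in> K") (simp_all add: P0)
  have intR: "integrable lborel R"
    unfolding R_eq[abs_def]
  proof (intro Bochner_Integration.integrable_sum)
    fix h k :: 'n
    have "\<forall>i. \<exists>B. (\<forall>x. \<bar>dir_deriv (axis i 1) f x\<bar> \<le> B) \<and> 0 \<le> B" by (metis lipschitz_compact_dir_deriv_bound[OF lf])
    then obtain B where B: "\<And>i x. \<bar>P x $ i\<bar> \<le> B i" "\<And>i. 0 \<le> B i" unfolding P_def by (simp, metis)
    show "integrable lborel (\<lambda>x. indicator K x *\<^sub>R ((norm (grad w x))\<^sup>2 * coeff_matrix a (grad w x) $ h $ k) * (P x $ k * P x $ h))"
    proof (rule integrable_continuous_mult_bounded[OF K(1)])
      have "continuous_on S (\<lambda>x. (norm (grad w x))\<^sup>2 * coeff_matrix a (grad w x) $ h $ k)"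
        unfolding coeff_matrix_def vec_lambda_beta using gw
        by (intro continuous_intros continuous_on_coeff[OF a w gw] Ck_1D(3)[OF w1]) auto
      then show "continuous_on K (\<lambda>x. (norm (grad w x))\<^sup>2 * coeff_matrix a (grad w x) $ h $ k)"
        using K(2) continuous_on_subset by blast
      show "(\<lambda>x. P x $ k * P x $ h) \<in> borel_measurable borel"
        using lipschitz_compact_borel_dir[OF lf] by (simp add: P_def)
      show "\<bar>P x $ k * P x $ h\<bar> \<le> B k * B h" for x
        unfolding abs_mult using B by (intro mult_mono) auto
    qed
  qed
  have aeS: "AE x in lborel. \<forall>i. dir_diff (axis i 1) f x"
    by (subst AE_all_countable) (intro allI lipschitz_compact_dir_diff_AE lf)
  have RHS: "(LINT x:S|lebesgue. (norm (grad w x))\<^sup>2 * ((coeff_matrix a (grad w x) *v grad \<phi> x) \<bullet> grad \<phi> x)) = (LINT x|lborel. R x)"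
  proof (rule set_lebesgue_integral_eq_lborel(1))
    show "R \<in> borel_measurable borel" using intR by auto
    show "AE x in lborel. (if x \<in> S then (norm (grad w x))\<^sup>2 * ((coeff_matrix a (grad w x) *v grad \<phi> x) \<bullet> grad \<phi> x) else 0) = R x"
      using aeS
    proof eventually_elim
      case (elim x)
      show ?case
      proof (cases "x \<in> S")
        case True
        then have "grad \<phi> x = P x" using elim fS[OF True] by (simp add: grad_def P_def partial_eq_dir_deriv)
        then show ?thesis using True by (simp add: R_def)
      next
        case False
        then have "P x = 0" using P0[of x] K(2) by auto
        then show ?thesis using False by (simp add: R_def)
      qed
    qed
  qed

  let ?E = "\<lambda>x. (eig1 a (norm (grad w x)) * (norm (tangential_grad w (\<lambda>y. norm (grad w y)) x))\<^sup>2
         + eig2 a (norm (grad w x)) * (norm (grad w x))\<^sup>2 * (\<Sum>\<kappa>\<in>#principal_curvatures w x. \<kappa>\<^sup>2))"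
  have E0: "0 \<le> ?E x" if "x \<in> S" for x
  proof -
    have "0 \<le> (\<Sum>\<kappa>\<in>#principal_curvatures w x. \<kappa>\<^sup>2)"
      unfolding sum_mset_eq_sum_count by (intro sum_nonneg) simp
    then show ?thesis using a_pos[of "norm (grad w x)"] gw[OF that] by (simp add: eig1_def eig2_def)
  qed
  have point: "AE x in lborel. indicator S x *\<^sub>R (?E x * (\<phi> x)\<^sup>2) \<le> R x - D x"
    using aeS
  proof eventually_elim
    case (elim x)
    show ?case
    proof (cases "x \<in> S")
      case False
      then have xK: "x \<notin> K" using K by auto
      have "dir_deriv v \<psi>2 x = 0" "dir_deriv v (\<psi>1 j) x = 0" for v j
        using dir_deriv_outside_support[OF compact_imp_closed[OF K(1)] z2 xK] dir_deriv_outside_support[OF compact_imp_closed[OF K(1)] z1 xK] by auto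
      then show ?thesis using False P0[OF xK] by (simp add: D_def R_def)
    next
      case x: True
      let ?\<xi> = "grad w x" and ?H = "hess w x" and ?A = "coeff_matrix a (grad w x)" and ?s = "partial n w x" and ?N = "norm (grad w x)"
      have \<xi>: "?\<xi> \<noteq> 0" using gw[OF x] .
      have pos: "0 < a ?N \<and> 0 < a ?N + deriv a ?N * ?N" using a_pos \<xi> by simp
      have d\<phi>: "dir_diff (axis i 1) \<phi> x" "dir_deriv (axis i 1) \<phi> x = P x $ i" for i
        using elim fS[OF x] by (auto simp: P_def)
      have Hs: "(?H *v axis j 1) $ i = (?H *v axis i 1) $ j" for i j
        using inner_symmetric_matrix[OF hess_symmetric[OF S w x], of "axis j 1" "axis i 1"] by (simp add: inner_axis inner_axis')
      have pj: "dir_deriv (axis i 1) (partial j w) x = (?H *v axis j 1) $ i" for i j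
        using has_derivative_dir(2)[OF has_derivative_partial_hess[OF w x], of "axis i 1" j] Hs by simp
      have d1: "dir_deriv (axis i 1) (\<psi>1 j) x = ((\<phi> x)\<^sup>2 *\<^sub>R (?H *v axis j 1) + (2 * partial j w x * \<phi> x) *\<^sub>R P x) $ i" for i j
      proof -
        have "dir_deriv (axis i 1) (\<psi>1 j) x = dir_deriv (axis i 1) (\<lambda>x. partial j w x * (\<phi> x * \<phi> x)) x"
          by (rule dir_cong(2)[OF S x]) (simp add: \<psi>1_def)
        also have "\<dots> = dir_deriv (axis i 1) (partial j w) x * (\<phi> x * \<phi> x) + partial j w x * (P x $ i * \<phi> x + \<phi> x * P x $ i)"
          using dir_deriv_mult[OF has_derivative_dir(1)[OF has_derivative_partial_hess[OF w x]] dir_deriv_mult(1)[OF d\<phi>(1) d\<phi>(1)]]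
            dir_deriv_mult(2)[OF d\<phi>(1) d\<phi>(1)] d\<phi>(2) by simp
        finally show ?thesis by (simp add: pj power2_eq_square algebra_simps)
      qed
      have d2: "dir_deriv (axis i 1) \<psi>2 x = ((\<phi> x)\<^sup>2 *\<^sub>R g x + (2 * q x * \<phi> x) *\<^sub>R P x) $ i" for i
      proof -
        have "dir_deriv (axis i 1) \<psi>2 x = dir_deriv (axis i 1) (\<lambda>x. q x * (\<phi> x * \<phi> x)) x"
          by (rule dir_cong(2)[OF S x]) (simp add: \<psi>2_def)
        also have "\<dots> = dir_deriv (axis i 1) q x * (\<phi> x * \<phi> x) + q x * (P x $ i * \<phi> x + \<phi> x * P x $ i)"
          using dir_deriv_mult[OF has_derivative_dir(1)[OF qd[OF x]] dir_deriv_mult(1)[OF d\<phi>(1) d\<phi>(1)]]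
            dir_deriv_mult(2)[OF d\<phi>(1) d\<phi>(1)] d\<phi>(2) by simp
        also have "dir_deriv (axis i 1) q x = g x $ i" using has_derivative_dir(2)[OF qd[OF x]] by (simp add: inner_axis)
        finally show ?thesis by (simp add: power2_eq_square algebra_simps)
      qed
      have pT: "partial j (flux a w i) x = (?A *v (?H *v axis j 1)) $ i" for i j
        using has_derivative_partial[OF has_derivative_flux[OF a w x \<xi>]] .
      have sumi: "(\<Sum>i\<in>UNIV. y $ i * z $ i) = y \<bullet> z" for y z :: "real^'n" by (simp add: inner_vec_def)
      have I2: "?I2 x = (?A *v (?H *v axis n 1)) \<bullet> ((2 * (\<phi> x)\<^sup>2 / ?s) *\<^sub>R (?H *v ?\<xi>) - (?N\<^sup>2 * (\<phi> x)\<^sup>2 / ?s\<^sup>2) *\<^sub>R (?H *v axis n 1) + (2 * ?N\<^sup>2 * \<phi> x / ?s) *\<^sub>R P x)"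
        unfolding pT d2 sumi by (simp add: g_def q_def algebra_simps inner_diff_right)
      have "?I1 j x = (\<phi> x)\<^sup>2 * ((?A *v (?H *v axis j 1)) \<bullet> (?H *v axis j 1)) + 2 * \<phi> x * (partial j w x * ((?A *v (?H *v axis j 1)) \<bullet> P x))" for j
        unfolding pT d1 sumi by (simp add: inner_add_right)
      then have "(\<Sum>j\<in>UNIV. ?I1 j x) = (\<phi> x)\<^sup>2 * (\<Sum>j\<in>UNIV. (?A *v (?H *v axis j 1)) \<bullet> (?H *v axis j 1))
          + 2 * \<phi> x * (\<Sum>j\<in>UNIV. partial j w x * ((?A *v (?H *v axis j 1)) \<bullet> P x))"
        by (simp add: sum.distrib sum_distrib_left)
      also have "(\<Sum>j\<in>UNIV. partial j w x * ((?A *v (?H *v axis j 1)) \<bullet> P x)) = (?A *v (?H *v ?\<xi>)) \<bullet> P x"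
      proof -
        have "?A *v (?H *v (\<Sum>j\<in>UNIV. ?\<xi> $ j *\<^sub>R axis j 1)) = (\<Sum>j\<in>UNIV. ?\<xi> $ j *\<^sub>R (?A *v (?H *v axis j 1)))"
          by (simp add: linear_sum[OF matrix_vector_mul_linear] matrix_vector_mult_scaleR)
        then show ?thesis unfolding vec_expansion by (simp add: inner_sum_left grad_def)
      qed
      finally have I1: "(\<Sum>j\<in>UNIV. ?I1 j x) = (\<phi> x)\<^sup>2 * (\<Sum>j\<in>UNIV. (?A *v (?H *v axis j 1)) \<bullet> (?H *v axis j 1)) + 2 * \<phi> x * ((?A *v (?H *v ?\<xi>)) \<bullet> P x)" .
      have \<nu>: "?\<xi> /\<^sub>R norm ?\<xi> = unit_normal w x" by (simp add: unit_normal_def)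
      have "(\<phi> x)\<^sup>2 * ?E x \<le> (\<phi> x)\<^sup>2 * ((\<Sum>j\<in>UNIV. (?A *v (?H *v axis j 1)) \<bullet> (?H *v axis j 1)) - (?A *v (?H *v unit_normal w x)) \<bullet> (?H *v unit_normal w x))"
        using curvature_terms_le[OF S w x \<xi> pos] by (rule mult_left_mono) simp
      then show ?thesis
        using picone_pointwise[OF \<xi> pos wn[OF x], of "?H *v axis n 1" "\<phi> x" ?H "P x"] x
        unfolding \<nu> D_def I1 I2 R_def by (simp add: right_diff_distrib mult.commute)
    qed
  qed
  \<comment> \<open>The measurability of the sum of squared curvatures is not needed: the integrand is nonnegative,
    and the integral of a function that is not integrable is \<open>0\<close> by convention.\<close>
  have "(LINT x:S|lebesgue. ?E x * (\<phi> x)\<^sup>2) \<le> (LINT x|lebesgue. R x - D x)"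
    unfolding set_lebesgue_integral_def
  proof (rule integral_mono_AE')
    show "integrable lebesgue (\<lambda>x. R x - D x)"
      using intR intD by (subst integrable_completion) auto
    show "AE x in lebesgue. indicator S x *\<^sub>R (?E x * (\<phi> x)\<^sup>2) \<le> R x - D x" using AE_completion[OF point] .
    then show "AE x in lebesgue. 0 \<le> R x - D x"
    proof eventually_elim
      case (elim x)
      have "0 \<le> indicator S x *\<^sub>R (?E x * (\<phi> x)\<^sup>2)"
      proof (cases "x \<in> S")
        case True
        then show ?thesis using mult_nonneg_nonneg[OF E0[OF True] zero_le_power2[of "\<phi> x"]] by simp
      qed simp
      then show ?case using elim by linarith
    qed
  qed
  also have "\<dots> = (LINT x|lborel. R x - D x)" using intR intD by (intro integral_completion) auto
  also have "\<dots> = (LINT x|lborel. R x) - (LINT x|lborel. \<Theta> x)" using intR intD D\<Theta> by simp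
  finally show "(LINT x:S|lebesgue. ?E x * (\<phi> x)\<^sup>2) + (LINT x|lborel. \<Theta> x)
     \<le> (LINT x:S|lebesgue. (norm (grad w x))\<^sup>2 * ((coeff_matrix a (grad w x) *v grad \<phi> x) \<bullet> grad \<phi> x))"
    unfolding RHS by simp
qed

section \<open>The coupled system\<close>

lemma has_derivative_vector_2:
  fixes u v :: "'a::real_normed_vector \<Rightarrow> real"
  assumes "(u has_derivative u') (at x)" "(v has_derivative v') (at x)"
  shows "((\<lambda>y. vector [u y, v y] :: real^2) has_derivative (\<lambda>h. vector [u' h, v' h])) (at x)"
  unfolding vector_2_axis using assms by (auto intro!: derivative_eq_intros)

lemma dist_vector_2_le: "dist (vector [s, t] :: real^2) (vector [s', t']) \<le> \<bar>s - s'\<bar> + \<bar>t - t'\<bar>"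
proof -
  have "vector [s, t] - (vector [s', t'] :: real^2) = (s - s') *\<^sub>R axis 1 1 + (t - t') *\<^sub>R axis 2 1"
    by (simp add: vector_2_axis algebra_simps)
  then have "dist (vector [s, t] :: real^2) (vector [s', t']) \<le> norm ((s - s') *\<^sub>R (axis 1 1 :: real^2)) + norm ((t - t') *\<^sub>R (axis 2 1 :: real^2))"
    unfolding dist_norm by (simp only: norm_triangle_ineq)
  then show ?thesis by simp
qed

lemma locally_lipschitz_on_compose_vector_2:
  fixes f :: "real^2 \<Rightarrow> real" and u v :: "'a::metric_space \<Rightarrow> real"
  assumes f: "locally_lipschitz_on UNIV f" and u: "locally_lipschitz_on S u" and v: "locally_lipschitz_on S v"
  shows "locally_lipschitz_on S (\<lambda>x. f (vector [u x, v x]))"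
  unfolding locally_lipschitz_on_def
proof
  fix x assume x: "x \<in> S"
  let ?p = "\<lambda>x. vector [u x, v x] :: real^2"
  obtain r L where f: "0 < r" "L-lipschitz_on (ball (?p x) r \<inter> UNIV) f" using f unfolding locally_lipschitz_on_def by blast
  obtain s M where u: "0 < s" "M-lipschitz_on (ball x s \<inter> S) u" using u x unfolding locally_lipschitz_on_def by blast
  obtain t N where v: "0 < t" "N-lipschitz_on (ball x t \<inter> S) v" using v x unfolding locally_lipschitz_on_def by blast
  have nn: "0 \<le> L" "0 \<le> M" "0 \<le> N" using f u v lipschitz_on_nonneg by blast+
  define d where "d = min (min s t) (r / (M + N + 1))"
  have d: "0 < d" using f u v nn by (simp add: d_def)
  have p: "dist (?p y) (?p z) \<le> (M + N) * dist y z" if "y \<in> ball x d \<inter> S" "z \<in> ball x d \<inter> S" for y z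
  proof -
    have "\<bar>u y - u z\<bar> \<le> M * dist y z" "\<bar>v y - v z\<bar> \<le> N * dist y z"
      using lipschitz_onD[OF u(2), of y z] lipschitz_onD[OF v(2), of y z] that by (auto simp: d_def dist_real_def)
    then show ?thesis using dist_vector_2_le[of "u y" "v y" "u z" "v z"] by (simp add: distrib_right)
  qed
  have pb: "?p y \<in> ball (?p x) r" if "y \<in> ball x d \<inter> S" for y
  proof -
    have "dist (?p x) (?p y) \<le> (M + N) * dist x y" using p[of x y] that x d by simp
    also have "\<dots> \<le> (M + N) * d" using that nn by (intro mult_left_mono) auto
    also have "\<dots> < (M + N + 1) * d" using d by simp
    also have "\<dots> \<le> (M + N + 1) * (r / (M + N + 1))" using nn by (intro mult_left_mono) (auto simp: d_def)
    also have "\<dots> = r" using nn by simp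
    finally show ?thesis by simp
  qed
  have "(L * (M + N))-lipschitz_on (ball x d \<inter> S) (\<lambda>x. f (?p x))"
  proof (rule lipschitz_onI)
    fix y z assume yz: "y \<in> ball x d \<inter> S" "z \<in> ball x d \<inter> S"
    have "dist (f (?p y)) (f (?p z)) \<le> L * dist (?p y) (?p z)"
      using pb yz by (intro lipschitz_onD[OF f(2)]) auto
    also have "\<dots> \<le> L * ((M + N) * dist y z)" using p[OF yz] nn by (intro mult_left_mono)
    finally show "dist (f (?p y)) (f (?p z)) \<le> L * (M + N) * dist y z" by (simp add: mult.assoc)
  qed (use nn in auto)
  then show "\<exists>r>0. \<exists>C. C-lipschitz_on (ball x r \<inter> S) (\<lambda>x. f (?p x))" using d by blast
qed

text \<open>For a Lipschitz function, differentiability along a curve depends only on the position and the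
  velocity of the curve.\<close>

lemma locally_lipschitz_derivative_along_curves:
  fixes f :: "'a::real_normed_vector \<Rightarrow> real" and \<gamma> \<delta> :: "real \<Rightarrow> 'a"
  assumes f: "locally_lipschitz_on UNIV f"
    and \<gamma>: "(\<gamma> has_vector_derivative m) (at 0)" and \<delta>: "(\<delta> has_vector_derivative m) (at 0)" and eq: "\<gamma> 0 = \<delta> 0"
    and D: "((\<lambda>t. f (\<gamma> t)) has_real_derivative D) (at 0)"
  shows "((\<lambda>t. f (\<delta> t)) has_real_derivative D) (at 0)"
proof -
  obtain r L where L: "0 < r" "L-lipschitz_on (ball (\<gamma> 0) r \<inter> UNIV) f" using f unfolding locally_lipschitz_on_def by blast
  have c: "((\<lambda>t. \<gamma> t) \<longlongrightarrow> \<gamma> 0) (at 0)" "((\<lambda>t. \<delta> t) \<longlongrightarrow> \<gamma> 0) (at 0)"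
    using has_vector_derivative_continuous[OF \<gamma>] has_vector_derivative_continuous[OF \<delta>] eq by (auto simp: isCont_def)
  have "((\<lambda>t. (\<delta> t - \<gamma> t) /\<^sub>R t) \<longlongrightarrow> 0) (at 0)"
  proof -
    have "((\<lambda>t. \<delta> t - \<gamma> t) has_vector_derivative 0) (at 0)"
      using has_vector_derivative_diff[OF \<delta> \<gamma>] by simp
    then have "((\<lambda>t. norm (\<delta> t - \<gamma> t) * inverse \<bar>t\<bar>) \<longlongrightarrow> 0) (at 0)"
      using eq by (simp add: has_vector_derivative_def has_derivative_at divide_inverse)
    then show ?thesis
      by (subst tendsto_norm_zero_iff[symmetric]) (simp add: mult.commute)
  qed
  then have z: "((\<lambda>t. L * norm ((\<delta> t - \<gamma> t) /\<^sub>R t)) \<longlongrightarrow> 0) (at 0)"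
    by (intro tendsto_mult_right_zero tendsto_norm_zero)
  have "((\<lambda>t. (f (\<delta> t) - f (\<gamma> t)) / t) \<longlongrightarrow> 0) (at 0)"
  proof (rule Lim_null_comparison[OF _ z])
    have "eventually (\<lambda>t. \<gamma> t \<in> ball (\<gamma> 0) r) (at 0)" "eventually (\<lambda>t. \<delta> t \<in> ball (\<gamma> 0) r) (at 0)"
      using topological_tendstoD[OF c(1) open_ball, of "\<gamma> 0" r] topological_tendstoD[OF c(2) open_ball, of "\<gamma> 0" r] L(1) by simp_all
    then show "eventually (\<lambda>t. norm ((f (\<delta> t) - f (\<gamma> t)) / t) \<le> L * norm ((\<delta> t - \<gamma> t) /\<^sub>R t)) (at 0)"
    proof eventually_elim
      case (elim t)
      have "\<bar>f (\<delta> t) - f (\<gamma> t)\<bar> \<le> L * norm (\<delta> t - \<gamma> t)"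
        using lipschitz_onD[OF L(2), of "\<delta> t" "\<gamma> t"] elim by (simp add: dist_norm)
      from mult_left_mono[OF this, of "inverse \<bar>t\<bar>"] show ?case by (simp add: divide_inverse abs_mult mult_ac)
    qed
  qed
  moreover have "((\<lambda>t. (f (\<gamma> t) - f (\<gamma> 0)) / t) \<longlongrightarrow> D) (at 0)"
    using D by (simp add: DERIV_def)
  ultimately have "((\<lambda>t. (f (\<delta> t) - f (\<gamma> t)) / t + (f (\<gamma> t) - f (\<gamma> 0)) / t) \<longlongrightarrow> 0 + D) (at 0)"
    by (rule tendsto_add)
  then show ?thesis by (simp add: DERIV_def eq diff_divide_distrib)
qed

lemma AE_lborel_if_negligible:
  assumes "negligible N" shows "AE x in lborel. x \<notin> N"
proof -
  obtain N' where "N' \<in> null_sets lborel" "N \<subseteq> N'"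
    using assms unfolding negligible_iff_null_sets null_sets_completion_iff2 by auto
  then show ?thesis by (intro AE_I'[of N']) auto
qed

lemma negligible_if_AE_lborel:
  assumes "AE x in lborel. P x" shows "negligible {x. \<not> P x}"
proof -
  obtain N where N: "N \<in> null_sets lborel" "\<And>x. x \<in> space lborel - N \<Longrightarrow> P x" using assms by (rule AE_E3) blast
  then have "negligible N" by (simp add: negligible_iff_null_sets null_sets_completionI)
  then show ?thesis by (rule negligible_subset) (use N(2) in auto)
qed

text \<open>At a point where \<open>\<nabla>u\<close> and \<open>\<nabla>v\<close> are parallel, the curves \<open>(u, v)\<close> along the coordinate lines have
  parallel velocities, so that \<open>\<nabla>(f \<circ> (u, v))\<close> is parallel to \<open>\<nabla>u\<close> wherever it exists. No
  differentiability of \<open>f\<close> itself is required.\<close>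

lemma coupling_rank_1:
  fixes u v :: "real^'n::finite \<Rightarrow> real" and f :: "real^2 \<Rightarrow> real"
  assumes f: "locally_lipschitz_on UNIV f" and u: "u differentiable (at x)" and v: "v differentiable (at x)"
    and un: "partial n u x \<noteq> 0" and vn: "partial n v x \<noteq> 0"
    and rank: "\<And>i j. partial i u x * partial j v x = partial j u x * partial i v x"
    and d: "dir_diff (axis n 1) (\<lambda>x. f (vector [u x, v x])) x"
  shows "dir_deriv (axis j 1) (\<lambda>x. f (vector [u x, v x])) x = partial j u x / partial n u x * dir_deriv (axis n 1) (\<lambda>x. f (vector [u x, v x])) x"
proof -
  let ?p = "\<lambda>x. vector [u x, v x] :: real^2"
  let ?s = "partial j u x / partial n u x"
  have vj: "partial j v x = ?s * partial n v x" using rank[of j n] un by (simp add: field_simps)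
  have curve: "((\<lambda>t. ?p (x + (c * t) *\<^sub>R axis k 1)) has_vector_derivative vector [c * partial k u x, c * partial k v x]) (at 0)" for c k
  proof -
    have "((\<lambda>t. x + (c * t) *\<^sub>R axis k 1) has_derivative (\<lambda>h. (c * h) *\<^sub>R axis k 1)) (at 0)"
      by (auto intro!: derivative_eq_intros)
    moreover have "(?p has_derivative (\<lambda>h. vector [grad u x \<bullet> h, grad v x \<bullet> h])) (at (x + (c * 0) *\<^sub>R axis k 1))"
      using has_derivative_vector_2[OF has_derivative_grad[OF u] has_derivative_grad[OF v]] by simp
    ultimately have "((\<lambda>t. ?p (x + (c * t) *\<^sub>R axis k 1)) has_derivative (\<lambda>h. vector [grad u x \<bullet> ((c * h) *\<^sub>R axis k 1), grad v x \<bullet> ((c * h) *\<^sub>R axis k 1)])) (at 0)"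
      by (rule has_derivative_compose)
    moreover have "vector [grad u x \<bullet> ((c * h) *\<^sub>R axis k 1), grad v x \<bullet> ((c * h) *\<^sub>R axis k 1)] = h *\<^sub>R (vector [c * partial k u x, c * partial k v x] :: real^2)" for h
      by (simp add: vec_eq_iff forall_2 inner_axis grad_def mult_ac)
    ultimately show ?thesis by (simp add: has_vector_derivative_def)
  qed
  have "((\<lambda>t. f (?p (x + t *\<^sub>R axis n 1))) has_real_derivative dir_deriv (axis n 1) (\<lambda>x. f (?p x)) x) (at (?s * 0))"
    using dir_diff_DERIV[OF d] by simp
  then have 1: "((\<lambda>t. f (?p (x + (?s * t) *\<^sub>R axis n 1))) has_real_derivative dir_deriv (axis n 1) (\<lambda>x. f (?p x)) x * ?s) (at 0)"
    by (rule DERIV_chain2) (rule DERIV_cmult_Id)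
  have "?s * partial n u x = partial j u x" using un by simp
  then have 2: "((\<lambda>t. ?p (x + t *\<^sub>R axis j 1)) has_vector_derivative vector [?s * partial n u x, ?s * partial n v x]) (at 0)"
    using curve[of 1 j] vj by (simp only: mult_1)
  have "((\<lambda>t. f (?p (x + t *\<^sub>R axis j 1))) has_real_derivative dir_deriv (axis n 1) (\<lambda>x. f (?p x)) x * ?s) (at 0)"
    by (rule locally_lipschitz_derivative_along_curves[OF f curve[of ?s n] 2 _ 1]) simp
  from dir_derivI(2)[OF this] show ?thesis by (simp add: mult.commute)
qed

lemma coupling_rank_2:
  fixes u v :: "real^'n::finite \<Rightarrow> real" and f :: "real^2 \<Rightarrow> real"
  assumes u: "u differentiable (at x)" and v: "v differentiable (at x)" and f: "f differentiable (at (vector [u x, v x]))"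
  shows "dir_deriv (axis j 1) (\<lambda>x. f (vector [u x, v x])) x
     = partial 1 f (vector [u x, v x]) * partial j u x + partial 2 f (vector [u x, v x]) * partial j v x"
proof -
  let ?y = "vector [u x, v x] :: real^2"
  have "((\<lambda>x. f (vector [u x, v x])) has_derivative (\<lambda>h. grad f ?y \<bullet> vector [grad u x \<bullet> h, grad v x \<bullet> h])) (at x)"
    by (rule has_derivative_compose[OF has_derivative_vector_2[OF has_derivative_grad[OF u] has_derivative_grad[OF v]] has_derivative_grad[OF f]])
  from has_derivative_dir(2)[OF this] show ?thesis
    by (simp add: inner_vec_def[where 'b = 2] sum_2 inner_axis grad_def)
qed

text \<open>With \<open>U = \<nabla>u\<close>, \<open>V = \<nabla>v\<close>, \<open>s = u\<^sub>n\<close>, \<open>t = v\<^sub>n\<close> and the second derivatives \<open>\<alpha>\<close>, \<open>\<beta>\<close>, \<open>\<gamma>\<close> of \<open>F\<close>, the sum of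
  the two remainders is a nonnegative multiple of \<open>\<beta> |t U - s V|\<^sup>2\<close>.\<close>

lemma coupling_sign:
  fixes U V :: "'a::real_inner"
  assumes "0 < s" "t < 0" "0 \<le> \<beta>"
  shows "0 \<le> (\<alpha> * (U \<bullet> U) + \<beta> * (U \<bullet> V) - (\<alpha> * s + \<beta> * t) * ((norm U)\<^sup>2 / s))
    + (\<beta> * (U \<bullet> V) + \<gamma> * (V \<bullet> V) - (\<beta> * s + \<gamma> * t) * ((norm V)\<^sup>2 / t))"
proof -
  have "(\<alpha> * (U \<bullet> U) + \<beta> * (U \<bullet> V) - (\<alpha> * s + \<beta> * t) * ((norm U)\<^sup>2 / s))
    + (\<beta> * (U \<bullet> V) + \<gamma> * (V \<bullet> V) - (\<beta> * s + \<gamma> * t) * ((norm V)\<^sup>2 / t))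
    = \<beta> * ((t *\<^sub>R U - s *\<^sub>R V) \<bullet> (t *\<^sub>R U - s *\<^sub>R V)) / (s * (- t))"
    using assms by (simp add: power2_norm_eq_inner inner_diff_left inner_diff_right inner_commute[of V U] field_simps)
  also have "\<dots> \<ge> 0" using assms by (intro divide_nonneg_nonneg mult_nonneg_nonneg) auto
  finally show ?thesis .
qed

theorem corollary3p3:
  fixes \<Omega> :: "(real^'n::finite) set" and n :: 'n
    and F :: "real^2 \<Rightarrow> real" and a b :: "real \<Rightarrow> real"
    and u v \<phi> :: "real^'n \<Rightarrow> real"
  assumes F: "C11_loc F"
    and a_C1: "a C1_differentiable_on {0<..}" and b_C1: "b C1_differentiable_on {0<..}"
    and a_pos: "\<And>t. 0 < t \<Longrightarrow> 0 < a t \<and> 0 < a t + deriv a t * t"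
    and b_pos: "\<And>t. 0 < t \<Longrightarrow> 0 < b t \<and> 0 < b t + deriv b t * t"
    and "open \<Omega>"
    and weak_sol: "weak_solution_system \<Omega> a b F u v"
    and u_C2: "Ck 2 \<Omega> u" and v_C2: "Ck 2 \<Omega> v"
    and u_W12: "\<And>i. W12_loc \<Omega> (partial i u)" and v_W12: "\<And>i. W12_loc \<Omega> (partial i v)"
    and mono: "\<And>x. x \<in> \<Omega> \<Longrightarrow> partial n u x > 0 \<and> partial n v x < 0"
    and F12: "\<And>x. x \<in> \<Omega> \<Longrightarrow> has_partial 2 (partial 1 F) (vector [u x, v x]) \<Longrightarrow>
                partial 2 (partial 1 F) (vector [u x, v x]) \<ge> 0"
    and phi_lip: "locally_lipschitz_on \<Omega> \<phi>" and phi_supp: "compact_support_in \<Omega> \<phi>"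
  shows
    "(LINT x:\<Omega>|lebesgue.
        (eig1 a (norm (grad u x)) * (norm (tangential_grad u (\<lambda>y. norm (grad u y)) x))\<^sup>2
         + eig2 a (norm (grad u x)) * (norm (grad u x))\<^sup>2
           * (\<Sum>\<kappa>\<in>#principal_curvatures u x. \<kappa>\<^sup>2)) * (\<phi> x)\<^sup>2)
     + (LINT x:\<Omega>|lebesgue.
        (eig1 b (norm (grad v x)) * (norm (tangential_grad v (\<lambda>y. norm (grad v y)) x))\<^sup>2
         + eig2 b (norm (grad v x)) * (norm (grad v x))\<^sup>2
           * (\<Sum>\<kappa>\<in>#principal_curvatures v x. \<kappa>\<^sup>2)) * (\<phi> x)\<^sup>2)
     \<le> (LINT x:\<Omega>|lebesgue.
          (norm (grad u x))\<^sup>2 * ((coeff_matrix a (grad u x) *v grad \<phi> x) \<bullet> grad \<phi> x))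
       + (LINT x:\<Omega>|lebesgue.
          (norm (grad v x))\<^sup>2 * ((coeff_matrix b (grad v x) *v grad \<phi> x) \<bullet> grad \<phi> x))"
proof -
  let ?p = "\<lambda>x. vector [u x, v x] :: real^2"
  define g where "g = (\<lambda>x. partial 1 F (?p x))"
  define h where "h = (\<lambda>x. partial 2 F (?p x))"
  have FL: "locally_lipschitz_on UNIV (partial i F)" and F1: "Ck (Suc 0) UNIV F" for i
    using F by (auto simp: C11_loc_def)
  have u1: "Ck (Suc 0) \<Omega> u" and v1: "Ck (Suc 0) \<Omega> v" using Ck_2D u_C2 v_C2 by blast+
  have uL: "locally_lipschitz_on \<Omega> u" and vL: "locally_lipschitz_on \<Omega> v"
    using Ck_1_locally_lipschitz[OF \<open>open \<Omega>\<close>] u1 v1 by auto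
  have gL: "locally_lipschitz_on \<Omega> g" and hL: "locally_lipschitz_on \<Omega> h"
    unfolding g_def h_def by (intro locally_lipschitz_on_compose_vector_2 FL uL vL)+
  have weak: "weak_solution \<Omega> a u g" "weak_solution \<Omega> b v h"
    using weak_sol by (auto simp: weak_solution_system_def g_def h_def)
  have un: "partial n u x \<noteq> 0" and vn: "partial n v x \<noteq> 0" if "x \<in> \<Omega>" for x
    using mono[OF that] by auto
  note U = poincare_inequality_with_remainder[OF \<open>open \<Omega>\<close> a_C1 a_pos weak(1) u_C2 gL un phi_lip phi_supp]
  note V = poincare_inequality_with_remainder[OF \<open>open \<Omega>\<close> b_C1 b_pos weak(2) v_C2 hL vn phi_lip phi_supp]
  let ?\<Theta>u = "\<lambda>x. if x \<in> \<Omega> then ((\<Sum>j\<in>UNIV. dir_deriv (axis j 1) g x * partial j u x)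
       - dir_deriv (axis n 1) g x * ((norm (grad u x))\<^sup>2 / partial n u x)) * (\<phi> x)\<^sup>2 else 0"
  let ?\<Theta>v = "\<lambda>x. if x \<in> \<Omega> then ((\<Sum>j\<in>UNIV. dir_deriv (axis j 1) h x * partial j v x)
       - dir_deriv (axis n 1) h x * ((norm (grad v x))\<^sup>2 / partial n v x)) * (\<phi> x)\<^sup>2 else 0"
  define K where "K = closure {x \<in> \<Omega>. \<phi> x \<noteq> 0}"
  have K: "compact K" "K \<subseteq> \<Omega>" using phi_supp by (auto simp: compact_support_in_def K_def)
  have \<phi>0: "\<phi> x = 0" if "x \<in> \<Omega>" "x \<notin> K" for x
    using that closure_subset[of "{x \<in> \<Omega>. \<phi> x \<noteq> 0}"] by (auto simp: K_def)
  \<comment> \<open>\<open>\<nabla>F\<close> is differentiable off the null set \<open>N\<close>, whose preimage under \<open>(u, v)\<close> contains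
    almost no point of rank 2, but may well contain every point of rank 1.\<close>
  define N where "N = {y. \<not> (partial 1 F differentiable (at y) \<and> partial 2 F differentiable (at y))}"
  have "AE y in lborel. partial 1 F differentiable (at y) \<and> partial 2 F differentiable (at y)"
    using locally_lipschitz_differentiable_AE[OF FL[of 1]] locally_lipschitz_differentiable_AE[OF FL[of 2]] by eventually_elim simp
  then have "negligible N" unfolding N_def by (rule negligible_if_AE_lborel)
  then have "AE x in lborel. x \<notin> {x \<in> \<Omega>. partial i u x * partial j v x \<noteq> partial j u x * partial i v x \<and> ?p x \<in> N}" for i j
    by (intro AE_lborel_if_negligible negligible_vimage_rank_2 \<open>open \<Omega>\<close> u1 v1)
  then have rank: "AE x in lborel. \<forall>i j. x \<notin> {x \<in> \<Omega>. partial i u x * partial j v x \<noteq> partial j u x * partial i v x \<and> ?p x \<in> N}"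
    by (subst AE_all_countable, intro allI)+
  have "AE x in lborel. 0 \<le> ?\<Theta>u x + ?\<Theta>v x"
    using rank locally_lipschitz_dir_diff_AE[OF \<open>open \<Omega>\<close> gL K, of "axis n 1"] locally_lipschitz_dir_diff_AE[OF \<open>open \<Omega>\<close> hL K, of "axis n 1"]
  proof eventually_elim
    case (elim x)
    show ?case
    proof (cases "x \<in> K")
      case False
      then show ?thesis using \<phi>0 by auto
    next
      case xK: True
      then have x: "x \<in> \<Omega>" using K by auto
      have du: "u differentiable (at x)" and dv: "v differentiable (at x)" using Ck_1D(1)[OF u1 x] Ck_1D(1)[OF v1 x] .
      have gg: "(norm (grad w x))\<^sup>2 = (\<Sum>j\<in>UNIV. partial j w x * partial j w x)" for w :: "real^'n \<Rightarrow> real"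
        unfolding norm_vec_power2 by (simp add: grad_def power2_eq_square)
      have "0 \<le> ((\<Sum>j\<in>UNIV. dir_deriv (axis j 1) g x * partial j u x) - dir_deriv (axis n 1) g x * ((norm (grad u x))\<^sup>2 / partial n u x))
         + ((\<Sum>j\<in>UNIV. dir_deriv (axis j 1) h x * partial j v x) - dir_deriv (axis n 1) h x * ((norm (grad v x))\<^sup>2 / partial n v x))"
      proof (cases "\<forall>i j. partial i u x * partial j v x = partial j u x * partial i v x")
        case True
        have dg: "dir_deriv (axis j 1) g x = partial j u x / partial n u x * dir_deriv (axis n 1) g x" for j
          unfolding g_def using True elim xK
          by (intro coupling_rank_1[OF FL du dv un[OF x] vn[OF x]]) (auto simp: g_def)
        have dh: "dir_deriv (axis j 1) h x = partial j v x / partial n v x * dir_deriv (axis n 1) h x" for j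
        proof -
          have "dir_deriv (axis j 1) h x = partial j u x / partial n u x * dir_deriv (axis n 1) h x"
            unfolding h_def using True elim xK
            by (intro coupling_rank_1[OF FL du dv un[OF x] vn[OF x]]) (auto simp: h_def)
          moreover have "partial j u x / partial n u x = partial j v x / partial n v x"
            using True un[OF x] vn[OF x] by (simp add: field_simps)
          ultimately show ?thesis by simp
        qed
        have "(\<Sum>j\<in>UNIV. dir_deriv (axis j 1) g x * partial j u x) = dir_deriv (axis n 1) g x * ((norm (grad u x))\<^sup>2 / partial n u x)"
        proof -
          have "(\<Sum>j\<in>UNIV. dir_deriv (axis j 1) g x * partial j u x)
              = (\<Sum>j\<in>UNIV. dir_deriv (axis n 1) g x / partial n u x * (partial j u x * partial j u x))"
          proof (rule sum.cong[OF refl])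
            fix j
            show "dir_deriv (axis j 1) g x * partial j u x = dir_deriv (axis n 1) g x / partial n u x * (partial j u x * partial j u x)"
              by (subst dg) simp
          qed
          then show ?thesis unfolding gg by (simp add: sum_distrib_left sum_divide_distrib)
        qed
        moreover have "(\<Sum>j\<in>UNIV. dir_deriv (axis j 1) h x * partial j v x) = dir_deriv (axis n 1) h x * ((norm (grad v x))\<^sup>2 / partial n v x)"
        proof -
          have "(\<Sum>j\<in>UNIV. dir_deriv (axis j 1) h x * partial j v x)
              = (\<Sum>j\<in>UNIV. dir_deriv (axis n 1) h x / partial n v x * (partial j v x * partial j v x))"
          proof (rule sum.cong[OF refl])
            fix j
            show "dir_deriv (axis j 1) h x * partial j v x = dir_deriv (axis n 1) h x / partial n v x * (partial j v x * partial j v x)"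
              by (subst dh) simp
          qed
          then show ?thesis unfolding gg by (simp add: sum_distrib_left sum_divide_distrib)
        qed
        ultimately show ?thesis by simp
      next
        case False
        then have d: "partial 1 F differentiable (at (?p x))" "partial 2 F differentiable (at (?p x))"
          using elim(1) x by (auto simp: N_def)
        have dg: "dir_deriv (axis j 1) g x = partial 1 (partial 1 F) (?p x) * partial j u x + partial 2 (partial 1 F) (?p x) * partial j v x"
          and dh: "dir_deriv (axis j 1) h x = partial 1 (partial 2 F) (?p x) * partial j u x + partial 2 (partial 2 F) (?p x) * partial j v x" for j
          unfolding g_def h_def by (intro coupling_rank_2 du dv d)+
        have sym: "partial 1 (partial 2 F) (?p x) = partial 2 (partial 1 F) (?p x)"
          using Ck_1D(1)[OF F1] d by (intro partial_partial_commute[OF open_UNIV]) auto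
        have pos: "0 \<le> partial 2 (partial 1 F) (?p x)"
          using d(1) by (intro F12[OF x]) (simp add: has_partial_iff dir_deriv_differentiable)
        have sg: "(\<Sum>j\<in>UNIV. (c * partial j u x + d * partial j v x) * partial j w x) = c * (grad u x \<bullet> grad w x) + d * (grad v x \<bullet> grad w x)" for c d w
          by (simp add: inner_vec_def grad_def distrib_right sum.distrib sum_distrib_left mult.assoc)
        show ?thesis
          unfolding dg dh sg unfolding sym
          using coupling_sign[of "partial n u x" "partial n v x" "partial 2 (partial 1 F) (?p x)" "partial 1 (partial 1 F) (?p x)" "grad u x" "grad v x" "partial 2 (partial 2 F) (?p x)"]
            mono[OF x] pos by (simp add: inner_commute)
      qed
      then show ?thesis using x by (simp add: distrib_right[symmetric])
    qed
  qed
  then have "0 \<le> (LINT x|lborel. ?\<Theta>u x + ?\<Theta>v x)" by (rule integral_nonneg_AE)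
  also have "\<dots> = (LINT x|lborel. ?\<Theta>u x) + (LINT x|lborel. ?\<Theta>v x)"
    by (rule Bochner_Integration.integral_add[OF U(1) V(1)])
  finally show ?thesis using U(2) V(2) by linarith
qed

end
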